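(* Let $\Omega \subset \mathbb{R}^2$ be a bounded polygonal domain and let $\{\tau_k\}_{k=1}^\infty$ be a sequence of triangulations of $\Omega$ such that $\lim_{k\to\infty}|\tau_k| = 0$ (no other condition is imposed on the shapes of the triangles). Let $f \in W^{1,\infty}(\Omega)$, let $A_L(f)$ be the surface area of the graph $z=f(x,y)$ over $\Omega$ in the sense of Lebesgue, and let $$A_{\tau_k}^{CR}(f) := \sum_{K\in\tau_k}\int_K \sqrt{1+|\nabla(\mathcal{I}_K^{CR}f)|^2}\,d\mathbf{x}$$ be its approximation by Crouzeix--Raviart interpolation. Then $$\lim_{k\to\infty}A_{\tau_k}^{CR}(f) = A_L(f).$$
   Context: A triangulation $\tau$ of a bounded polygonal domain $\Omega$ is a finite set of (closed, nondegenerate) triangles with $\overline\Omega=\bigcup_{K\in\tau}K$ such that any two distinct $K_1,K_2\in\tau$ are either disjoint or meet exactly in a common vertex or a common edge of both. Its fineness is $|\tau| := \max_{K\in\tau}\operatorname{diam}K$. Crouzeix--Raviart interpolation: let $K$ be a triangle with edges $e_1,e_2,e_3$. For $v\in W^{1,1}(K)$, $\mathcal{I}_K^{CR}v$ is the unique polynomial of degree at most $1$ in two variables such that $\int_{e_i}(v-\mathcal{I}_K^{CR}v)\,ds=0$ for $i=1,2,3$ (boundary values of $v$ in the sense of traces). Here $\mathcal{I}_K^{CR}f$ means $\mathcal{I}_K^{CR}(f|_K)$. Surface area in the sense of Lebesgue: for continuous $f$ on $\overline\Omega$, $A_L(f)$ is the infimum of $\liminf_{n\to\infty}A_E(f_n)$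 over all sequences $\{(f_n,\sigma_n)\}$ in which $\sigma_n$ are triangulations of $\Omega$ with $|\sigma_n|\to0$, $f_n$ is continuous on $\overline\Omega$ and affine on each triangle of $\sigma_n$, and $f_n\to f$ uniformly on $\overline\Omega$, where $A_E(f_n)=\int_\Omega\sqrt{1+|\nabla f_n|^2}\,d\mathbf{x}$ is the elementary area of the polyhedral graph. By Tonelli's theorem, for $f\in W^{1,\infty}(\Omega)$ this area is finite and $$A_L(f)=\int_\Omega\sqrt{1+|\nabla f(\mathbf{x})|^2}\,d\mathbf{x}.$$ *)

theory Defs
  imports "HOL-Analysis.Analysis"
begin

section \<open>Polygonal domains and triangulations\<close>

definition simple_closed_polygon :: "(real^2) set \<Rightarrow> bool" where
  "simple_closed_polygon C \<longleftrightarrow>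
     (\<exists>g. simple_path g \<and> pathfinish g = pathstart g \<and> path_image g = C) \<and>
     (\<exists>S. finite S \<and> C = (\<Union>(a, b)\<in>S. closed_segment a b))"

text \<open>
  The boundary may have several components (holes are allowed). Since it consists of pairwise
  disjoint simple closed polygons, the domain is Lipschitz: slits and boundary components
  touching each other are excluded, and every \<open>W\<^sup>1\<^sup>,\<^sup>\<infinity>\<close> function has a continuous extension
  to the closure.
\<close>
definition polygonal_domain :: "(real^2) set \<Rightarrow> bool" where
  "polygonal_domain \<Omega> \<longleftrightarrow>
     open \<Omega> \<and> connected \<Omega> \<and> \<Omega> \<noteq> {} \<and>
     (\<exists>P. finite P \<and> (\<forall>C\<in>P. simple_closed_polygon C) \<and> pairwise disjnt P \<and> frontier \<Omega> = \<Union>P)"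

text \<open>
  The library predicate \<^const>\<open>triangulation\<close> says that the family is a finite set of closed
  nondegenerate simplices, any two of which meet in a common face (possibly empty). For distinct
  triangles such a face is empty, a common vertex or a common edge.
\<close>
definition triangulation_of :: "(real^2) set \<Rightarrow> (real^2) set set \<Rightarrow> bool" where
  "triangulation_of \<Omega> \<tau> \<longleftrightarrow> triangulation \<tau> \<and> (\<forall>K\<in>\<tau>. 2 simplex K) \<and> \<Union>\<tau> = closure \<Omega>"

definition fineness :: "(real^2) set set \<Rightarrow> real" where
  "fineness \<tau> = Max (diameter ` \<tau>)"


section \<open>Gradients and the Sobolev space of order one\<close>

definition grad :: "(real^2 \<Rightarrow> real) \<Rightarrow> real^2 \<Rightarrow> real^2" where
  "grad f x = (THE D. GDERIV f x :> D)"

definition C1 :: "(real^2 \<Rightarrow> real) \<Rightarrow> bool" where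
  "C1 \<phi> \<longleftrightarrow> (\<exists>D. (\<forall>x. GDERIV \<phi> x :> D x) \<and> continuous_on UNIV D)"

definition test_function :: "(real^2) set \<Rightarrow> (real^2 \<Rightarrow> real) \<Rightarrow> bool" where
  "test_function U \<phi> \<longleftrightarrow>
     C1 \<phi> \<and> compact (closure {x. \<phi> x \<noteq> 0}) \<and> closure {x. \<phi> x \<noteq> 0} \<subseteq> U"

text \<open>
  As in Gilbarg--Trudinger, first order weak derivatives are tested against \<open>C\<^sup>1\<close> functions with
  compact support. Below, \<^term>\<open>u\<close> and \<^term>\<open>G\<close> are always integrable or essentially bounded on a
  bounded set, so that both integrals exist.
\<close>
definition weak_gradient ::
    "(real^2) set \<Rightarrow> (real^2 \<Rightarrow> real) \<Rightarrow> (real^2 \<Rightarrow> real^2) \<Rightarrow> bool" where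
  "weak_gradient U u G \<longleftrightarrow>
     (\<forall>\<phi>. test_function U \<phi> \<longrightarrow>
        (LINT x|lebesgue_on U. u x *\<^sub>R grad \<phi> x) = - (LINT x|lebesgue_on U. \<phi> x *\<^sub>R G x))"

definition L_infinity :: "(real^2) set \<Rightarrow> (real^2 \<Rightarrow> 'b::euclidean_space) \<Rightarrow> bool" where
  "L_infinity U u \<longleftrightarrow>
     u \<in> borel_measurable (lebesgue_on U) \<and> (\<exists>M. AE x in lebesgue_on U. norm (u x) \<le> M)"

text \<open>
  Membership in \<open>W\<^sup>1\<^sup>,\<^sup>\<infinity>(U)\<close>. The function \<^term>\<open>u\<close> represents its class modulo null sets; its
  values outside \<^term>\<open>U\<close> are irrelevant.
\<close>
definition W_1_infinity :: "(real^2) set \<Rightarrow> (real^2 \<Rightarrow> real) \<Rightarrow> bool" where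
  "W_1_infinity U u \<longleftrightarrow> L_infinity U u \<and> (\<exists>G. L_infinity U G \<and> weak_gradient U u G)"

text \<open>
  On a polygonal domain every \<open>W\<^sup>1\<^sup>,\<^sup>\<infinity>\<close> function agrees almost everywhere with a function that is
  continuous on the closure, and the latter is uniquely determined on the closure.
\<close>
definition continuous_rep :: "(real^2) set \<Rightarrow> (real^2 \<Rightarrow> real) \<Rightarrow> real^2 \<Rightarrow> real" where
  "continuous_rep \<Omega> f =
     (SOME g. continuous_on (closure \<Omega>) g \<and> (AE x in lebesgue_on \<Omega>. g x = f x))"


section \<open>Crouzeix--Raviart interpolation\<close>

definition segment_integrable :: "real^2 \<Rightarrow> real^2 \<Rightarrow> (real^2 \<Rightarrow> real) \<Rightarrow> bool" where
  "segment_integrable a b g \<longleftrightarrow> integrable (lebesgue_on {0..1}) (\<lambda>s. g (linepath a b s))"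

text \<open>The integral with respect to arc length.\<close>
definition segment_integral :: "real^2 \<Rightarrow> real^2 \<Rightarrow> (real^2 \<Rightarrow> real) \<Rightarrow> real" where
  "segment_integral a b g = dist a b * (LINT s|lebesgue_on {0..1}. g (linepath a b s))"

text \<open>
  The trace is the continuous extension of the restriction map from \<open>C\<^sup>1\<close> functions up to the
  boundary to \<open>W\<^sup>1\<^sup>,\<^sup>1(K)\<close>, with values in \<open>L\<^sup>1(\<partial>K)\<close>: the first line says that \<^term>\<open>v\<close>
  is in \<open>W\<^sup>1\<^sup>,\<^sup>1(K)\<close>, the next three that \<^term>\<open>\<phi>\<close> tends to \<^term>\<open>v\<close> in this space.
\<close>
definition has_trace :: "(real^2) set \<Rightarrow> (real^2 \<Rightarrow> real) \<Rightarrow> (real^2 \<Rightarrow> real) \<Rightarrow> bool" where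
  "has_trace K v t \<longleftrightarrow>
     (\<exists>G \<phi>. integrable (lebesgue_on (interior K)) v \<and> integrable (lebesgue_on (interior K)) G \<and>
        weak_gradient (interior K) v G \<and>
        (\<forall>n. C1 (\<phi> n)) \<and>
        (\<lambda>n. LINT x|lebesgue_on (interior K). \<bar>\<phi> n x - v x\<bar>) \<longlonglongrightarrow> 0 \<and>
        (\<lambda>n. LINT x|lebesgue_on (interior K). norm (grad (\<phi> n) x - G x)) \<longlonglongrightarrow> 0 \<and>
        (\<forall>a b. closed_segment a b edge_of K \<longrightarrow>
           segment_integrable a b t \<and>
           (\<lambda>n. segment_integral a b (\<lambda>x. \<bar>\<phi> n x - t x\<bar>)) \<longlonglongrightarrow> 0))"

definition boundary_trace :: "(real^2) set \<Rightarrow> (real^2 \<Rightarrow> real) \<Rightarrow> real^2 \<Rightarrow> real" where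
  "boundary_trace K v = (SOME t. has_trace K v t)"

definition CR_interpolant :: "(real^2) set \<Rightarrow> (real^2 \<Rightarrow> real) \<Rightarrow> real^2 \<Rightarrow> real" where
  "CR_interpolant K v =
     (THE p. (\<exists>c w. p = (\<lambda>x. c + w \<bullet> x)) \<and>
        (\<forall>a b. closed_segment a b edge_of K \<longrightarrow>
           segment_integral a b (\<lambda>x. boundary_trace K v x - p x) = 0))"


section \<open>Surface areas\<close>

text \<open>
  For a piecewise affine \<^term>\<open>g\<close> the gradient is unspecified where \<^term>\<open>g\<close> is not
  differentiable, which happens on a null set only.
\<close>
definition elementary_area :: "(real^2) set \<Rightarrow> (real^2 \<Rightarrow> real) \<Rightarrow> real" where
  "elementary_area S g = (LINT x|lebesgue_on S. sqrt (1 + (norm (grad g x))\<^sup>2))"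

definition CR_area :: "(real^2) set set \<Rightarrow> (real^2 \<Rightarrow> real) \<Rightarrow> real" where
  "CR_area \<tau> f = (\<Sum>K\<in>\<tau>. elementary_area K (CR_interpolant K f))"

definition piecewise_affine :: "(real^2) set set \<Rightarrow> (real^2 \<Rightarrow> real) \<Rightarrow> bool" where
  "piecewise_affine \<sigma> g \<longleftrightarrow> (\<forall>K\<in>\<sigma>. \<exists>c w. \<forall>x\<in>K. g x = c + w \<bullet> x)"

text \<open>For functions \<^term>\<open>f\<close> that are continuous on \<^term>\<open>closure \<Omega>\<close>.\<close>
definition Lebesgue_area :: "(real^2) set \<Rightarrow> (real^2 \<Rightarrow> real) \<Rightarrow> ereal" where
  "Lebesgue_area \<Omega> f =
     Inf {liminf (\<lambda>n. ereal (elementary_area \<Omega> (F n))) | F \<sigma>.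
       (\<forall>n. triangulation_of \<Omega> (\<sigma> n)) \<and> (\<lambda>n. fineness (\<sigma> n)) \<longlonglongrightarrow> 0 \<and>
       (\<forall>n. continuous_on (closure \<Omega>) (F n) \<and> piecewise_affine (\<sigma> n) (F n)) \<and>
       uniform_limit (closure \<Omega>) F f sequentially}"

end

theory Submission imports Defs begin

text \<open>
  Let \<open>G\<close> be the weak gradient of \<open>f\<close>. By the divergence theorem the gradient of the
  Crouzeix--Raviart interpolant on a triangle \<open>K\<close> is the mean of \<open>G\<close> over \<open>K\<close>, so that the
  approximate area is the sum of \<open>\<bar>K\<bar> sqrt (1 + \<bar>mean of G over K\<bar>\<^sup>2)\<close>. Means over sets of small
  diameter, whatever their shape, converge to \<open>G\<close> in \<open>L\<^sup>1\<close>, hence these sums tend to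
  the integral of \<open>sqrt (1 + \<bar>G\<bar>\<^sup>2)\<close> over \<open>\<Omega>\<close>. By Jensen's inequality each of them is also a lower bound
  for the limit inferior of the elementary areas of every admissible sequence, because the mean of the
  gradient over \<open>K\<close> passes to uniform limits. Equality follows from a recovery sequence:
  the Lipschitz representative of \<open>f\<close> is extended to the plane, mollified, and
  interpolated on a uniform grid; the interpolant is affine on the triangles of a common
  refinement of the grid and a triangulation of \<open>\<Omega>\<close>.
\<close>

section \<open>Mollification\<close>

text \<open>The shape of the triangles never enters because no interpolation error is estimated: the
  mean of the gradient is reproduced exactly, and one continuous field that is close to
  \<open>G\<close> in L1 has small oscillation on every set of small diameter. The mollifier
  averages over the cube with lower corner \<open>x\<close>, since the differentiation theorem for
  integrals that is used concerns such cubes. Most of the work lies at the boundary. A bounded weak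
  gradient controls differences only along segments inside \<Omega>, whereas traces and
  mollification up to the boundary call for a Lipschitz function on the whole plane. A triangulation
  of \<Omega> supplies it: \<open>f\<close> is extended to each closed triangle, the extensions are
  shown to agree, and finitely many triangles meeting face to face give one Lipschitz constant.
  Agreement at a boundary point rests on the topology of simple closed curves, which shows that
  \<Omega> does not touch itself there. The trace and the weak gradient that comes with it are
  arbitrary choices, so only integrals over a triangle are ever compared.\<close>

lemma integrable_bounded_support:
  fixes h :: "'a::euclidean_space \<Rightarrow> 'b::euclidean_space"
  assumes "h \<in> borel_measurable lebesgue" "\<And>y. norm (h y) \<le> B" "\<And>y. y \<notin> S \<Longrightarrow> h y = 0"
    and "S \<in> lmeasurable"
  shows "integrable lebesgue h" "norm (LINT y|lebesgue. h y) \<le> B * measure lebesgue S"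
proof -
  have i: "integrable lebesgue (\<lambda>y. B * indicat_real S y)"
    using assms(4) by (auto simp: fmeasurable_def intro!: integrable_real_indicator)
  have b: "norm (h y) \<le> B * indicat_real S y" for y
    using assms(2)[of y] assms(3)[of y] by (cases "y \<in> S") auto
  show "integrable lebesgue h"
    by (rule Bochner_Integration.integrable_bound[OF i assms(1)]) (use b in \<open>auto intro!: AE_I2 order_trans[OF b]\<close>)
  then have "norm (LINT y|lebesgue. h y) \<le> (LINT y|lebesgue. B * indicat_real S y)"
    by (intro order_trans[OF integral_norm_bound] integral_mono i integrable_norm b)
  then show "norm (LINT y|lebesgue. h y) \<le> B * measure lebesgue S"
    using assms(4) by simp
qed

lemma continuous_imp_measurable_lebesgue:
  fixes h :: "'a::euclidean_space \<Rightarrow> 'b::euclidean_space"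
  shows "continuous_on UNIV h \<Longrightarrow> h \<in> borel_measurable lebesgue"
  by (intro measurable_completion) (simp add: borel_measurable_continuous_onI)

text \<open>The ball of radius 1/2 around (1/2, 1/2) is inscribed in the unit cube, which puts the
  support into the cube with lower corner 0. Squaring the positive part makes the gradient
  Lipschitz, and \<open>C1\<close> is the regularity asked of test functions.\<close>

definition bump :: "real^2 \<Rightarrow> real" where
  "bump z = (max 0 (1/4 - (norm (z - (\<chi> i. 1/2)))\<^sup>2))\<^sup>2"

definition bump_grad :: "real^2 \<Rightarrow> real^2" where
  "bump_grad z = (- 4 * max 0 (1/4 - (norm (z - (\<chi> i. 1/2)))\<^sup>2)) *\<^sub>R (z - (\<chi> i. 1/2))"

lemma has_real_derivative_pos_part_square:
  "((\<lambda>t::real. (max 0 t)\<^sup>2) has_real_derivative 2 * max 0 t) (at t)"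
proof -
  consider "t > 0" | "t < 0" | "t = 0" by linarith
  then show ?thesis
  proof cases
    case 1
    have "((\<lambda>t::real. t\<^sup>2) has_real_derivative 2 * max 0 t) (at t)"
      using 1 by (auto intro!: derivative_eq_intros)
    then show ?thesis
      by (rule has_field_derivative_transform_within[of _ _ _ _ t]) (use 1 in \<open>auto simp: dist_real_def\<close>)
  next
    case 2
    have "((\<lambda>t::real. 0) has_real_derivative 2 * max 0 t) (at t)"
      using 2 by (auto intro!: derivative_eq_intros)
    then show ?thesis
      by (rule has_field_derivative_transform_within[of _ _ _ _ "-t"]) (use 2 in \<open>auto simp: dist_real_def\<close>)
  next
    case 3
    have "((\<lambda>h::real. max 0 h) \<longlongrightarrow> max 0 0) (at 0)"
      by (intro tendsto_max tendsto_const tendsto_ident_at)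
    moreover have "((max 0 (0 + h))\<^sup>2 - (max 0 0)\<^sup>2) / h = max 0 h" for h :: real
      by (cases "h \<le> 0") (auto simp: power2_eq_square max_def)
    ultimately show ?thesis
      unfolding 3 DERIV_def by simp
  qed
qed

text \<open>The slope of 1/4 - t^2 is at most 1 in modulus for 0 \<le> t \<le> 1/2, and the positive
  part vanishes beyond.\<close>

lemma pos_part_lipschitz:
  fixes r s :: "'a::real_normed_vector"
  shows "\<bar>max 0 (1/4 - (norm r)\<^sup>2) - max 0 (1/4 - (norm s)\<^sup>2)\<bar> \<le> norm (r - s)"
proof -
  have main: "\<bar>max 0 (1/4 - a\<^sup>2) - max 0 (1/4 - b\<^sup>2)\<bar> \<le> b - a" if "0 \<le> a" "a \<le> b" for a b :: real
  proof -
    have ab: "a\<^sup>2 \<le> b\<^sup>2" using that by (simp add: power_mono)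
    show ?thesis
    proof (cases "b \<le> 1/2")
      case True
      have "b\<^sup>2 - a\<^sup>2 = (b - a) * (b + a)" by (simp add: power2_eq_square algebra_simps)
      also have "\<dots> \<le> (b - a) * 1" using that True by (intro mult_left_mono) auto
      finally have "b\<^sup>2 - a\<^sup>2 \<le> b - a" by simp
      moreover have "b\<^sup>2 \<le> 1/4" 
        using that True power_mono[of b "1/2" 2] by (simp add: power2_eq_square)
      ultimately show ?thesis using ab that by linarith
    next
      case False
      then have b: "b\<^sup>2 \<ge> 1/4" using power_mono[of "1/2" b 2] by (simp add: power2_eq_square)
      show ?thesis
      proof (cases "a \<le> 1/2")
        case True
        have "1/4 - a\<^sup>2 = (1/2 - a) * (1/2 + a)" by (simp add: power2_eq_square algebra_simps)
        also have "\<dots> \<le> (1/2 - a) * 1" using that True by (intro mult_left_mono) auto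
        finally show ?thesis using b that False by (auto simp: max_def)
      next
        case False
        then have "a\<^sup>2 \<ge> 1/4" using power_mono[of "1/2" a 2] by (simp add: power2_eq_square)
        then show ?thesis using b that by (auto simp: max_def)
      qed
    qed
  qed
  show ?thesis
  proof (cases "norm r \<le> norm s")
    case True
    then show ?thesis
      using main[of "norm r" "norm s"] norm_triangle_ineq2[of s r] by (simp add: norm_minus_commute)
  next
    case False
    then show ?thesis
      using main[of "norm s" "norm r"] norm_triangle_ineq2[of r s] by (simp add: abs_minus_commute)
  qed
qed

text \<open>With m the positive part, the product m(r) r is estimated as in the product rule: m is
  1-Lipschitz and at most 1/4, and r has norm at most 1/2 where it counts, which gives 1/2 + 1/4;
  the factor 4 in \<open>bump_grad\<close> makes it 3. Beyond radius 1/2 the product vanishes, so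
  one point may be assumed inside.\<close>

lemma bump_grad_lipschitz: "norm (bump_grad x - bump_grad y) \<le> 3 * norm (x - y)"
proof -
  define m where "m r = max 0 (1/4 - (norm r)\<^sup>2)" for r :: "real^2"
  have m: "0 \<le> m r" "m r \<le> 1/4" for r by (auto simp: m_def max_def)
  have m0: "m r = 0" if "norm r > 1/2" for r
    using that power_mono[of "1/2" "norm r" 2] by (simp add: m_def power2_eq_square)
  have main: "norm (m r *\<^sub>R r - m s *\<^sub>R s) \<le> 3/4 * norm (r - s)" if "norm r \<le> 1/2" for r s
  proof -
    have "norm (m r *\<^sub>R r - m s *\<^sub>R s) = norm ((m r - m s) *\<^sub>R r + m s *\<^sub>R (r - s))"
      by (simp add: algebra_simps)
    also have "\<dots> \<le> \<bar>m r - m s\<bar> * norm r + m s * norm (r - s)"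
      using m[of s] by (intro order_trans[OF norm_triangle_ineq]) simp
    also have "\<dots> \<le> norm (r - s) * (1/2) + 1/4 * norm (r - s)"
      using pos_part_lipschitz[of r s] m[of s] that
      by (intro add_mono mult_mono) (auto simp: m_def)
    finally show ?thesis by simp
  qed
  have *: "norm (m r *\<^sub>R r - m s *\<^sub>R s) \<le> 3/4 * norm (r - s)" for r s
  proof (cases "norm r \<le> 1/2")
    case False
    show ?thesis
    proof (cases "norm s \<le> 1/2")
      case True
      then show ?thesis using main[of s r] by (simp add: norm_minus_commute)
    next
      case False
      then show ?thesis using m0[of r] m0[of s] \<open>\<not> norm r \<le> 1/2\<close> by simp
    qed
  qed (rule main)
  let ?c = "(\<chi> i. 1/2) :: real^2"
  have "bump_grad x - bump_grad y = (-4) *\<^sub>R (m (x - ?c) *\<^sub>R (x - ?c) - m (y - ?c) *\<^sub>R (y - ?c))"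
    by (simp add: bump_grad_def m_def scaleR_diff_right)
  then show ?thesis
    using *[of "x - ?c" "y - ?c"] by simp
qed

lemma GDERIV_bump: "GDERIV bump z :> bump_grad z"
proof -
  have 1: "GDERIV (\<lambda>z. 1/4 - (norm (z - (\<chi> i. 1/2)))\<^sup>2) z :> (-2) *\<^sub>R (z - (\<chi> i. 1/2))" for z :: "real^2"
    unfolding gderiv_def power2_norm_eq_inner
    by (auto intro!: derivative_eq_intros simp: inner_commute algebra_simps)
  show ?thesis
    using GDERIV_DERIV_compose[OF 1 has_real_derivative_pos_part_square, of z]
    unfolding bump_def[abs_def] bump_grad_def by (rule GDERIV_subst) simp
qed

text \<open>The remainder is quadratic uniformly in \<open>x\<close>, as the gradient is Lipschitz.
  This uniformity later allows differentiation under the integral sign without a convergence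
  theorem.\<close>

lemma bump_expansion: "\<bar>bump (x + h) - bump x - h \<bullet> bump_grad x\<bar> \<le> 3 * (norm h)\<^sup>2"
proof -
  have "norm (bump (x + h) - bump x - (\<lambda>h. h \<bullet> bump_grad x) (x + h - x)) \<le> norm (x + h - x) * (3 * norm h)"
  proof (rule differentiable_bound_linearization[where S = "cball x (norm h)" and f' = "\<lambda>y h. h \<bullet> bump_grad y"])
    fix y assume y: "y \<in> cball x (norm h)"
    show "(bump has_derivative (\<lambda>h. h \<bullet> bump_grad y)) (at y within cball x (norm h))"
      using GDERIV_bump[of y] by (simp add: gderiv_def has_derivative_at_withinI)
    have "onorm ((\<lambda>h. h \<bullet> bump_grad y) - (\<lambda>h. h \<bullet> bump_grad x)) \<le> norm (bump_grad y - bump_grad x)"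
      by (intro onorm_bound) (auto simp: inner_diff_right[symmetric] mult.commute Cauchy_Schwarz_ineq2)
    also have "\<dots> \<le> 3 * norm (y - x)" by (rule bump_grad_lipschitz)
    also have "\<dots> \<le> 3 * norm h" using y by (simp add: dist_norm norm_minus_commute)
    finally show "onorm ((\<lambda>h. h \<bullet> bump_grad y) - (\<lambda>h. h \<bullet> bump_grad x)) \<le> 3 * norm h" .
  qed (auto simp: dist_norm mult_left_le_one_le)
  then show ?thesis by (simp add: power2_eq_square)
qed

lemma One_nth: "(One::real^'n) $ i = 1"
  by (simp add: cart_eq_inner_axis inner_sum_left_Basis axis_in_Basis_iff)

lemma sum_Basis_nth [simp]: "(\<Sum>x\<in>(Basis::(real^'n) set). x $ i) = 1"
  using One_nth[of i] by simp

lemma norm_vec2: "(norm (z::real^2))\<^sup>2 = (z$1)\<^sup>2 + (z$2)\<^sup>2"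
  unfolding power2_norm_eq_inner by (simp add: inner_vec_def sum_2 power2_eq_square)

lemma bump_support: assumes "z \<notin> cbox 0 One" shows "bump z = 0" "bump_grad z = 0"
proof -
  have "(norm (z - (\<chi> i. 1/2)))\<^sup>2 \<ge> 1/4"
  proof -
    obtain i where i: "z$i < 0 \<or> z$i > 1"
      using assms by (auto simp: mem_box_cart not_le)
    then have "(1/2)\<^sup>2 \<le> \<bar>(z - (\<chi> i. 1/2))$i\<bar>\<^sup>2"
      by (intro power_mono) auto
    moreover have "\<bar>(z - (\<chi> i. 1/2))$i\<bar>\<^sup>2 \<le> (norm (z - (\<chi> i. 1/2)))\<^sup>2"
      by (intro power_mono component_le_norm_cart) auto
    ultimately show ?thesis by (simp add: power2_eq_square)
  qed
  then show "bump z = 0" "bump_grad z = 0" by (auto simp: bump_def bump_grad_def)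
qed

lemma bump_bounds: "0 \<le> bump z" "bump z \<le> 1/16"
proof -
  show "0 \<le> bump z" by (simp add: bump_def)
  have "(max 0 (1/4 - (norm (z - (\<chi> i. 1/2)))\<^sup>2))\<^sup>2 \<le> (1/4)\<^sup>2"
    by (intro power_mono) (auto simp: max_def)
  then show "bump z \<le> 1/16" by (simp add: bump_def power2_eq_square)
qed

text \<open>Both coordinates are within 1/4 of the centre, so the squared distance is at most 1/8
  and the value at least (1/4 - 1/8)^2.\<close>

lemma bump_ge: assumes "z \<in> cbox (\<chi> i. 1/4) (\<chi> i. 3/4)" shows "bump z \<ge> 1/64"
proof -
  have b: "1/4 \<le> z$i \<and> z$i \<le> 3/4" for i
    using assms by (simp add: mem_box_cart)
  have "\<bar>z$i - 1/2\<bar> \<le> 1/4" for i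
    using b[of i] by linarith
  then have "\<bar>z$i - 1/2\<bar>\<^sup>2 \<le> (1/4)\<^sup>2" for i
    by (intro power_mono) auto
  then have "(z$i - 1/2)\<^sup>2 \<le> 1/16" for i
    by (simp add: power2_eq_square)
  from this[of 1] this[of 2] have "(norm (z - (\<chi> i. 1/2)))\<^sup>2 \<le> 1/8"
    by (simp add: norm_vec2)
  then have "(1/8)\<^sup>2 \<le> (max 0 (1/4 - (norm (z - (\<chi> i. 1/2)))\<^sup>2))\<^sup>2"
    by (intro power_mono) auto
  then show ?thesis by (simp add: bump_def power2_eq_square)
qed

section \<open>The mollification kernel and its derivative\<close>

definition bump_mass :: "real \<Rightarrow> real" where
  "bump_mass e = (LINT z|lebesgue. bump (z /\<^sub>R e))"

definition kern :: "real \<Rightarrow> real^2 \<Rightarrow> real" where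
  "kern e z = bump (z /\<^sub>R e) / bump_mass e"

definition kern_grad :: "real \<Rightarrow> real^2 \<Rightarrow> real^2" where
  "kern_grad e z = bump_grad (z /\<^sub>R e) /\<^sub>R (e * bump_mass e)"

text \<open>With \<open>y - x\<close> instead of \<open>x - y\<close> in the kernel, the average is
  taken over the cube with lower corner \<open>x\<close> and side \<open>e\<close>.\<close>

definition mollify :: "real \<Rightarrow> (real^2 \<Rightarrow> 'b::euclidean_space) \<Rightarrow> real^2 \<Rightarrow> 'b" where
  "mollify e u x = (LINT y|lebesgue. kern e (y - x) *\<^sub>R u y)"

abbreviation ecube :: "real \<Rightarrow> (real^2) set" where
  "ecube e \<equiv> cbox 0 (e *\<^sub>R One)"

lemma bump_continuous: "continuous_on UNIV bump"
  unfolding bump_def by (intro continuous_intros)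

lemma bump_grad_continuous: "continuous_on UNIV bump_grad"
  unfolding bump_grad_def by (intro continuous_intros)

lemma scaled_notin: assumes "e > 0" "z \<notin> ecube e" shows "z /\<^sub>R e \<notin> cbox 0 (One::real^2)"
  using assms by (auto simp: mem_box_cart field_simps)

lemma content_ecube: "0 \<le> e \<Longrightarrow> measure lebesgue (cbox x (x + e *\<^sub>R One) :: (real^2) set) = e\<^sup>2"
  by (simp add: content_cbox_if_cart prod_constant interval_eq_empty_cart not_less)

text \<open>On the middle square of side e/2 the bump is at least 1/64, and the area of that square
  is e^2/4.\<close>

lemma bump_mass_ge: assumes "e > 0" shows "bump_mass e \<ge> e\<^sup>2 / 256"
proof -
  let ?h = "\<lambda>z. bump (z /\<^sub>R e)"
  have "?h \<in> borel_measurable lebesgue"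
    by (intro continuous_imp_measurable_lebesgue continuous_on_compose2[OF bump_continuous] continuous_intros) auto
  then have i: "integrable lebesgue ?h"
    by (rule integrable_bounded_support(1)[where B = "1/16" and S = "ecube e"])
       (use bump_bounds scaled_notin[OF assms] bump_support in auto)
  let ?Q = "cbox (\<chi> i. e/4) (\<chi> i. 3*e/4) :: (real^2) set"
  have "(LINT z|lebesgue. (1/64) * indicat_real ?Q z) \<le> bump_mass e"
    unfolding bump_mass_def
  proof (rule integral_mono[OF _ i])
    show "integrable lebesgue (\<lambda>z. (1/64) * indicat_real ?Q z)"
      by (intro integrable_mult_right integrable_real_indicator) (auto simp: emeasure_lborel_cbox_eq)
    fix z :: "real^2"
    show "(1/64) * indicat_real ?Q z \<le> ?h z"
    proof (cases "z \<in> ?Q")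
      case True
      then have "z /\<^sub>R e \<in> cbox (\<chi> i. 1/4) (\<chi> i. 3/4)"
        using assms by (auto simp: mem_box_cart field_simps)
      then show ?thesis using bump_ge[of "z /\<^sub>R e"] True by simp
    qed (simp add: bump_bounds)
  qed
  moreover have "measure lebesgue ?Q = (e/2)\<^sup>2"
    using assms by (auto simp: content_cbox_if_cart interval_eq_empty_cart power2_eq_square not_less)
  ultimately show ?thesis by (simp add: power2_eq_square)
qed

lemma bump_mass_pos: "e > 0 \<Longrightarrow> bump_mass e > 0"
  using bump_mass_ge[of e] by (smt (verit) divide_pos_pos zero_less_power)

lemma kern_support: "e > 0 \<Longrightarrow> z \<notin> ecube e \<Longrightarrow> kern e z = 0"
  "e > 0 \<Longrightarrow> z \<notin> ecube e \<Longrightarrow> kern_grad e z = 0"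
  using bump_support[of "z /\<^sub>R e"] scaled_notin[of e z] by (auto simp: kern_def kern_grad_def)

lemma kern_nonneg: "e > 0 \<Longrightarrow> 0 \<le> kern e z"
  using bump_bounds(1) bump_mass_pos[of e] by (simp add: kern_def)

text \<open>The bound is a multiple of 1 over the area of the cube, which is what compares
  mollifications with plain means over cubes.\<close>

lemma kern_le: assumes "e > 0" shows "kern e z \<le> 16 / e\<^sup>2"
proof -
  have "kern e z \<le> (1/16) / (e\<^sup>2/256)"
    unfolding kern_def using assms bump_mass_ge[OF assms] bump_bounds
    by (intro frac_le) auto
  then show ?thesis by simp
qed

lemma kern_continuous: "e > 0 \<Longrightarrow> continuous_on UNIV (kern e)"
  unfolding kern_def using bump_mass_pos[of e]
  by (intro continuous_intros continuous_on_compose2[OF bump_continuous]) auto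

lemma kern_grad_continuous: "e > 0 \<Longrightarrow> continuous_on UNIV (kern_grad e)"
  unfolding kern_grad_def 
  by (intro continuous_intros continuous_on_compose2[OF bump_grad_continuous]) auto

lemma ecube_shift: "y - x \<in> ecube e \<longleftrightarrow> y \<in> cbox x (x + e *\<^sub>R One)" for x y :: "real^2"
  by (simp add: mem_box_cart algebra_simps)

lemma kern_shift_support: "e > 0 \<Longrightarrow> y \<notin> cbox x (x + e *\<^sub>R One) \<Longrightarrow> kern e (y - x) = 0"
  using kern_support(1)[of e "y - x"] ecube_shift by blast

lemma kern_shift_measurable: "e > 0 \<Longrightarrow> (\<lambda>y. kern e (y - x)) \<in> borel_measurable lebesgue"
  by (intro continuous_imp_measurable_lebesgue continuous_on_compose2[OF kern_continuous] continuous_intros) auto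

lemma kern_mult_integrable:
  fixes u :: "real^2 \<Rightarrow> 'b::euclidean_space"
  assumes "e > 0" "u \<in> borel_measurable lebesgue" "\<And>y. norm (u y) \<le> B"
  shows "integrable lebesgue (\<lambda>y. kern e (y - x) *\<^sub>R u y)"
proof (rule integrable_bounded_support(1)[where B = "16/e\<^sup>2 * B" and S = "cbox x (x + e *\<^sub>R One)"])
  show "(\<lambda>y. kern e (y - x) *\<^sub>R u y) \<in> borel_measurable lebesgue"
    using kern_shift_measurable[OF assms(1)] assms(2) by measurable
  show "norm (kern e (y - x) *\<^sub>R u y) \<le> 16/e\<^sup>2 * B" for y
    using kern_le[OF assms(1), of "y - x"] kern_nonneg[OF assms(1), of "y - x"] assms(3)[of y]
      mult_mono[of "kern e (y - x)" "16/e\<^sup>2" "norm (u y)" B] by simp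
qed (auto simp: kern_shift_support[OF assms(1)])

lemma kern_integral: assumes "e > 0" shows "(LINT y|lebesgue. kern e (y - x)) = 1"
proof -
  have "(LINT y|lebesgue. kern e (y - x)) = (LINT y|lborel. kern e (y - x))"
    by (rule integral_completion) (use kern_continuous[OF assms] in \<open>auto intro!: borel_measurable_continuous_onI continuous_on_compose2[OF kern_continuous] continuous_intros assms\<close>)
  also have "\<dots> = (LINT y|distr lborel borel ((+) x). kern e (y - x))"
    by (simp add: lborel_distr_plus)
  also have "\<dots> = (LINT y|lborel. kern e y)"
    using kern_continuous[OF assms]
    by (subst integral_distr) (auto intro!: borel_measurable_continuous_onI continuous_on_compose2[OF kern_continuous] continuous_intros assms)
  also have "\<dots> = (LINT y|lebesgue. kern e y)"
    by (rule integral_completion[symmetric]) (use kern_continuous[OF assms] in \<open>auto intro!: borel_measurable_continuous_onI\<close>)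
  also have "\<dots> = 1"
    using bump_mass_pos[OF assms] by (simp add: kern_def bump_mass_def)
  finally show ?thesis .
qed

lemma kern_integrable: assumes "e > 0" shows "integrable lebesgue (\<lambda>y. kern e (y - x))"
  using kern_mult_integrable[OF assms, of "\<lambda>_. 1::real" 1 x] by simp

lemma mollify_diff_const:
  fixes u :: "real^2 \<Rightarrow> 'b::euclidean_space"
  assumes "e > 0" "u \<in> borel_measurable lebesgue" "\<And>y. norm (u y) \<le> B"
  shows "mollify e u x - c = (LINT y|lebesgue. kern e (y - x) *\<^sub>R (u y - c))"
proof -
  have "(LINT y|lebesgue. kern e (y - x) *\<^sub>R c) = c"
    by (simp add: kern_integral[OF assms(1)] integral_scaleR_left[OF kern_integrable[OF assms(1)]])
  moreover have "integrable lebesgue (\<lambda>y. kern e (y - x) *\<^sub>R c)"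
    by (rule kern_mult_integrable[where B = "norm c"]) (use assms in auto)
  ultimately show ?thesis
    using kern_mult_integrable[OF assms, where x = x]
    by (simp add: mollify_def scaleR_diff_right Bochner_Integration.integral_diff)
qed

text \<open>The kernel is a probability density carried by the cube, so a mollification is no
  farther from \<open>c\<close> than \<open>u\<close> is on the cube.\<close>

lemma norm_mollify_diff_const_le:
  fixes u :: "real^2 \<Rightarrow> 'b::euclidean_space"
  assumes "e > 0" "u \<in> borel_measurable lebesgue" "\<And>y. norm (u y) \<le> B"
    and "\<And>y. y \<in> cbox x (x + e *\<^sub>R One) \<Longrightarrow> norm (u y - c) \<le> d"
  shows "norm (mollify e u x - c) \<le> d"
proof -
  have "norm (mollify e u x - c) \<le> (LINT y|lebesgue. norm (kern e (y - x) *\<^sub>R (u y - c)))"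
    unfolding mollify_diff_const[OF assms(1-3)] by (rule integral_norm_bound)
  also have "\<dots> \<le> (LINT y|lebesgue. kern e (y - x) * d)"
  proof (rule integral_mono)
    have "norm (u y - c) \<le> B + norm c" for y
      using assms(3)[of y] norm_triangle_ineq4[of "u y" c] by linarith
    then show "integrable lebesgue (\<lambda>y. norm (kern e (y - x) *\<^sub>R (u y - c)))"
      by (intro integrable_norm kern_mult_integrable[where B = "B + norm c"])
         (use assms(1,2) in auto)
    show "integrable lebesgue (\<lambda>y. kern e (y - x) * d)"
      using kern_integrable[OF assms(1)] by simp
    show "norm (kern e (y - x) *\<^sub>R (u y - c)) \<le> kern e (y - x) * d" for y
      using assms(4)[of y] kern_nonneg[OF assms(1), of "y - x"] kern_shift_support[OF assms(1), of y x]
      by (cases "y \<in> cbox x (x + e *\<^sub>R One)") (auto simp: mult_left_mono)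
  qed
  also have "\<dots> = d" by (simp add: kern_integral[OF assms(1)])
  finally show ?thesis .
qed

lemma norm_mollify_le:
  fixes u :: "real^2 \<Rightarrow> 'b::euclidean_space"
  assumes "e > 0" "u \<in> borel_measurable lebesgue" "\<And>y. norm (u y) \<le> B"
  shows "norm (mollify e u x) \<le> B"
  using norm_mollify_diff_const_le[OF assms, of x 0 B] assms(3) by simp

text \<open>A quadratic remainder for steps of length at most 1 is the form in which the kernel
  estimates deliver derivatives.\<close>

lemma GDERIV_of_quadratic:
  fixes f :: "'a::real_inner \<Rightarrow> real"
  assumes "\<And>h. norm h \<le> 1 \<Longrightarrow> \<bar>f (x + h) - f x - h \<bullet> D\<bar> \<le> C * (norm h)\<^sup>2"
  shows "GDERIV f x :> D"
  unfolding gderiv_def has_derivative_at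
proof
  show "bounded_linear (\<lambda>h. h \<bullet> D)" by (rule bounded_linear_inner_left)
  show "(\<lambda>h. norm (f (x + h) - f x - h \<bullet> D) / norm h) \<midarrow>0\<rightarrow> 0"
  proof (rule Lim_null_comparison)
    have "\<forall>\<^sub>F h in at (0::'a). h \<in> ball 0 1"
      by (rule eventually_at_in_open') auto
    then show "\<forall>\<^sub>F h in at 0. norm (norm (f (x + h) - f x - h \<bullet> D) / norm h) \<le> C * norm h"
    proof eventually_elim
      case (elim h)
      then show ?case
        using assms[of h] by (cases "h = 0") (auto simp: power2_eq_square field_simps)
    qed
    show "(\<lambda>h. C * norm h) \<midarrow>0\<rightarrow> 0"
      by (auto intro!: tendsto_eq_intros)
  qed
qed

lemma GDERIV_unique: "GDERIV f x :> D \<Longrightarrow> GDERIV f x :> E \<Longrightarrow> D = E"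
proof -
  assume "GDERIV f x :> D" "GDERIV f x :> E"
  then have "(\<lambda>h. h \<bullet> D) = (\<lambda>h. h \<bullet> E)"
    unfolding gderiv_def by (rule has_derivative_unique)
  then show "D = E" by (metis inner_commute vector_eq_rdot)
qed

lemma grad_eq: "GDERIV f x :> D \<Longrightarrow> grad f x = D"
  unfolding grad_def by (rule the_equality) (auto intro: GDERIV_unique)

text \<open>The Lipschitz constant 3 of \<open>bump_grad\<close>, with one factor 1/e from the chain
  rule and one from the scaled argument, divided by the mass.\<close>

definition kern_const :: "real \<Rightarrow> real" where "kern_const e = 3 / (e\<^sup>2 * bump_mass e)"

lemma kern_const_pos: "e > 0 \<Longrightarrow> 0 < kern_const e"
  using bump_mass_pos[of e] by (simp add: kern_const_def)

lemma kern_expansion: assumes "e > 0"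
  shows "\<bar>kern e (z + h) - kern e z - h \<bullet> kern_grad e z\<bar> \<le> kern_const e * (norm h)\<^sup>2"
proof -
  have "kern e (z + h) - kern e z - h \<bullet> kern_grad e z
      = (bump (z /\<^sub>R e + h /\<^sub>R e) - bump (z /\<^sub>R e) - (h /\<^sub>R e) \<bullet> bump_grad (z /\<^sub>R e)) / bump_mass e"
    using bump_mass_pos[OF assms] assms
    by (simp add: kern_def kern_grad_def scaleR_add_right field_simps)
  also have "\<bar>\<dots>\<bar> \<le> (3 * (norm (h /\<^sub>R e))\<^sup>2) / bump_mass e"
    using bump_mass_pos[OF assms] bump_expansion[of "z /\<^sub>R e" "h /\<^sub>R e"]
    by (simp add: abs_divide divide_right_mono)
  also have "\<dots> = kern_const e * (norm h)\<^sup>2"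
    using assms by (simp add: kern_const_def power_mult_distrib field_simps)
  finally show ?thesis .
qed

lemma kern_grad_lipschitz: assumes "e > 0"
  shows "norm (kern_grad e x - kern_grad e y) \<le> kern_const e * norm (x - y)"
proof -
  have "kern_grad e x - kern_grad e y = (bump_grad (x /\<^sub>R e) - bump_grad (y /\<^sub>R e)) /\<^sub>R (e * bump_mass e)"
    by (simp add: kern_grad_def scaleR_diff_right)
  also have "norm \<dots> \<le> (3 * norm (x /\<^sub>R e - y /\<^sub>R e)) / (e * bump_mass e)"
    using bump_mass_pos[OF assms] assms bump_grad_lipschitz[of "x /\<^sub>R e" "y /\<^sub>R e"]
      divide_right_mono[of "norm (bump_grad (x /\<^sub>R e) - bump_grad (y /\<^sub>R e))" "3 * norm (x /\<^sub>R e - y /\<^sub>R e)" "e * bump_mass e"]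
    by (simp add: divide_inverse mult_ac)
  also have "norm (x /\<^sub>R e - y /\<^sub>R e) = norm (x - y) / e"
    using assms by (simp add: scaleR_diff_right[symmetric] divide_inverse mult.commute)
  finally show ?thesis
    by (simp add: kern_const_def power2_eq_square mult_ac)
qed

lemma GDERIV_kern: "e > 0 \<Longrightarrow> GDERIV (\<lambda>y. kern e (y - x)) y :> kern_grad e (y - x)"
  by (rule GDERIV_of_quadratic[where C = "kern_const e"])
     (use kern_expansion[of e "y - x"] in \<open>simp add: algebra_simps\<close>)

lemma norm_ecube: assumes "z \<in> ecube e" shows "norm (z::real^2) \<le> 2 * e"
proof -
  have "norm z \<le> \<bar>z$1\<bar> + \<bar>z$2\<bar>"
    using norm_le_l1_cart[of z] by (simp add: sum_2)
  moreover have "0 \<le> z$i \<and> z$i \<le> e" for i using assms by (simp add: mem_box_cart)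
  ultimately show ?thesis by (smt (verit))
qed

lemma ecube_ball: assumes "y \<in> cbox x (x + e *\<^sub>R One)" shows "dist x (y::real^2) \<le> 2 * e"
  using norm_ecube[of "y - x" e] assms ecube_shift[of y x e] by (simp add: dist_norm norm_minus_commute)

text \<open>The gradient vanishes at the centre of the cube, so its Lipschitz constant times a bound
  for the distance to the centre suffices.\<close>

lemma norm_kern_grad_le: assumes "e > 0" shows "norm (kern_grad e z) \<le> kern_const e * (4 * e)"
proof (cases "z \<in> ecube e")
  case True
  let ?c = "e *\<^sub>R (\<chi> i. 1/2) :: real^2"
  have "kern_grad e ?c = 0" using assms by (simp add: kern_grad_def bump_grad_def)
  then have "norm (kern_grad e z) \<le> kern_const e * norm (z - ?c)"
    using kern_grad_lipschitz[OF assms, of z ?c] by simp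
  also have "norm (z - ?c) \<le> 4 * e"
  proof -
    have "?c \<in> ecube e" using assms by (simp add: mem_box_cart)
    then show ?thesis
      using norm_ecube[OF True] norm_ecube[of ?c e] norm_triangle_ineq4[of z ?c] by linarith
  qed
  finally show ?thesis using kern_const_pos[OF assms] by (simp add: mult_left_mono)
next
  case False
  then show ?thesis using kern_support[OF assms] assms kern_const_pos[OF assms] by simp
qed

lemma kern_grad_shift_measurable:
  "e > 0 \<Longrightarrow> (\<lambda>y. kern_grad e (y - x)) \<in> borel_measurable lebesgue"
  by (intro continuous_imp_measurable_lebesgue continuous_on_compose2[OF kern_grad_continuous] continuous_intros) auto

lemma kern_far: assumes "e > 0" "y \<notin> cball x (2 * e)"
  shows "kern e (y - x) = 0" "kern_grad e (y - x) = 0"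
  using kern_support[OF assms(1), of "y - x"] ecube_ball[of y x e] assms(2) ecube_shift[of y x e] by auto

text \<open>The sign comes from differentiating \<open>kern e (y - x)\<close> in \<open>x\<close>.
  Only the kernel is differentiated, so the formula makes sense for every bounded measurable
  \<open>u\<close>.\<close>

definition mollify_grad :: "real \<Rightarrow> (real^2 \<Rightarrow> real) \<Rightarrow> real^2 \<Rightarrow> real^2" where
  "mollify_grad e u x = - (LINT y|lebesgue. u y *\<^sub>R kern_grad e (y - x))"

context
  fixes u :: "real^2 \<Rightarrow> real" and B e :: real
  assumes e: "e > 0" and u: "u \<in> borel_measurable lebesgue" and B: "\<And>y. \<bar>u y\<bar> \<le> B"
begin

lemma kern_grad_mult_integrable: "integrable lebesgue (\<lambda>y. u y *\<^sub>R kern_grad e (y - x))"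
proof (rule integrable_bounded_support(1)[where B = "B * (kern_const e * (4 * e))" and S = "cball x (2*e)"])
  show "(\<lambda>y. u y *\<^sub>R kern_grad e (y - x)) \<in> borel_measurable lebesgue"
    using u kern_grad_shift_measurable[OF e] by measurable
  show "norm (u y *\<^sub>R kern_grad e (y - x)) \<le> B * (kern_const e * (4 * e))" for y
    using B[of y] norm_kern_grad_le[OF e, of "y - x"] by (simp add: mult_mono)
qed (use kern_far[OF e] in auto)

text \<open>The quadratic expansion of the kernel is integrated against \<open>u\<close> over a
  fixed ball, so the remainder is again quadratic in \<open>h\<close>.\<close>

lemma GDERIV_mollify: "GDERIV (mollify e u) x :> mollify_grad e u x"
proof (rule GDERIV_of_quadratic)
  fix h :: "real^2" assume h: "norm h \<le> 1"
  have B0: "0 \<le> B" using B[of 0] by linarith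
  let ?r = "\<lambda>y. u y * (kern e (y - x - h) - kern e (y - x) + h \<bullet> kern_grad e (y - x))"
  have i: "integrable lebesgue (\<lambda>y. kern e (y - z) * u y)" for z
    using kern_mult_integrable[OF e u, of B z] B by simp
  have ig: "integrable lebesgue (\<lambda>y. u y * (h \<bullet> kern_grad e (y - x)))"
    using integrable_inner_right[OF kern_grad_mult_integrable, of h x] by (simp add: inner_commute)
  have "mollify e u (x + h) - mollify e u x - h \<bullet> mollify_grad e u x =
     (LINT y|lebesgue. kern e (y - (x + h)) * u y) - (LINT y|lebesgue. kern e (y - x) * u y)
       + (LINT y|lebesgue. u y * (h \<bullet> kern_grad e (y - x)))"
    using integral_inner_right[OF kern_grad_mult_integrable, of h x] by (simp add: mollify_def mollify_grad_def)
  also have "\<dots> = (LINT y|lebesgue. kern e (y - (x + h)) * u y - kern e (y - x) * u y + u y * (h \<bullet> kern_grad e (y - x)))"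
    using i[of "x+h"] i[of x] ig
    by (subst Bochner_Integration.integral_add) (simp_all add: Bochner_Integration.integral_diff)
  also have "\<dots> = (LINT y|lebesgue. ?r y)"
    by (rule Bochner_Integration.integral_cong) (simp_all add: algebra_simps)
  finally have eq: "mollify e u (x + h) - mollify e u x - h \<bullet> mollify_grad e u x = (LINT y|lebesgue. ?r y)" .
  \<comment> \<open>The radius 2e + 1 covers the supports of the kernels at \<open>x\<close> and at
    \<open>x + h\<close>, because \<open>h\<close> has norm at most 1.\<close>
  have "norm (LINT y|lebesgue. ?r y) \<le> (B * (kern_const e * (norm h)\<^sup>2)) * measure lebesgue (cball x (2*e+1))"
  proof (rule integrable_bounded_support(2))
    show "?r \<in> borel_measurable lebesgue"
      using u kern_grad_shift_measurable[OF e, of x] kern_shift_measurable[OF e, of x]  kern_shift_measurable[OF e, of "x + h"]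
      by (simp add: diff_diff_add) measurable
    show "norm (?r y) \<le> B * (kern_const e * (norm h)\<^sup>2)" for y
      unfolding norm_mult using B[of y] kern_expansion[OF e, of "y - x" "-h"] B0 by (intro mult_mono) auto
    fix y assume "y \<notin> cball x (2 * e + 1)"
    then have "y \<notin> cball x (2*e)" "y \<notin> cball (x + h) (2*e)"
      using h dist_triangle[of x y "x+h"] e by (auto simp: dist_norm norm_minus_commute)
    then show "?r y = 0" using kern_far[OF e] by (simp add: diff_diff_add)
  qed simp
  then show "\<bar>mollify e u (x + h) - mollify e u x - h \<bullet> mollify_grad e u x\<bar>
     \<le> (B * kern_const e * measure lebesgue (cball x (2*e+1))) * (norm h)\<^sup>2"
    unfolding eq by (simp add: mult_ac)
qed

text \<open>The constant is the same for all points. It yields continuity here and later the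
  gradient error of the grid interpolation.\<close>

lemma mollify_grad_lipschitz:
  assumes "norm (x - x') \<le> 1"
  shows "norm (mollify_grad e u x - mollify_grad e u x')
     \<le> B * kern_const e * measure lebesgue (cball 0 (2*e+1) :: (real^2) set) * norm (x - x')"
proof -
  have B0: "0 \<le> B" using B[of 0] by linarith
  let ?r = "\<lambda>y. u y *\<^sub>R (kern_grad e (y - x') - kern_grad e (y - x))"
  have "mollify_grad e u x - mollify_grad e u x' = (LINT y|lebesgue. ?r y)"
    using kern_grad_mult_integrable[of x] kern_grad_mult_integrable[of x']
    by (simp add: mollify_grad_def Bochner_Integration.integral_diff scaleR_diff_right)
  moreover have "norm (LINT y|lebesgue. ?r y) \<le> (B * (kern_const e * norm (x - x'))) * measure lebesgue (cball x (2*e+1))"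
  proof (rule integrable_bounded_support(2))
    show "?r \<in> borel_measurable lebesgue"
      using u kern_grad_shift_measurable[OF e] by measurable
    show "norm (?r y) \<le> B * (kern_const e * norm (x - x'))" for y
      using B[of y] kern_grad_lipschitz[OF e, of "y - x'" "y - x"] B0
      by (simp add: mult_mono)
    fix y assume "y \<notin> cball x (2 * e + 1)"
    then have "y \<notin> cball x (2*e)" "y \<notin> cball x' (2*e)"
      using assms dist_triangle[of x y x'] e by (auto simp: dist_norm norm_minus_commute)
    then show "?r y = 0" using kern_far[OF e] by simp
  qed simp
  moreover have "measure lebesgue (cball x (2*e+1)) = measure lebesgue (cball 0 (2*e+1) :: (real^2) set)"
    using e by (simp add: content_cball)
  ultimately show ?thesis by (simp add: mult_ac)
qed

lemma continuous_mollify_grad: "continuous_on UNIV (mollify_grad e u)"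
proof -
  define C where "C = B * kern_const e * measure lebesgue (cball 0 (2*e+1) :: (real^2) set)"
  have "isCont (mollify_grad e u) x" for x
    unfolding isCont_def
  proof (rule LIM_I)
    fix r :: real assume "r > 0"
    have C: "C \<ge> 0" using B[of 0] kern_const_pos[OF e] by (auto simp: C_def intro!: mult_nonneg_nonneg)
    show "\<exists>s>0. \<forall>y. y \<noteq> x \<and> norm (y - x) < s \<longrightarrow> norm (mollify_grad e u y - mollify_grad e u x) < r"
    proof (intro exI[of _ "min 1 (r / (C+1))"] conjI allI impI)
      show "0 < min 1 (r / (C + 1))" using \<open>r > 0\<close> C by simp
      fix y assume y: "y \<noteq> x \<and> norm (y - x) < min 1 (r / (C + 1))"
      then have "norm (mollify_grad e u y - mollify_grad e u x) \<le> C * norm (y - x)"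
        using mollify_grad_lipschitz[of y x] by (simp add: C_def)
      also have "\<dots> \<le> (C + 1) * norm (y - x)" using C by (simp add: mult_right_mono)
      also have "\<dots> < r" using y C by (simp add: field_simps)
      finally show "norm (mollify_grad e u y - mollify_grad e u x) < r" .
    qed
  qed
  then show ?thesis by (simp add: continuous_on_eq_continuous_at)
qed

lemma C1_mollify: "C1 (mollify e u)"
  unfolding C1_def using GDERIV_mollify continuous_mollify_grad by blast

end

lemma test_function_kern:
  assumes "e > 0" "cbox x (x + e *\<^sub>R One) \<subseteq> U"
  shows "test_function U (\<lambda>y. kern e (y - x))"
  unfolding test_function_def
proof (intro conjI)
  show "C1 (\<lambda>y. kern e (y - x))"
    unfolding C1_def using GDERIV_kern[OF assms(1)]
    by (auto intro!: exI[of _ "\<lambda>y. kern_grad e (y - x)"] continuous_on_compose2[OF kern_grad_continuous[OF assms(1)]] continuous_intros)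
  have s: "closure {y. kern e (y - x) \<noteq> 0} \<subseteq> cbox x (x + e *\<^sub>R One)"
    by (intro closure_minimal) (use kern_shift_support[OF assms(1)] in auto)
  then show "closure {y. kern e (y - x) \<noteq> 0} \<subseteq> U" using assms by blast
  show "compact (closure {y. kern e (y - x) \<noteq> 0})"
    using s by (meson bounded_cbox bounded_subset compact_eq_bounded_closed closed_closure)
qed

text \<open>The translated kernel is itself a test function on \<open>U\<close>. Passing from the
  gradient in \<open>y\<close> to the gradient in \<open>x\<close> changes the sign, which cancels
  the minus sign of integration by parts.\<close>

lemma GDERIV_mollify_weak:
  assumes "e > 0" "u \<in> borel_measurable lebesgue" "\<And>y. \<bar>u y\<bar> \<le> B"
    and "U \<in> sets lebesgue" "weak_gradient U u G" "cbox x (x + e *\<^sub>R One) \<subseteq> U"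
  shows "GDERIV (mollify e u) x :> mollify e G x"
proof -
  let ?k = "\<lambda>y. kern e (y - x)"
  have g: "grad ?k = (\<lambda>y. kern_grad e (y - x))"
    using GDERIV_kern[OF assms(1)] grad_eq by blast
  have "(LINT y|lebesgue_on U. u y *\<^sub>R grad ?k y) = - (LINT y|lebesgue_on U. ?k y *\<^sub>R G y)"
    using assms(5) test_function_kern[OF assms(1,6)] by (simp add: weak_gradient_def)
  moreover have "kern_grad e (y - x) = 0 \<and> kern e (y - x) = 0" if "y \<notin> U" for y
    using that assms(6) kern_support[OF assms(1), of "y - x"] ecube_shift[of y x e] by blast
  then have "(\<lambda>y. indicat_real U y *\<^sub>R (u y *\<^sub>R kern_grad e (y - x))) = (\<lambda>y. u y *\<^sub>R kern_grad e (y - x))"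
     "(\<lambda>y. indicat_real U y *\<^sub>R (?k y *\<^sub>R G y)) = (\<lambda>y. ?k y *\<^sub>R G y)"
    by (auto simp: fun_eq_iff indicator_def)
  ultimately have "mollify_grad e u x = mollify e G x"
    unfolding g mollify_grad_def mollify_def
    using assms(4) by (subst (asm) (1 2) integral_restrict_space) simp_all
  then show ?thesis using GDERIV_mollify[OF assms(1-3), of x] by simp
qed

abbreviation eps :: "nat \<Rightarrow> real" where "eps n \<equiv> inverse (real (Suc n))"

lemma eps_tendsto: "eps \<longlonglongrightarrow> 0"
  by (rule LIMSEQ_inverse_real_of_nat)

lemma eventually_eps_less: "d > 0 \<Longrightarrow> \<forall>\<^sub>F n in sequentially. eps n < d"
  using order_tendstoD(2)[OF eps_tendsto] by simp

section \<open>Almost everywhere convergence of mollifications\<close>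

lemma bounded_measurable_on_cbox:
  fixes u :: "real^2 \<Rightarrow> real"
  assumes "u \<in> borel_measurable lebesgue" "\<And>y. \<bar>u y\<bar> \<le> B"
  shows "u absolutely_integrable_on cbox a b"
  unfolding set_integrable_def
proof (rule integrable_bounded_support(1)[where B = B and S = "cbox a b"])
  show "(\<lambda>x. indicat_real (cbox a b) x *\<^sub>R u x) \<in> borel_measurable lebesgue"
    by (intro borel_measurable_scaleR borel_measurable_indicator assms(1)) simp
  show "norm (indicat_real (cbox a b) y *\<^sub>R u y) \<le> B" for y
    using assms(2)[of y] by (auto simp: indicator_def)
qed auto

text \<open>Differentiating the integrals of \<open>u\<close> and of its square shows that, at
  almost every \<open>x\<close>, the mean of (u - u x)^2 over the cube tends to 0. The kernel is at
  most 16 over the area of the cube, so this also controls its weighted mean of |u - u x|.\<close>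

lemma mollify_tendsto_AE_real:
  fixes u :: "real^2 \<Rightarrow> real"
  assumes u: "u \<in> borel_measurable lebesgue" and B: "\<And>y. \<bar>u y\<bar> \<le> B"
  obtains N where "negligible N" "\<And>x. x \<notin> N \<Longrightarrow> (\<lambda>n. mollify (eps n) u x) \<longlonglongrightarrow> u x"
proof -
  have u2: "(\<lambda>y. (u y)\<^sup>2) \<in> borel_measurable lebesgue" using u by measurable
  have B2: "\<bar>(u y)\<^sup>2\<bar> \<le> B\<^sup>2" for y using power_mono[of "\<bar>u y\<bar>" B 2] B[of y] by (simp del: abs_power2)
  have ai: "u absolutely_integrable_on cbox a b" "(\<lambda>y. (u y)\<^sup>2) absolutely_integrable_on cbox a b" for a b
    using bounded_measurable_on_cbox[OF u B] bounded_measurable_on_cbox[OF u2 B2] by auto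
  have hk: "u integrable_on cbox a b" "(\<lambda>y. (u y)\<^sup>2) integrable_on cbox a b" for a b
    using ai by (auto intro: set_lebesgue_integral_eq_integral(1))
  obtain N1 where N1: "negligible N1" "\<And>x e. \<lbrakk>x \<notin> N1; 0 < e\<rbrakk> \<Longrightarrow>
       \<exists>d>0. \<forall>h. 0 < h \<and> h < d \<longrightarrow> norm (integral (cbox x (x + h *\<^sub>R One)) u /\<^sub>R h ^ DIM(real^2) - u x) < e"
    by (rule integrable_ccontinuous_explicit[OF hk(1)]) (rule that)
  obtain N2 where N2: "negligible N2" "\<And>x e. \<lbrakk>x \<notin> N2; 0 < e\<rbrakk> \<Longrightarrow>
       \<exists>d>0. \<forall>h. 0 < h \<and> h < d \<longrightarrow> norm (integral (cbox x (x + h *\<^sub>R One)) (\<lambda>y. (u y)\<^sup>2) /\<^sub>R h ^ DIM(real^2) - (u x)\<^sup>2) < e"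
    by (rule integrable_ccontinuous_explicit[OF hk(2)]) (rule that)
  show thesis
  proof (rule that[of "N1 \<union> N2"])
    show "negligible (N1 \<union> N2)" using N1 N2 by simp
    fix x assume x: "x \<notin> N1 \<union> N2"
    define a where "a = u x"
    \<comment> \<open>\<delta> is chosen such that 16 / r times \<delta> (1 + 2 |a|) equals
      \<open>r\<close>; the other \<open>r\<close> is the integral of the constant \<open>r\<close>
      against the kernel.\<close>
    have key: "\<bar>mollify e u x - a\<bar> \<le> 2 * r"
      if r: "r > 0" and e: "e > 0" and \<delta>: "\<delta> = r\<^sup>2 / (16 * (1 + 2 * \<bar>a\<bar>))"
        and e1: "norm (integral (cbox x (x + e *\<^sub>R One)) u /\<^sub>R e ^ DIM(real^2) - u x) < \<delta>"
        and e2: "norm (integral (cbox x (x + e *\<^sub>R One)) (\<lambda>y. (u y)\<^sup>2) /\<^sub>R e ^ DIM(real^2) - (u x)\<^sup>2) < \<delta>"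
      for r e \<delta>
    proof -
      let ?Q = "cbox x (x + e *\<^sub>R One)"
      have mQ: "measure lebesgue ?Q = e\<^sup>2" using content_ecube[of e x] e by simp
      have int1: "integrable lebesgue (\<lambda>y. indicat_real ?Q y * u y)" "integrable lebesgue (\<lambda>y. indicat_real ?Q y * (u y)\<^sup>2)"
        using ai by (auto simp: set_integrable_def)
      have int0: "integrable lebesgue (indicat_real ?Q)" by (simp add: emeasure_lborel_cbox_eq)
      have I: "(LINT y|lebesgue. indicat_real ?Q y * u y) = integral ?Q u"
              "(LINT y|lebesgue. indicat_real ?Q y * (u y)\<^sup>2) = integral ?Q (\<lambda>y. (u y)\<^sup>2)"
        using set_lebesgue_integral_eq_integral(2)[OF ai(1)] set_lebesgue_integral_eq_integral(2)[OF ai(2)]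
        by (simp_all add: set_lebesgue_integral_def)
      have sq: "indicat_real ?Q y * (u y - a)\<^sup>2 = indicat_real ?Q y * (u y)\<^sup>2 - 2 * a * (indicat_real ?Q y * u y) + a\<^sup>2 * indicat_real ?Q y" for y
        by (simp add: power2_eq_square algebra_simps)
      have int2: "integrable lebesgue (\<lambda>y. indicat_real ?Q y * (u y - a)\<^sup>2)"
        unfolding sq using int0 int1 by (intro Bochner_Integration.integrable_add Bochner_Integration.integrable_diff integrable_mult_right)
      have V: "(LINT y|lebesgue. indicat_real ?Q y * (u y - a)\<^sup>2) = integral ?Q (\<lambda>y. (u y)\<^sup>2) - 2 * a * integral ?Q u + a\<^sup>2 * e\<^sup>2"
        unfolding sq using int0 int1 mQ
        by (simp add: I Bochner_Integration.integral_add Bochner_Integration.integral_diff)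
      have V2: "(LINT y|lebesgue. indicat_real ?Q y * (u y - a)\<^sup>2) \<le> e\<^sup>2 * (\<delta> * (1 + 2 * \<bar>a\<bar>))"
      proof -
        define p where "p = integral ?Q u / e\<^sup>2 - a"
        define q where "q = integral ?Q (\<lambda>y. (u y)\<^sup>2) / e\<^sup>2 - a\<^sup>2"
        have pq: "\<bar>p\<bar> < \<delta>" "\<bar>q\<bar> < \<delta>"
          using e1 e2 by (auto simp: p_def q_def a_def divide_inverse mult.commute)
        have "integral ?Q u = (a + p) * e\<^sup>2" "integral ?Q (\<lambda>y. (u y)\<^sup>2) = (a\<^sup>2 + q) * e\<^sup>2"
          using e by (auto simp: p_def q_def)
        then have "(LINT y|lebesgue. indicat_real ?Q y * (u y - a)\<^sup>2) = e\<^sup>2 * (q - 2 * a * p)"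
          unfolding V by (simp add: power2_eq_square algebra_simps)
        moreover have "q - 2 * a * p \<le> \<delta> + 2 * \<bar>a\<bar> * \<delta>"
        proof -
          have "- (2 * a * p) \<le> \<bar>2 * a * p\<bar>" by simp
          also have "\<dots> = 2 * \<bar>a\<bar> * \<bar>p\<bar>" by (simp add: abs_mult)
          also have "\<dots> \<le> 2 * \<bar>a\<bar> * \<delta>" using pq by (intro mult_left_mono) auto
          finally show ?thesis using pq by linarith
        qed
        then have "q - 2 * a * p \<le> \<delta> * (1 + 2 * \<bar>a\<bar>)" by (simp add: algebra_simps)
        ultimately show ?thesis by (simp add: mult_left_mono)
      qed
      have "\<bar>mollify e u x - a\<bar> \<le> (LINT y|lebesgue. norm (kern e (y - x) *\<^sub>R (u y - a)))"
      proof -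
        have "mollify e u x - a = (LINT y|lebesgue. kern e (y - x) *\<^sub>R (u y - a))"
          by (rule mollify_diff_const[OF e u, where B = B]) (use B in auto)
        then show ?thesis
          using integral_norm_bound[of lebesgue "\<lambda>y. kern e (y - x) *\<^sub>R (u y - a)"] by (simp only: real_norm_def)
      qed
      also have "\<dots> \<le> (LINT y|lebesgue. r * kern e (y - x) + (16 / (e\<^sup>2 * r)) * (indicat_real ?Q y * (u y - a)\<^sup>2))"
      proof (rule integral_mono)
        have "norm (u y - a) \<le> B + \<bar>a\<bar>" for y using B[of y] by simp
        then show "integrable lebesgue (\<lambda>y. norm (kern e (y - x) *\<^sub>R (u y - a)))"
          by (intro integrable_norm kern_mult_integrable[where B = "B + \<bar>a\<bar>"]) (use e u in auto)
        show "integrable lebesgue (\<lambda>y. r * kern e (y - x) + (16 / (e\<^sup>2 * r)) * (indicat_real ?Q y * (u y - a)\<^sup>2))"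
          using int2 kern_integrable[OF e] by simp
        fix y
        show "norm (kern e (y - x) *\<^sub>R (u y - a)) \<le> r * kern e (y - x) + (16 / (e\<^sup>2 * r)) * (indicat_real ?Q y * (u y - a)\<^sup>2)"
        proof (cases "y \<in> ?Q")
          case True
          \<comment> \<open>Bounding a modulus by a threshold plus a multiple of its square lets the
            mean square control the mean modulus.\<close>
          have t: "\<bar>u y - a\<bar> \<le> r + (u y - a)\<^sup>2 / r"
          proof (cases "\<bar>u y - a\<bar> \<le> r")
            case False
            then have "\<bar>u y - a\<bar> * r \<le> \<bar>u y - a\<bar> * \<bar>u y - a\<bar>" by (intro mult_left_mono) auto
            then have "\<bar>u y - a\<bar> \<le> (u y - a)\<^sup>2 / r" using r by (simp add: field_simps power2_eq_square)
            then show ?thesis using r by simp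
          qed (use r in \<open>simp add: add_increasing2\<close>)
          have "norm (kern e (y - x) *\<^sub>R (u y - a)) = kern e (y - x) * \<bar>u y - a\<bar>"
            using kern_nonneg[OF e, of "y - x"] by (simp add: abs_mult)
          also have "\<dots> \<le> kern e (y - x) * (r + (u y - a)\<^sup>2 / r)"
            using t kern_nonneg[OF e] by (rule mult_left_mono)
          also have "\<dots> = r * kern e (y - x) + kern e (y - x) * ((u y - a)\<^sup>2 / r)"
            by (simp add: algebra_simps)
          also have "\<dots> \<le> r * kern e (y - x) + (16 / e\<^sup>2) * ((u y - a)\<^sup>2 / r)"
            using kern_le[OF e, of "y - x"] r by (intro add_left_mono mult_right_mono) auto
          finally show ?thesis using True by (simp add: field_simps)
        next
          case False
          then show ?thesis using kern_shift_support[OF e False] by simp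
        qed
      qed
      also have "\<dots> = r + 16 / (e\<^sup>2 * r) * (LINT y|lebesgue. indicat_real ?Q y * (u y - a)\<^sup>2)"
        using int2 kern_integrable[OF e] by (simp add: kern_integral[OF e])
      also have "\<dots> \<le> r + 16 / (e\<^sup>2 * r) * (e\<^sup>2 * (\<delta> * (1 + 2 * \<bar>a\<bar>)))"
        using V2 r by (intro add_left_mono mult_left_mono) auto
      also have "\<dots> = 2 * r"
      proof -
        have "1 + 2 * \<bar>a\<bar> \<noteq> 0" using abs_ge_zero[of a] by linarith
        moreover have "r\<^sup>2 / (16 * t) * t = r\<^sup>2 / 16" if "t \<noteq> 0" for t
          using that by simp
        ultimately have "\<delta> * (1 + 2 * \<bar>a\<bar>) = r\<^sup>2 / 16" unfolding \<delta> by blast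
        then show ?thesis using e r by (simp only:) (simp add: power2_eq_square)
      qed
      finally show ?thesis .
    qed
    show "(\<lambda>n. mollify (eps n) u x) \<longlonglongrightarrow> u x"
    proof (rule LIMSEQ_I)
      fix r :: real assume "r > 0"
      define \<delta> where "\<delta> = (r/4)\<^sup>2 / (16 * (1 + 2 * \<bar>a\<bar>))"
      have "\<delta> > 0" using \<open>r > 0\<close> unfolding \<delta>_def by (intro divide_pos_pos) (auto simp: add_pos_nonneg)
      then obtain d1 d2 where d: "d1 > 0" "d2 > 0"
        "\<And>h. 0 < h \<Longrightarrow> h < d1 \<Longrightarrow> norm (integral (cbox x (x + h *\<^sub>R One)) u /\<^sub>R h ^ DIM(real^2) - u x) < \<delta>"
        "\<And>h. 0 < h \<Longrightarrow> h < d2 \<Longrightarrow> norm (integral (cbox x (x + h *\<^sub>R One)) (\<lambda>y. (u y)\<^sup>2) /\<^sub>R h ^ DIM(real^2) - (u x)\<^sup>2) < \<delta>"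
        using N1(2)[of x \<delta>] N2(2)[of x \<delta>] x by blast
      have "\<forall>\<^sub>F n in sequentially. eps n < min d1 d2"
        using d(1,2) by (intro eventually_eps_less) simp
      then have "\<forall>\<^sub>F n in sequentially. norm (mollify (eps n) u x - u x) < r"
      proof eventually_elim
        case (elim n)
        have "\<bar>mollify (eps n) u x - a\<bar> \<le> 2 * (r/4)"
          by (rule key[OF _ _ \<delta>_def]) (use elim d \<open>r > 0\<close> in auto)
        then show ?case using \<open>r > 0\<close> by (simp add: a_def)
      qed
      then show "\<exists>no. \<forall>n\<ge>no. norm (mollify (eps n) u x - u x) < r"
        by (simp add: eventually_sequentially)
    qed
  qed
qed

lemma mollify_nth:
  fixes G :: "real^2 \<Rightarrow> real^2"
  assumes "e > 0" "G \<in> borel_measurable lebesgue" "\<And>y. norm (G y) \<le> B"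
  shows "mollify e G x $ i = mollify e (\<lambda>y. G y $ i) x"
proof -
  have "(LINT y|lebesgue. kern e (y - x) *\<^sub>R G y) \<bullet> axis i 1 = (LINT y|lebesgue. (kern e (y - x) *\<^sub>R G y) \<bullet> axis i 1)"
    by (rule integral_inner_left[symmetric]) (use kern_mult_integrable[OF assms] in auto)
  then show ?thesis by (simp add: mollify_def cart_eq_inner_axis[symmetric])
qed

lemma mollify_tendsto_AE:
  fixes G :: "real^2 \<Rightarrow> real^2"
  assumes G: "G \<in> borel_measurable lebesgue" and B: "\<And>y. norm (G y) \<le> B"
  obtains N where "negligible N" "\<And>x. x \<notin> N \<Longrightarrow> (\<lambda>n. mollify (eps n) G x) \<longlonglongrightarrow> G x"
proof -
  have m: "(\<lambda>y. G y $ i) \<in> borel_measurable lebesgue" for i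
    using borel_measurable_inner[OF G borel_measurable_const[of "axis i 1"]] by (simp add: cart_eq_inner_axis[symmetric])
  have b: "\<bar>G y $ i\<bar> \<le> B" for y i using B[of y] component_le_norm_cart[of "G y" i] by linarith
  have "\<exists>N. negligible N \<and> (\<forall>x. x \<notin> N \<longrightarrow> (\<lambda>n. mollify (eps n) (\<lambda>y. G y $ i) x) \<longlonglongrightarrow> G x $ i)" for i
    using mollify_tendsto_AE_real[OF m b, of i] by metis
  then obtain N where N: "\<And>i. negligible (N i)"
    "\<And>i x. x \<notin> N i \<Longrightarrow> (\<lambda>n. mollify (eps n) (\<lambda>y. G y $ i) x) \<longlonglongrightarrow> G x $ i"
    by metis
  show thesis
  proof (rule that[of "\<Union>i. N i"])
    show "negligible (\<Union>i. N i)" using N(1) by (intro negligible_Union) auto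
    fix x assume "x \<notin> (\<Union>i. N i)"
    then show "(\<lambda>n. mollify (eps n) G x) \<longlonglongrightarrow> G x"
      by (intro vec_tendstoI) (use N(2) in \<open>simp add: mollify_nth[OF _ G B]\<close>)
  qed
qed

section \<open>Lipschitz bounds under mollification\<close>

lemma GDERIV_bound:
  assumes "convex S" "\<And>z. z \<in> S \<Longrightarrow> GDERIV f z :> D z" "\<And>z. z \<in> S \<Longrightarrow> norm (D z) \<le> M"
    and "x \<in> S" "y \<in> S"
  shows "\<bar>f x - f y\<bar> \<le> M * norm (x - y)"
proof -
  have "norm (f x - f y) \<le> M * norm (x - y)"
  proof (rule differentiable_bound[OF assms(1) _ _ assms(4,5)])
    fix z assume z: "z \<in> S"
    show "(f has_derivative (\<lambda>h. h \<bullet> D z)) (at z within S)"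
      using assms(2)[OF z] by (simp add: gderiv_def has_derivative_at_withinI)
    show "onorm (\<lambda>h. h \<bullet> D z) \<le> M"
    proof (rule onorm_bound)
      show "0 \<le> M" using assms(3)[OF z] norm_ge_zero[of "D z"] by linarith
      fix h
      have "norm (h \<bullet> D z) \<le> norm (D z) * norm h" using Cauchy_Schwarz_ineq2[of h "D z"] by (simp add: mult.commute)
      also have "\<dots> \<le> M * norm h" using assms(3)[OF z] by (rule mult_right_mono) simp
      finally show "norm (h \<bullet> D z) \<le> M * norm h" .
    qed
  qed
  then show ?thesis by simp
qed

text \<open>The difference quotients in the direction \<open>D\<close> itself tend to
  \<open>D \<bullet> D\<close> and are at most \<open>L * norm D\<close>.\<close>

lemma norm_GDERIV_le:
  fixes f :: "real^2 \<Rightarrow> real"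
  assumes "GDERIV f x :> D" "\<And>y. \<bar>f y - f x\<bar> \<le> L * norm (y - x)"
  shows "norm D \<le> L"
proof (cases "D = 0")
  case True
  have "0 \<le> L * norm (x + axis 1 1 - x)" using assms(2)[of "x + axis 1 1"] by linarith
  then show ?thesis using True by (simp add: norm_axis_1)
next
  case False
  have 1: "(f has_derivative (\<lambda>h. h \<bullet> D)) (at (x + 0 *\<^sub>R D))" using assms(1) by (simp add: gderiv_def)
  have "((\<lambda>t::real. f (x + t *\<^sub>R D)) has_derivative (\<lambda>t. (t *\<^sub>R D) \<bullet> D)) (at 0)"
  proof -
    have "((\<lambda>t::real. x + t *\<^sub>R D) has_derivative (\<lambda>t. t *\<^sub>R D)) (at 0)"
      by (auto intro!: derivative_eq_intros)
    from has_derivative_compose[OF this 1] show ?thesis .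
  qed
  moreover have "(\<lambda>t. (t *\<^sub>R D) \<bullet> D) = (*) (D \<bullet> D)"
    by (simp add: fun_eq_iff mult.commute)
  ultimately have "((\<lambda>t::real. f (x + t *\<^sub>R D)) has_real_derivative (D \<bullet> D)) (at 0)"
    by (simp only: has_field_derivative_def)
  then have "(\<lambda>t. (f (x + t *\<^sub>R D) - f x) / t) \<midarrow>0\<rightarrow> D \<bullet> D"
    by (simp add: DERIV_def)
  moreover have "\<forall>\<^sub>F t in at (0::real). (f (x + t *\<^sub>R D) - f x) / t \<le> L * norm D"
  proof (intro always_eventually allI)
    fix t :: real
    have "(f (x + t *\<^sub>R D) - f x) / t \<le> \<bar>f (x + t *\<^sub>R D) - f x\<bar> / \<bar>t\<bar>"
      by (metis abs_divide abs_ge_self)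
    also have "\<dots> \<le> (L * norm (t *\<^sub>R D)) / \<bar>t\<bar>"
      using assms(2)[of "x + t *\<^sub>R D"] by (intro divide_right_mono) auto
    also have "\<dots> \<le> L * norm D"
    proof (cases "t = 0")
      case True
      have "0 \<le> L * norm D" using assms(2)[of "x + D"] by simp
      then show ?thesis using True by simp
    qed simp
    finally show "(f (x + t *\<^sub>R D) - f x) / t \<le> L * norm D" .
  qed
  ultimately have "D \<bullet> D \<le> L * norm D"
    by (intro tendsto_upperbound) auto
  then show ?thesis using False by (simp add: dot_square_norm power2_eq_square)
qed

lemma mollify_translate:
  fixes u :: "real^2 \<Rightarrow> 'b::euclidean_space"
  assumes e: "e > 0" and u: "continuous_on UNIV u"
  shows "mollify e u x = (LINT z|lebesgue. kern e z *\<^sub>R u (z + x))"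
proof -
  have m: "(\<lambda>y. kern e (y - x) *\<^sub>R u y) \<in> borel_measurable lborel" "(\<lambda>y. kern e y *\<^sub>R u (y + x)) \<in> borel_measurable lborel"
    using kern_continuous[OF e] u
    by (auto intro!: borel_measurable_continuous_onI continuous_on_compose2[OF kern_continuous[OF e]] continuous_on_compose2[OF u] continuous_intros)
  have "mollify e u x = (LINT y|lborel. kern e (y - x) *\<^sub>R u y)"
    unfolding mollify_def by (rule integral_completion) (use m in auto)
  also have "\<dots> = (LINT y|distr lborel borel ((+) x). kern e (y - x) *\<^sub>R u y)"
    by (simp add: lborel_distr_plus)
  also have "\<dots> = (LINT y|lborel. kern e y *\<^sub>R u (y + x))"
    using m by (subst integral_distr) (auto simp: add.commute)
  also have "\<dots> = (LINT z|lebesgue. kern e z *\<^sub>R u (z + x))"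
    by (rule integral_completion[symmetric]) (use m in auto)
  finally show ?thesis .
qed

text \<open>The difference of two values of the mollification is the mollification at
  \<open>x\<close> of the difference of two translates of \<open>u\<close>, so the Lipschitz
  constant is preserved.\<close>

lemma norm_mollify_grad_le:
  fixes u :: "real^2 \<Rightarrow> real"
  assumes e: "e > 0" and L: "L-lipschitz_on UNIV u" and B: "\<And>y. \<bar>u y\<bar> \<le> B"
  shows "norm (mollify_grad e u x) \<le> L"
proof (rule norm_GDERIV_le)
  have c: "continuous_on UNIV u" using L by (rule lipschitz_on_continuous_on)
  have m: "u \<in> borel_measurable lebesgue" by (rule continuous_imp_measurable_lebesgue[OF c])
  show "GDERIV (mollify e u) x :> mollify_grad e u x" by (rule GDERIV_mollify[OF e m B])
  fix y
  define v where "v z = u (z + (y - x))" for z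
  have vc: "continuous_on UNIV v" unfolding v_def by (intro continuous_intros continuous_on_compose2[OF c]) auto
  have vm: "v \<in> borel_measurable lebesgue" by (rule continuous_imp_measurable_lebesgue[OF vc])
  have "mollify e u y = mollify e v x"
    unfolding mollify_translate[OF e c] mollify_translate[OF e vc] by (simp add: v_def algebra_simps)
  then have "mollify e u y - mollify e u x = mollify e (\<lambda>z. v z - u z) x"
    using kern_mult_integrable[OF e m, of B x] kern_mult_integrable[OF e vm, of B x] B
    by (simp add: mollify_def v_def right_diff_distrib)
  also have "norm \<dots> \<le> L * norm (y - x)"
  proof (rule norm_mollify_le[OF e])
    show "(\<lambda>z. v z - u z) \<in> borel_measurable lebesgue" using m vm by measurable
    show "norm (v z - u z) \<le> L * norm (y - x)" for z
      using lipschitz_onD[OF L, of "z + (y - x)" z] by (simp add: v_def dist_norm)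
  qed
  finally show "\<bar>mollify e u y - mollify e u x\<bar> \<le> L * norm (y - x)" by simp
qed

lemma mollify_lipschitz_dist:
  fixes u :: "real^2 \<Rightarrow> real"
  assumes e: "e > 0" and L: "L-lipschitz_on UNIV u" and B: "\<And>y. \<bar>u y\<bar> \<le> B"
  shows "\<bar>mollify e u x - u x\<bar> \<le> L * (2 * e)"
proof -
  have c: "continuous_on UNIV u" using L by (rule lipschitz_on_continuous_on)
  have "norm (mollify e u x - u x) \<le> L * (2 * e)"
  proof (rule norm_mollify_diff_const_le[OF e continuous_imp_measurable_lebesgue[OF c]])
    fix y assume y: "y \<in> cbox x (x + e *\<^sub>R One)"
    have "norm (u y - u x) \<le> L * dist x y"
      using lipschitz_onD[OF L, of y x] by (simp add: dist_norm dist_commute norm_minus_commute)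
    also have "\<dots> \<le> L * (2 * e)"
      using ecube_ball[OF y] lipschitz_on_nonneg[OF L] by (intro mult_left_mono) auto
    finally show "norm (u y - u x) \<le> L * (2 * e)" .
  qed (use B in auto)
  then show ?thesis by simp
qed

text \<open>The gradient of a mollification is a mollification of \<open>G\<close> as long as the
  cubes stay in \<open>U\<close>, hence bounded by \<open>M\<close> along a compact segment in
  \<open>U\<close> once the cubes are small. The mean value bound passes to the limit at any two
  points where the mollifications converge.\<close>

lemma weak_gradient_AE_lipschitz:
  assumes "open U" and u: "u \<in> borel_measurable lebesgue" and B: "\<And>y. \<bar>u y\<bar> \<le> B"
    and G: "G \<in> borel_measurable lebesgue" and M: "\<And>y. norm (G y) \<le> M"
    and w: "weak_gradient U u G"
  obtains N where "negligible N"
    "\<And>x y. x \<notin> N \<Longrightarrow> y \<notin> N \<Longrightarrow> closed_segment x y \<subseteq> U \<Longrightarrow> \<bar>u x - u y\<bar> \<le> M * norm (x - y)"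
proof -
  obtain N where N: "negligible N" "\<And>x. x \<notin> N \<Longrightarrow> (\<lambda>n. mollify (eps n) u x) \<longlonglongrightarrow> u x"
    using mollify_tendsto_AE_real[OF u B] by blast
  show thesis
  proof (rule that[OF N(1)])
    fix x y assume xy: "x \<notin> N" "y \<notin> N" "closed_segment x y \<subseteq> U"
    obtain d where d: "d > 0" "(\<Union>z\<in>closed_segment x y. ball z d) \<subseteq> U"
      using compact_subset_open_imp_ball_epsilon_subset[OF compact_segment assms(1) xy(3)] by blast
    have "\<forall>\<^sub>F n in sequentially. eps n < d / 2"
      using d(1) by (intro eventually_eps_less) simp
    then have "\<forall>\<^sub>F n in sequentially. \<bar>mollify (eps n) u x - mollify (eps n) u y\<bar> \<le> M * norm (x - y)"
    proof eventually_elim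
      case (elim n)
      show ?case
      proof (rule GDERIV_bound[of "closed_segment x y"])
        fix z assume z: "z \<in> closed_segment x y"
        have "cbox z (z + eps n *\<^sub>R One) \<subseteq> ball z d"
          using ecube_ball[of _ z "eps n"] elim by force
        then have "cbox z (z + eps n *\<^sub>R One) \<subseteq> U" using d z by blast
        then show "GDERIV (mollify (eps n) u) z :> mollify (eps n) G z"
          by (intro GDERIV_mollify_weak[OF _ u B _ w]) (use assms(1) in auto)
        show "norm (mollify (eps n) G z) \<le> M" by (rule norm_mollify_le[OF _ G M]) auto
      qed auto
    qed
    moreover have "(\<lambda>n. \<bar>mollify (eps n) u x - mollify (eps n) u y\<bar>) \<longlonglongrightarrow> \<bar>u x - u y\<bar>"
      using N(2) xy by (intro tendsto_intros) auto
    ultimately show "\<bar>u x - u y\<bar> \<le> M * norm (x - y)"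
      by (intro tendsto_upperbound[where F = sequentially]) auto
  qed
qed

text \<open>Mollified indicators of the points at distance at least 4 \<open>eps n\<close> from the
  complement. Mollification with parameter \<open>eps n\<close> looks at most 2 \<open>eps n\<close>
  away, so the support keeps the distance 2 \<open>eps n\<close> from the complement, and the value
  is 1 from distance 6 \<open>eps n\<close> on.\<close>

lemma cutoff_sequence:
  assumes "open U" "bounded (U :: (real^2) set)"
  obtains \<phi> where "\<And>n::nat. test_function U (\<phi> n)" "\<And>n x. 0 \<le> \<phi> n x" "\<And>n x. \<phi> n x \<le> 1"
    "\<And>x. x \<in> U \<Longrightarrow> (\<lambda>n. \<phi> n x) \<longlonglongrightarrow> 1"
proof -
  have ne: "- U \<noteq> {}" using assms(2) not_bounded_UNIV by (metis Compl_UNIV_eq double_compl)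
  define dd where "dd x = infdist x (- U)" for x
  have ddc: "continuous_on UNIV dd" unfolding dd_def by (intro continuous_intros)
  have dd_lip: "dd x \<le> dd y + dist x y" for x y unfolding dd_def by (rule infdist_triangle)
  define A where "A n = {y. 4 * eps n \<le> dd y}" for n
  define \<phi> where "\<phi> n = mollify (eps n) (indicat_real (A n))" for n
  have cl: "closed {y. c \<le> dd y}" for c using ddc by (intro closed_Collect_le) auto
  have m: "indicat_real (A n) \<in> borel_measurable lebesgue" for n
    using cl[of "4 * eps n"] by (intro borel_measurable_indicator) (auto simp: A_def)
  have near: "\<bar>dd y - dd x\<bar> \<le> 2 * e" if "y \<in> cbox x (x + e *\<^sub>R One)" for x y e
    using dd_lip[of x y] dd_lip[of y x] ecube_ball[OF that] by (simp add: dist_commute)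
  have zero: "\<phi> n x = 0" if "dd x < 2 * eps n" for n x
  proof -
    have "norm (\<phi> n x - 0) \<le> 0"
      unfolding \<phi>_def
    proof (rule norm_mollify_diff_const_le[OF _ m])
      fix y assume "y \<in> cbox x (x + eps n *\<^sub>R One)"
      from near[OF this] that show "norm (indicat_real (A n) y - 0) \<le> 0" by (auto simp: A_def)
    qed (auto simp: indicator_def)
    then show ?thesis by simp
  qed
  show thesis
  proof (rule that[of \<phi>])
    fix n
    have s: "closure {x. \<phi> n x \<noteq> 0} \<subseteq> {x. 2 * eps n \<le> dd x}"
      by (rule closure_minimal[OF _ cl]) (use zero in force)
    have sU: "{x. 2 * eps n \<le> dd x} \<subseteq> U"
    proof
      fix x assume "x \<in> {x. 2 * eps n \<le> dd x}"
      then have "0 < dd x" by (smt (verit) mem_Collect_eq inverse_positive_iff_positive of_nat_0_less_iff zero_less_Suc)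
      then show "x \<in> U" by (metis ComplI dd_def infdist_zero less_irrefl)
    qed
    show "test_function U (\<phi> n)"
      unfolding test_function_def
    proof (intro conjI)
      show "C1 (\<phi> n)" unfolding \<phi>_def by (rule C1_mollify[OF _ m, where B = 1]) (auto simp: indicator_def)
      show "closure {x. \<phi> n x \<noteq> 0} \<subseteq> U" using s sU by blast
      then show "compact (closure {x. \<phi> n x \<noteq> 0})"
        using assms(2) bounded_subset compact_eq_bounded_closed by blast
    qed
    fix x
    show "0 \<le> \<phi> n x" unfolding \<phi>_def mollify_def
      by (intro integral_nonneg_AE AE_I2) (simp add: kern_nonneg del: of_nat_Suc)
    have "norm (\<phi> n x) \<le> 1" unfolding \<phi>_def by (rule norm_mollify_le[OF _ m]) (auto simp: indicator_def)
    then show "\<phi> n x \<le> 1" by simp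
  next
    fix x assume "x \<in> U"
    then have pos: "0 < dd x"
      unfolding dd_def using assms(1) ne in_closed_iff_infdist_zero[of "- U" x] infdist_nonneg[of x "- U"]
    by (auto simp: closed_def less_le)
    have "\<forall>\<^sub>F n in sequentially. eps n < dd x / 6"
      using pos by (intro eventually_eps_less) simp
    then have "\<forall>\<^sub>F n in sequentially. \<phi> n x = 1"
    proof eventually_elim
      case (elim n)
      have "norm (\<phi> n x - 1) \<le> 0"
        unfolding \<phi>_def
      proof (rule norm_mollify_diff_const_le[OF _ m])
        fix y assume "y \<in> cbox x (x + eps n *\<^sub>R One)"
        from near[OF this] elim show "norm (indicat_real (A n) y - 1) \<le> 0" by (auto simp: A_def)
      qed (auto simp: indicator_def)
      then show ?case by simp
    qed
    then show "(\<lambda>n. \<phi> n x) \<longlonglongrightarrow> 1" by (rule tendsto_eventually)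
  qed
qed

section \<open>Polygonal domains\<close>

definition to_complex :: "real^2 \<Rightarrow> complex" where "to_complex x = Complex (x$1) (x$2)"

lemma linear_to_complex: "linear to_complex"
  by (rule linearI) (auto simp: to_complex_def complex_eq_iff)

lemma bij_to_complex: "bij to_complex"
proof (rule o_bij)
  let ?g = "\<lambda>z. vector [Re z, Im z] :: real^2"
  show "?g \<circ> to_complex = id" by (auto simp: fun_eq_iff vec_eq_iff forall_2 to_complex_def)
  show "to_complex \<circ> ?g = id" by (auto simp: fun_eq_iff to_complex_def complex_eq_iff)
qed

lemma connected_component_continuous_image:
  assumes "continuous_on UNIV f" "connected_component S x y"
  shows "connected_component (f ` S) (f x) (f y)"
  using assms unfolding connected_component_def
  by (meson connected_continuous_image continuous_on_subset image_eqI image_mono subset_UNIV)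

text \<open>\<open>Janiszewski\<close> speaks of the complex plane; the linear bijection
  \<open>to_complex\<close> and its continuous inverse carry it over.\<close>

lemma Janiszewski_cart:
  fixes a b :: "real^2"
  assumes "compact S" "closed T" "connected (S \<inter> T)"
    and "connected_component (- S) a b" "connected_component (- T) a b"
  shows "connected_component (- (S \<union> T)) a b"
proof -
  let ?f = to_complex
  have inj: "inj ?f" and surj: "surj ?f" using bij_to_complex by (auto simp: bij_def)
  have cont: "continuous_on A ?f" for A by (rule linear_continuous_on_compose[OF continuous_on_id linear_to_complex, simplified])
  define g :: "complex \<Rightarrow> real^2" where "g z = Re z *\<^sub>R axis 1 1 + Im z *\<^sub>R axis 2 1" for z
  have gf: "g (?f x) = x" for x :: "real^2"
    by (simp add: g_def to_complex_def vec_eq_iff forall_2 axis_def)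
  have cinv: "continuous_on UNIV g" unfolding g_def by (intro continuous_intros)
  have co: "?f ` (- A) = - (?f ` A)" for A by (rule bij_image_Compl_eq[OF bij_to_complex])
  have "connected_component (- (?f ` S \<union> ?f ` T)) (?f a) (?f b)"
  proof (rule Janiszewski)
    show "compact (?f ` S)" using assms(1) cont by (rule compact_continuous_image[rotated])
    show "closed (?f ` T)" using assms(2) closed_injective_linear_image linear_to_complex inj by blast
    show "connected (?f ` S \<inter> ?f ` T)"
      unfolding image_Int[OF inj, symmetric] by (rule connected_continuous_image[OF cont assms(3)])
    show "connected_component (- ?f ` S) (?f a) (?f b)" "connected_component (- ?f ` T) (?f a) (?f b)"
      unfolding co[symmetric] using assms(4,5) by (auto intro!: connected_component_continuous_image cont)
  qed
  then have "connected_component (g ` (?f ` (- (S \<union> T)))) (g (?f a)) (g (?f b))"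
    unfolding co by (intro connected_component_continuous_image cinv) (simp add: image_Un)
  then show ?thesis by (simp add: image_image gf)
qed

text \<open>Janiszewski's theorem is applied to the curve and to the union of its part away from \<open>p\<close>
  with the complement of the ball: they meet in an arc.\<close>
lemma simple_closed_path_locally_connected_complement:
  fixes g :: "real \<Rightarrow> real^2"
  assumes "simple_path g" "pathfinish g = pathstart g" "p \<in> path_image g" "e > 0"
  obtains d where "d > 0" "\<And>a b. a \<in> ball p d \<Longrightarrow> b \<in> ball p d \<Longrightarrow>
     connected_component (- path_image g) a b \<Longrightarrow> connected_component (ball p e - path_image g) a b"
proof -
  obtain t where t: "t \<in> {0..1}" "g t = p" using assms(3) by (auto simp: path_image_def)
  \<comment> \<open>Rotating the loop puts \<open>p\<close> at both ends of the parameter interval,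
    so the part of the curve away from \<open>p\<close> is the image of a single interval.\<close>
  define h where "h = shiftpath t g"
  have h: "simple_path h" "pathfinish h = pathstart h" "path_image h = path_image g" "h 0 = p"
    using simple_path_shiftpath[OF assms(1,2), of t] endpoints_shiftpath[OF assms(2)] t
      path_image_shiftpath[OF t(1) assms(2)] pathstart_shiftpath[of t g] 
    by (auto simp: h_def pathstart_def pathfinish_def)
  have h1: "h 1 = p" using h(2,4) by (simp add: pathstart_def pathfinish_def)
  have hc: "continuous_on {0..1} h" using h(1) by (simp add: simple_path_def path_def)
  obtain n0 where n0: "n0 > 0" "\<And>s. s \<in> {0..1} \<Longrightarrow> dist s 0 < n0 \<Longrightarrow> dist (h s) (h 0) < e"
    using hc[unfolded continuous_on_iff, rule_format, of 0 e] assms(4) by auto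
  obtain n1 where n1: "n1 > 0" "\<And>s. s \<in> {0..1} \<Longrightarrow> dist s 1 < n1 \<Longrightarrow> dist (h s) (h 1) < e"
    using hc[unfolded continuous_on_iff, rule_format, of 1 e] assms(4) by auto
  \<comment> \<open>Parameters closer than \<eta> to an end stay in the ball, and \<eta> at most 1/4
    keeps the middle interval nonempty.\<close>
  define \<eta> where "\<eta> = min (1/4) (min n0 n1 / 2)"
  have \<eta>: "0 < \<eta>" "\<eta> < n0" "\<eta> < n1" "\<eta> \<le> 1/4" using n0 n1 by (auto simp: \<eta>_def min_def)
  define A where "A = h ` {\<eta>..1-\<eta>}"
  have hcA: "continuous_on {\<eta>..1-\<eta>} h" using \<eta> by (intro continuous_on_subset[OF hc]) auto
  have Acomp: "compact A" unfolding A_def by (rule compact_continuous_image[OF hcA]) simp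
  have Acon: "connected A" unfolding A_def by (rule connected_continuous_image[OF hcA]) simp
  have pA: "p \<notin> A"
  proof
    assume "p \<in> A"
    then obtain s where s: "s \<in> {\<eta>..1-\<eta>}" "h s = h 0" using h(4) by (auto simp: A_def)
    then have "s = 0 \<or> s = 1" 
      using h(1) \<eta> unfolding simple_path_def loop_free_def by (metis atLeastAtMost_iff diff_ge_0_iff_ge le_add_same_cancel1 order_trans less_imp_le order_refl zero_le_one diff_add_cancel add_increasing2)
    then show False using s \<eta> by auto
  qed
  let ?S = "path_image g"
  have "A \<subseteq> path_image h" using \<eta> unfolding A_def path_image_def by (intro image_mono) auto
  then have AS: "A \<subseteq> ?S" using h(3) by simp
  have SA: "x \<in> A" if "x \<in> ?S" "x \<notin> ball p e" for x
  proof -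
    have "x \<in> path_image h" using that(1) h(3) by simp
    then obtain s where s: "s \<in> {0..1}" "x = h s" unfolding path_image_def by blast
    have "\<not> dist s 0 < n0" "\<not> dist s 1 < n1"
      using n0(2)[of s] n1(2)[of s] s that(2) h(4) h1 by (auto simp: dist_commute)
    then have "s \<in> {\<eta>..1-\<eta>}" using s \<eta> by (auto simp: dist_real_def)
    then show ?thesis by (auto simp: A_def s)
  qed
  obtain d0 where d0: "d0 > 0" "ball p d0 \<subseteq> - A"
    using pA compact_imp_closed[OF Acomp] by (metis ComplI closed_def openE)
  show thesis
  proof (rule that[of "min d0 e"])
    show "0 < min d0 e" using d0 assms(4) by simp
    fix a b assume ab: "a \<in> ball p (min d0 e)" "b \<in> ball p (min d0 e)" "connected_component (- ?S) a b"
    \<comment> \<open>The two sets meet exactly in the arc \<open>A\<close>, and removing both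
      leaves the ball without the curve.\<close>
    have "connected_component (- (?S \<union> (A \<union> - ball p e))) a b"
    proof (rule Janiszewski_cart)
      show "compact ?S" using assms(1) by (simp add: compact_simple_path_image)
      show "closed (A \<union> - ball p e)" using Acomp by (auto intro: compact_imp_closed)
      have "?S \<inter> (A \<union> - ball p e) = A" using AS SA by blast
      then show "connected (?S \<inter> (A \<union> - ball p e))" using Acon by simp
      have "ball p (min d0 e) \<subseteq> - (A \<union> - ball p e)" using d0 by auto
      then show "connected_component (- (A \<union> - ball p e)) a b"
        unfolding connected_component_def using ab(1,2) connected_ball by blast
    qed (rule ab)
    moreover have "- (?S \<union> (A \<union> - ball p e)) = ball p e - ?S" using AS by blast
    ultimately show "connected_component (ball p e - ?S) a b" by simp
  qed
qed

lemma polygonal_domainE: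
  assumes "polygonal_domain \<Omega>"
  obtains P where "open \<Omega>" "connected \<Omega>" "\<Omega> \<noteq> {}" "finite P" "frontier \<Omega> = \<Union>P" "pairwise disjnt P"
    "\<And>C. C \<in> P \<Longrightarrow> \<exists>g. simple_path g \<and> pathfinish g = pathstart g \<and> path_image g = C"
    "\<And>C. C \<in> P \<Longrightarrow> closed C"
  using assms unfolding polygonal_domain_def simple_closed_polygon_def
  by (metis compact_imp_closed compact_simple_path_image)

text \<open>Otherwise an interior point of the closure lies on a boundary curve \<open>C\<close>. By
  the Jordan curve theorem some component of the complement of \<open>C\<close> misses the connected
  set \<Omega> and has all of \<open>C\<close> as its frontier, so an open set free of \<Omega>
  comes arbitrarily close to the point.\<close>

lemma interior_closure_polygonal_domain:
  assumes "polygonal_domain \<Omega>"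
  shows "interior (closure \<Omega>) = \<Omega>"
proof
  obtain P where P: "open \<Omega>" "connected \<Omega>" "\<Omega> \<noteq> {}" "finite P" "frontier \<Omega> = \<Union>P" "pairwise disjnt P"
    "\<And>C. C \<in> P \<Longrightarrow> \<exists>g. simple_path g \<and> pathfinish g = pathstart g \<and> path_image g = C"
    "\<And>C. C \<in> P \<Longrightarrow> closed C"
    by (rule polygonal_domainE[OF assms]) (rule that)
  show "\<Omega> \<subseteq> interior (closure \<Omega>)" using P(1) by (simp add: interior_maximal closure_subset)
  show "interior (closure \<Omega>) \<subseteq> \<Omega>"
  proof
    fix x assume x: "x \<in> interior (closure \<Omega>)"
    show "x \<in> \<Omega>"
    proof (rule ccontr)
      assume "x \<notin> \<Omega>"
      then have "x \<in> frontier \<Omega>" using x P(1) interior_subset by (auto simp: frontier_def interior_open)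
      then obtain C where C: "C \<in> P" "x \<in> C" using P(5) by auto
      obtain g where g: "simple_path g" "pathfinish g = pathstart g" "path_image g = C" using P(7)[OF C(1)] by blast
      have hom: "C homeomorphic sphere (0::real^2) 1"
      proof -
        have "C homeomorphic sphere (0::complex) 1"
          using homeomorphic_simple_path_image_circle[OF g(1,2), of 1 0] g(3) by simp
        moreover have "sphere (0::complex) 1 homeomorphic sphere (0::real^2) 1"
          by (rule homeomorphic_spheres_gen) auto
        ultimately show ?thesis by (rule homeomorphic_trans)
      qed
      have \<Omega>C: "\<Omega> \<subseteq> - C"
        using C P(1,5) by (auto simp: frontier_def interior_open)
      obtain y where y: "y \<in> \<Omega>" using P(3) by blast
      have "\<not> connected (- C)" using Jordan_Brouwer_separation[OF hom] by simp
      then have "- C \<noteq> connected_component_set (- C) y" by (metis connected_connected_component)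
      then obtain z where z: "z \<in> - C" "z \<notin> connected_component_set (- C) y"
        using connected_component_subset by blast
      define W where "W = connected_component_set (- C) z"
      have W: "W \<in> components (- C)" using z by (auto simp: W_def components_def)
      have "frontier W = C" using Jordan_Brouwer_frontier[OF hom W] by simp
      then have xW: "x \<in> closure W" using C by (auto simp: frontier_def)
      have "\<Omega> \<subseteq> connected_component_set (- C) y"
        by (rule connected_component_maximal[OF y P(2) \<Omega>C])
      moreover have "W \<inter> connected_component_set (- C) y = {}"
        using z(2) unfolding W_def by (metis connected_component_disjoint connected_component_eq_empty Int_empty_left z(1) connected_component_nonoverlap connected_component_eq connected_component_refl mem_Collect_eq)
      ultimately have W\<Omega>: "W \<inter> \<Omega> = {}" by blast
      have Wo: "open W" using W P(8)[OF C(1)] open_components by (metis open_Compl)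
      have "W \<inter> interior (closure \<Omega>) \<noteq> {}"
        using xW x open_interior by (metis disjoint_iff closure_iff_nhds_not_empty IntI empty_iff inf_commute subset_refl open_Int_closure_eq_empty)
      then have "W \<inter> closure \<Omega> \<noteq> {}" using interior_subset by blast
      then show False using W\<Omega> Wo open_Int_closure_eq_empty by blast
    qed
  qed
qed

text \<open>Near \<open>p\<close> the frontier is the single curve \<open>C\<close>, since the other
  curves are closed, finitely many and disjoint from \<open>C\<close>. The connected set \<Omega>
  avoids \<open>C\<close>, so points of it near \<open>p\<close> are joined off \<open>C\<close> in
  the ball, and a connected set that avoids the frontier and meets \<Omega> stays in
  \<Omega>.\<close>

lemma polygonal_domain_locally_connected_at_frontier:
  assumes "polygonal_domain \<Omega>" "p \<in> frontier \<Omega>" "e > 0"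
  obtains d where "d > 0" "\<And>a b. a \<in> \<Omega> \<inter> ball p d \<Longrightarrow> b \<in> \<Omega> \<inter> ball p d \<Longrightarrow>
     \<exists>V. connected V \<and> V \<subseteq> \<Omega> \<inter> ball p e \<and> a \<in> V \<and> b \<in> V"
proof -
  obtain P where P: "open \<Omega>" "connected \<Omega>" "\<Omega> \<noteq> {}" "finite P" "frontier \<Omega> = \<Union>P" "pairwise disjnt P"
    "\<And>C. C \<in> P \<Longrightarrow> \<exists>g. simple_path g \<and> pathfinish g = pathstart g \<and> path_image g = C"
    "\<And>C. C \<in> P \<Longrightarrow> closed C"
    by (rule polygonal_domainE[OF assms(1)]) (rule that)
  obtain C where C: "C \<in> P" "p \<in> C" using assms(2) P(5) by auto
  obtain g where g: "simple_path g" "pathfinish g = pathstart g" "path_image g = C" using P(7)[OF C(1)] by blast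
  have "closed (\<Union>(P - {C}))" using P(4,8) by (intro closed_Union) auto
  moreover have "p \<notin> \<Union>(P - {C})" using P(6) C by (auto simp: pairwise_def disjnt_iff)
  ultimately obtain r where r: "r > 0" "ball p r \<subseteq> - \<Union>(P - {C})"
    by (metis ComplI closed_def openE)
  obtain d where d: "d > 0" "\<And>a b. a \<in> ball p d \<Longrightarrow> b \<in> ball p d \<Longrightarrow>
     connected_component (- C) a b \<Longrightarrow> connected_component (ball p (min e r) - C) a b"
    using simple_closed_path_locally_connected_complement[OF g(1,2), of p "min e r"] g(3) C(2) assms(3) r(1)
    by auto
  show thesis
  proof (rule that[OF d(1)])
    fix a b assume ab: "a \<in> \<Omega> \<inter> ball p d" "b \<in> \<Omega> \<inter> ball p d"
    have "\<Omega> \<subseteq> - C" using C P(1,5) by (auto simp: frontier_def interior_open)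
    then have "connected_component (- C) a b"
      unfolding connected_component_def using ab P(2) by blast
    then obtain V where V: "connected V" "V \<subseteq> ball p (min e r) - C" "a \<in> V" "b \<in> V"
      using d(2)[of a b] ab unfolding connected_component_def by blast
    have "V \<subseteq> ball p r - C" using V(2) by auto
    then have "V \<inter> frontier \<Omega> = {}" using r(2) unfolding P(5) by blast
    then have "V \<subseteq> \<Omega>" using connected_Int_frontier[OF V(1), of \<Omega>] V(3) ab by blast
    then show "\<exists>V. connected V \<and> V \<subseteq> \<Omega> \<inter> ball p e \<and> a \<in> V \<and> b \<in> V"
      using V by (intro exI[of _ V]) auto
  qed
qed

section \<open>The Lipschitz representative\<close>

text \<open>Through this density, estimates known off a null set extend to closures by
  continuity.\<close>

lemma closure_open_Diff_negligible:
  assumes "open S" "negligible N"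
  shows "closure (S - N) = closure S"
proof (rule antisym)
  show "closure (S - N) \<subseteq> closure S" by (intro closure_mono) auto
  have "S \<subseteq> closure (S - N)"
  proof
    fix x assume x: "x \<in> S"
    show "x \<in> closure (S - N)"
      unfolding closure_approachable
    proof (intro allI impI)
      fix e :: real assume "e > 0"
      have "open (S \<inter> ball x e)" "x \<in> S \<inter> ball x e" using x assms(1) \<open>e > 0\<close> by auto
      then have "\<not> negligible (S \<inter> ball x e)" by (metis empty_iff open_not_negligible)
      then have "\<not> S \<inter> ball x e \<subseteq> N" using assms(2) negligible_subset by blast
      then show "\<exists>y\<in>S - N. dist y x < e" by (auto simp: dist_commute)
    qed
  qed
  then show "closure S \<subseteq> closure (S - N)" by (simp add: closure_minimal)
qed

lemma triangleD:
  assumes "2 simplex (K :: (real^2) set)"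
  shows "compact K" "convex K" "closed K" "interior K \<noteq> {}" "closure (interior K) = K" "bounded K"
    "negligible (K - interior K)" "K \<in> sets lebesgue"
proof -
  show c: "compact K" "convex K" using assms by (auto intro: compact_simplex convex_simplex)
  then show cl: "closed K" "bounded K" by (auto intro: compact_imp_closed compact_imp_bounded)
  have "aff_dim K = int DIM(real^2)" using aff_dim_simplex[OF assms] by simp
  moreover have "K \<noteq> {}" using calculation by auto
  ultimately show i: "interior K \<noteq> {}"
    using interior_rel_interior[of K] rel_interior_eq_empty[OF c(2)] by simp
  show "closure (interior K) = K" using convex_closure_interior[OF c(2) i] cl by simp
  have "negligible (frontier K)" by (rule negligible_convex_frontier[OF c(2)])
  then show "negligible (K - interior K)" using cl by (simp add: frontier_def)
  show "K \<in> sets lebesgue" using cl by simp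
qed

lemma triangulation_ofD:
  assumes "triangulation_of \<Omega> \<tau>"
  shows "finite \<tau>" "\<And>K. K \<in> \<tau> \<Longrightarrow> 2 simplex K" "\<Union>\<tau> = closure \<Omega>"
    "\<And>K K'. K \<in> \<tau> \<Longrightarrow> K' \<in> \<tau> \<Longrightarrow> K \<inter> K' face_of K"
    "\<And>K. K \<in> \<tau> \<Longrightarrow> K \<subseteq> closure \<Omega>"
  using assms unfolding triangulation_of_def triangulation_def by auto

text \<open>A face that meets the interior of a convex set is the whole set; applied twice, this
  makes \<open>K\<close> and \<open>K'\<close> equal.\<close>

lemma triangulation_interior_disjoint:
  assumes "triangulation_of \<Omega> \<tau>" "K \<in> \<tau>" "K' \<in> \<tau>" "K \<noteq> K'"
  shows "K \<inter> interior K' = {}"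
proof (rule ccontr)
  assume ne: "K \<inter> interior K' \<noteq> {}"
  note t = triangulation_ofD[OF assms(1)]
  have f: "K' \<inter> K face_of K'" "K \<inter> K' face_of K" using t(4) assms by auto
  have "K' \<inter> K = K'"
    using face_of_disjoint_interior[OF f(1)] ne interior_subset by blast
  then have "K' face_of K" using f(2) by (simp add: Int_commute)
  moreover have "K' \<inter> interior K \<noteq> {}"
  proof -
    have "interior K' \<subseteq> K" using \<open>K' \<inter> K = K'\<close> interior_subset by blast
    then have "interior K' \<subseteq> interior K" by (simp add: interior_maximal)
    then show ?thesis using triangleD(4)[OF t(2)[OF assms(3)]] interior_subset by blast
  qed
  ultimately show False using face_of_disjoint_interior assms(4) by blast
qed

lemma triangle_interior_subset:
  assumes "polygonal_domain \<Omega>" "triangulation_of \<Omega> \<tau>" "K \<in> \<tau>"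
  shows "interior K \<subseteq> \<Omega>"
  using interior_mono[OF triangulation_ofD(5)[OF assms(2,3)]] interior_closure_polygonal_domain[OF assms(1)]
  by simp

lemma triangulation_negligible_rest:
  assumes "triangulation_of \<Omega> \<tau>"
  shows "negligible (closure \<Omega> - (\<Union>K\<in>\<tau>. interior K))"
proof -
  note t = triangulation_ofD[OF assms]
  have "negligible (\<Union>K\<in>\<tau>. K - interior K)"
    using t(1) triangleD(7)[OF t(2)] by (intro negligible_Union) auto
  moreover have "closure \<Omega> - (\<Union>K\<in>\<tau>. interior K) \<subseteq> (\<Union>K\<in>\<tau>. K - interior K)"
    using t(3) by auto
  ultimately show ?thesis using negligible_subset by blast
qed

text \<open>At a boundary point \<open>p\<close> the Lipschitz extensions from the triangles agree because \<open>\<Omega>\<close> is, near \<open>p\<close>, a connected cone with vertex \<open>p\<close>.\<close>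
lemma continuous_representative_exists:
  assumes dom: "polygonal_domain \<Omega>" and tri: "triangulation_of \<Omega> \<tau>" and N: "negligible N"
    and lip: "\<And>x y. x \<notin> N \<Longrightarrow> y \<notin> N \<Longrightarrow> closed_segment x y \<subseteq> \<Omega> \<Longrightarrow> \<bar>u x - u y\<bar> \<le> M * norm (x - y)"
    and M: "M \<ge> 0"
  obtains g :: "real^2 \<Rightarrow> real" where "\<And>K. K \<in> \<tau> \<Longrightarrow> M-lipschitz_on K g"
    "\<And>K x. K \<in> \<tau> \<Longrightarrow> x \<in> interior K - N \<Longrightarrow> g x = u x"
proof -
  note t = triangulation_ofD[OF tri]
  have open\<Omega>: "open \<Omega>" using dom by (simp add: polygonal_domain_def)
  have int\<Omega>: "interior (closure \<Omega>) = \<Omega>" by (rule interior_closure_polygonal_domain[OF dom])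
  have "\<exists>g. M-lipschitz_on K g \<and> (\<forall>x\<in>interior K - N. g x = u x)" if K: "K \<in> \<tau>" for K
  proof -
    have "M-lipschitz_on (interior K - N) u"
    proof (rule lipschitz_onI[OF _ M])
      fix x y assume xy: "x \<in> interior K - N" "y \<in> interior K - N"
      have "closed_segment x y \<subseteq> interior K"
        using xy convex_interior[OF triangleD(2)[OF t(2)[OF K]]] by (simp add: closed_segment_subset)
      then show "dist (u x) (u y) \<le> M * dist x y"
        using lip[of x y] xy triangle_interior_subset[OF dom tri K] by (auto simp: dist_norm)
    qed
    then obtain g where "M-lipschitz_on (closure (interior K - N)) g" "\<forall>x\<in>interior K - N. g x = u x"
      using lipschitz_extend_closure by blast
    then show ?thesis
      using closure_open_Diff_negligible[OF open_interior N, of K] triangleD(5)[OF t(2)[OF K]] by auto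
  qed
  then obtain G where G: "\<And>K. K \<in> \<tau> \<Longrightarrow> M-lipschitz_on K (G K)"
    "\<And>K x. K \<in> \<tau> \<Longrightarrow> x \<in> interior K - N \<Longrightarrow> G K x = u x" by metis
  have near: "\<exists>x\<in>interior K - N. dist x p < e" if "K \<in> \<tau>" "p \<in> K" "e > 0" for K p e
    using that closure_open_Diff_negligible[OF open_interior N, of K] triangleD(5)[OF t(2)[OF that(1)]]
    by (metis closure_approachable)
  \<comment> \<open>Inside \<Omega> a small ball around \<open>p\<close> contains the segments
    between nearby points of the two triangles, so the estimate for \<open>u\<close> compares them
    directly.\<close>
  have agree_in: "G K p = G K' p" if K: "K \<in> \<tau>" "K' \<in> \<tau>" "p \<in> K \<inter> K'" and p: "p \<in> \<Omega>" for K K' p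
  proof (rule ccontr)
    assume ne: "G K p \<noteq> G K' p"
    define d where "d = \<bar>G K p - G K' p\<bar>"
    have d: "d > 0" using ne by (simp add: d_def)
    obtain r where r: "r > 0" "ball p r \<subseteq> \<Omega>" using open\<Omega> p openE by blast
    \<comment> \<open>Four errors of size at most \<open>M * e\<close> must add up to less than
      \<open>d\<close>; the summand 1 covers \<open>M = 0\<close>.\<close>
    define e where "e = min r (d / (8 * (M + 1)))"
    have e: "e > 0" "e \<le> r" using r d M by (auto simp: e_def)
    have "e * (M + 1) \<le> d / (8 * (M + 1)) * (M + 1)"
      using M by (intro mult_right_mono) (auto simp: e_def)
    moreover have "d / (8 * s) * s = d / 8" if "s > 0" for s :: real using that by simp
    from this[of "M + 1"] have "d / (8 * (M + 1)) * (M + 1) = d / 8" using M by simp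
    ultimately have e3: "e * (M + 1) \<le> d / 8" by linarith
    note e = e e3
    obtain x where x: "x \<in> interior K - N" "dist x p < e" using near[OF K(1), of p e] K(3) e by auto
    obtain y where y: "y \<in> interior K' - N" "dist y p < e" using near[OF K(2), of p e] K(3) e by auto
    have "closed_segment x y \<subseteq> ball p r" using x y e by (intro closed_segment_subset) (auto simp: dist_commute)
    then have 1: "\<bar>u x - u y\<bar> \<le> M * norm (x - y)" using lip[of x y] x y r by auto
    have 2: "\<bar>G K x - G K p\<bar> \<le> M * dist x p"
      using lipschitz_onD[OF G(1)[OF K(1)], of x p] x K(3) interior_subset by (force simp: dist_norm)
    have 3: "\<bar>G K' y - G K' p\<bar> \<le> M * dist y p"
      using lipschitz_onD[OF G(1)[OF K(2)], of y p] y K(3) interior_subset by (force simp: dist_norm)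
    have 4: "norm (x - y) \<le> dist x p + dist y p" using dist_triangle2[of x y p] by (simp add: dist_norm)
    have "M * norm (x - y) \<le> M * (dist x p + dist y p)" by (rule mult_left_mono[OF 4 M])
    then have "d \<le> 2 * (M * dist x p) + 2 * (M * dist y p)"
      unfolding d_def using 1 2 3 G(2)[OF K(1) x(1)] G(2)[OF K(2) y(1)] by (simp add: algebra_simps)
    also have "\<dots> \<le> 2 * (M * e) + 2 * (M * e)"
      using x y M by (intro add_mono mult_left_mono) auto
    also have "\<dots> \<le> 4 * (e * (M + 1))" using e by (simp add: algebra_simps)
    also have "\<dots> < d" using e d by simp
    finally show False by simp
  qed
  have agree: "G K p = G K' p" if K: "K \<in> \<tau>" "K' \<in> \<tau>" "p \<in> K \<inter> K'" for K K' p
  proof (cases "p \<in> \<Omega>")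
    case False
    have "p \<in> closure \<Omega>" using t(5)[OF K(1)] K(3) by auto
    then have pf: "p \<in> frontier \<Omega>" using False open\<Omega> by (simp add: frontier_def interior_open)
    \<comment> \<open>Close to \<open>p\<close> only triangles that contain \<open>p\<close>
      occur.\<close>
    have "closed (\<Union>{K\<in>\<tau>. p \<notin> K})" using t(1) triangleD(3)[OF t(2)] by (intro closed_Union) auto
    moreover have "p \<notin> \<Union>{K\<in>\<tau>. p \<notin> K}" by auto
    ultimately have "open (- \<Union>{K\<in>\<tau>. p \<notin> K})" "p \<in> - \<Union>{K\<in>\<tau>. p \<notin> K}" by auto
    then obtain r where r: "r > 0" "ball p r \<subseteq> - \<Union>{K\<in>\<tau>. p \<notin> K}" by (rule openE) (rule that)
    define U where "U = \<Omega> \<inter> ball p r"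
    \<comment> \<open>Scaling about \<open>p\<close> maps a ball around \<open>x\<close> in
      \<open>U\<close> onto a ball around the new point. Each point of the latter lies on a segment
      from \<open>p\<close> to a point of a triangle containing \<open>p\<close>, hence in the
      closure of \<Omega>, and the interior of the closure is \<Omega>.\<close>
    have cone: "p + s *\<^sub>R (x - p) \<in> U" if x: "x \<in> U" and s: "0 < s" "s \<le> 1" for x s
    proof -
      have "open U" unfolding U_def by (intro open_Int open_ball open\<Omega>)
      then obtain \<rho> where \<rho>: "\<rho> > 0" "ball x \<rho> \<subseteq> U" using x openE by blast
      let ?z = "p + s *\<^sub>R (x - p)"
      have "ball ?z (s * \<rho>) \<subseteq> closure \<Omega>"
      proof
        fix w assume w: "w \<in> ball ?z (s * \<rho>)"
        define v where "v = p + (1/s) *\<^sub>R (w - p)"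
        have wv: "w = (1 - s) *\<^sub>R p + s *\<^sub>R v" using s by (simp add: v_def algebra_simps)
        have "x - v = (1/s) *\<^sub>R (?z - w)" using s by (simp add: v_def algebra_simps)
        then have "dist x v = dist ?z w / s" using s by (simp add: dist_norm divide_inverse mult.commute)
        then have "s * dist x v = dist ?z w" using s by simp
        also have "\<dots> < s * \<rho>" using w by (simp only: mem_ball)
        finally have "v \<in> ball x \<rho>" using s by simp
        then have v: "v \<in> U" using \<rho> by blast
        then have "v \<in> \<Union>\<tau>" using t(3) closure_subset by (auto simp: U_def)
        then obtain L where L: "L \<in> \<tau>" "v \<in> L" by auto
        then have "p \<in> L" using v r(2) by (auto simp: U_def)
        then have "w \<in> L" unfolding wv using L triangleD(2)[OF t(2)[OF L(1)]] s by (intro convexD) auto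
        then show "w \<in> closure \<Omega>" using t(5)[OF L(1)] by auto
      qed
      then have "?z \<in> interior (closure \<Omega>)" using \<rho> s by (intro interiorI[OF open_ball]) auto
      moreover have "dist p ?z \<le> dist p x" using s by (simp add: dist_norm mult_left_le_one_le norm_minus_commute)
      ultimately show ?thesis using x int\<Omega> by (auto simp: U_def)
    qed
    \<comment> \<open>Both points are pulled towards \<open>p\<close> until they enter the smaller
      ball, where points of \<Omega> are joined inside \<Omega> and the ball of radius
      \<open>r\<close>.\<close>
    have connU: "connected U"
      unfolding connected_iff_connected_component
    proof (intro ballI)
      fix a b assume ab: "a \<in> U" "b \<in> U"
      obtain d where d: "d > 0" "\<And>a b. a \<in> \<Omega> \<inter> ball p d \<Longrightarrow> b \<in> \<Omega> \<inter> ball p d \<Longrightarrow>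
         \<exists>V. connected V \<and> V \<subseteq> \<Omega> \<inter> ball p r \<and> a \<in> V \<and> b \<in> V"
        by (rule polygonal_domain_locally_connected_at_frontier[OF dom pf r(1)]) (rule that)
      define s where "s = min 1 (d / (2 * r))"
      have s: "0 < s" "s \<le> 1" "s * r < d" using d r by (auto simp: s_def min_def field_simps)
      have sc: "p + s *\<^sub>R (c - p) \<in> \<Omega> \<inter> ball p d" "connected_component U c (p + s *\<^sub>R (c - p))" if c: "c \<in> U" for c
      proof -
        have "dist p (p + s *\<^sub>R (c - p)) = s * dist p c" using s by (simp add: dist_norm norm_minus_commute)
        also have "\<dots> \<le> s * r" using s c by (intro mult_left_mono) (auto simp: U_def)
        finally show "p + s *\<^sub>R (c - p) \<in> \<Omega> \<inter> ball p d" using cone[OF c s(1,2)] s by (auto simp: U_def)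
        have "closed_segment c (p + s *\<^sub>R (c - p)) \<subseteq> U"
        proof
          fix y assume "y \<in> closed_segment c (p + s *\<^sub>R (c - p))"
          then obtain m where l: "0 \<le> m" "m \<le> 1" "y = (1 - m) *\<^sub>R c + m *\<^sub>R (p + s *\<^sub>R (c - p))"
            by (auto simp: in_segment)
          have "y = p + (1 - m * (1 - s)) *\<^sub>R (c - p)" by (simp add: l(3) algebra_simps)
          moreover have "0 < 1 - m * (1 - s)" "1 - m * (1 - s) \<le> 1"
          proof -
            have "m * (1 - s) \<le> 1 * (1 - s)" using l s by (intro mult_right_mono) auto
            then show "0 < 1 - m * (1 - s)" using s by simp
            show "1 - m * (1 - s) \<le> 1" using l s by simp
          qed
          ultimately show "y \<in> U" using cone[OF c] by simp
        qed
        then show "connected_component U c (p + s *\<^sub>R (c - p))"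
          unfolding connected_component_def using connected_segment by (metis ends_in_segment)
      qed
      obtain V where "connected V" "V \<subseteq> U" "p + s *\<^sub>R (a - p) \<in> V" "p + s *\<^sub>R (b - p) \<in> V"
        using d(2)[OF sc(1)[OF ab(1)] sc(1)[OF ab(2)]] by (auto simp: U_def)
      then have "connected_component U (p + s *\<^sub>R (a - p)) (p + s *\<^sub>R (b - p))"
        by (auto simp: connected_component_def)
      then show "connected_component U a b"
        using sc(2)[OF ab(1)] sc(2)[OF ab(2)] by (meson connected_component_sym connected_component_trans)
    qed
    \<comment> \<open>The segment from a common point \<open>x\<close> to \<open>p\<close>, without
      \<open>p\<close>, lies in \<Omega>, where the extensions already agree. Now move along it
      towards \<open>p\<close>.\<close>
    have ray: "G L p = G L' p" if L: "L \<in> \<tau>" "L' \<in> \<tau>" "p \<in> L" "p \<in> L'" and x: "x \<in> L" "x \<in> L'" "x \<in> U" for L L' x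
    proof -
      have b: "\<bar>G L p - G L' p\<bar> \<le> s * (2 * M * dist x p)" if s: "0 < s" "s \<le> 1" for s
      proof -
        let ?z = "p + s *\<^sub>R (x - p)"
        have "?z = (1 - s) *\<^sub>R p + s *\<^sub>R x" by (simp add: algebra_simps)
        then have z: "?z \<in> L" "?z \<in> L'"
          using L x s triangleD(2)[OF t(2)[OF L(1)]] triangleD(2)[OF t(2)[OF L(2)]] by (auto intro: convexD)
        have "G L ?z = G L' ?z" using agree_in[of L L' ?z] L z cone[OF x(3) s] by (auto simp: U_def)
        moreover have "dist (G L ?z) (G L p) \<le> M * dist ?z p" "dist (G L' ?z) (G L' p) \<le> M * dist ?z p"
          using lipschitz_onD[OF G(1)[OF L(1)] z(1) L(3)] lipschitz_onD[OF G(1)[OF L(2)] z(2) L(4)] by auto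
        moreover have "dist ?z p = s * dist x p" using s by (simp add: dist_norm)
        ultimately show ?thesis by (simp add: dist_norm algebra_simps)
      qed
      have "((\<lambda>s. s * (2 * M * dist x p)) \<longlongrightarrow> 0 * (2 * M * dist x p)) (at_right 0)"
        by (intro tendsto_intros)
      moreover have "\<forall>\<^sub>F s in at_right 0. \<bar>G L p - G L' p\<bar> \<le> s * (2 * M * dist x p)"
        unfolding eventually_at_right_field using b by (intro exI[of _ 1]) auto
      ultimately have "\<bar>G L p - G L' p\<bar> \<le> 0 * (2 * M * dist x p)"
        by (intro tendsto_lowerbound) auto
      then show ?thesis by simp
    qed
    show ?thesis
    proof (rule ccontr)
      assume ne: "G K p \<noteq> G K' p"
      \<comment> \<open>The triangles at \<open>p\<close> are sorted by the value they assign to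
        \<open>p\<close>. The two closed unions cover the connected set \<open>U\<close>, both meet
        it and are disjoint in it, which is impossible.\<close>
      define A where "A = \<Union>{L\<in>\<tau>. p \<in> L \<and> G L p = G K p}"
      define B where "B = \<Union>{L\<in>\<tau>. p \<in> L \<and> G L p \<noteq> G K p}"
      have cl: "closed A" "closed B" using t(1) triangleD(3)[OF t(2)] by (auto simp: A_def B_def intro!: closed_Union)
      have "U \<subseteq> A \<union> B"
      proof
        fix x assume x: "x \<in> U"
        then have "x \<in> \<Union>\<tau>" using t(3) closure_subset by (auto simp: U_def)
        then obtain L where L: "L \<in> \<tau>" "x \<in> L" by auto
        then have "p \<in> L" using x r(2) by (auto simp: U_def)
        then show "x \<in> A \<union> B" using L by (auto simp: A_def B_def)
      qed
      moreover have "A \<inter> B \<inter> U = {}"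
      proof (rule ccontr)
        assume "A \<inter> B \<inter> U \<noteq> {}"
        then obtain x where x: "x \<in> A" "x \<in> B" "x \<in> U" by blast
        from x(1) obtain L where L: "L \<in> \<tau>" "p \<in> L" "G L p = G K p" "x \<in> L" unfolding A_def by blast
        from x(2) obtain L' where L': "L' \<in> \<tau>" "p \<in> L'" "G L' p \<noteq> G K p" "x \<in> L'" unfolding B_def by blast
        show False using ray[OF L(1) L'(1) L(2) L'(2) L(4) L'(4) x(3)] L(3) L'(3) by simp
      qed
      moreover have meet: "L \<inter> U \<noteq> {}" if L: "L \<in> \<tau>" "p \<in> L" for L
      proof -
        obtain x where "x \<in> interior L - N" "dist x p < r" using near[OF L r(1)] by blast
        then have "x \<in> L \<inter> U" using triangle_interior_subset[OF dom tri L(1)] interior_subset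
          by (auto simp: U_def dist_commute)
        then show ?thesis by blast
      qed
      have "A \<inter> U \<noteq> {}" using meet[OF K(1)] K by (auto simp: A_def)
      moreover have "B \<inter> U \<noteq> {}" using meet[OF K(2)] K ne by (fastforce simp: B_def)
      ultimately show False
        using connU cl unfolding connected_closed by blast
    qed
  next
    case True
    then show ?thesis by (rule agree_in[OF K])
  qed
  define g where "g x = G (SOME K. K \<in> \<tau> \<and> x \<in> K) x" for x
  have gG: "g x = G K x" if "K \<in> \<tau>" "x \<in> K" for K x
  proof -
    have "(SOME K. K \<in> \<tau> \<and> x \<in> K) \<in> \<tau> \<and> x \<in> (SOME K. K \<in> \<tau> \<and> x \<in> K)"
      by (rule someI[of _ K]) (simp add: that)
    then show ?thesis unfolding g_def using agree[of "SOME K. K \<in> \<tau> \<and> x \<in> K" K x] that by simp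
  qed
  show thesis
  proof (rule that[of g])
    show "M-lipschitz_on K g" if "K \<in> \<tau>" for K
      using lipschitz_on_transform[OF G(1)[OF that] gG[OF that]] .
    show "g x = u x" if "K \<in> \<tau>" "x \<in> interior K - N" for K x
    proof -
      have "x \<in> K" using that(2) interior_subset by blast
      then show ?thesis using gG[OF that(1)] G(2)[OF that] by simp
    qed
  qed
qed

text \<open>Two triangles meeting in a common face \<open>E\<close> diverge from it at a linear rate: if \<open>x\<close>, \<open>y\<close> have
  weights \<open>s\<close>, \<open>t\<close> on the vertices not in \<open>E\<close>, then \<open>s + t\<close> is bounded by a multiple of the distance.\<close>
lemma lipschitz_across_common_face:
  fixes g :: "'a::euclidean_space \<Rightarrow> real"
  assumes K: "n simplex K" "m simplex K'" and face: "K \<inter> K' face_of K" "K' \<inter> K face_of K'"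
    and L: "L-lipschitz_on K g" "L-lipschitz_on K' g"
  shows "\<exists>C. \<forall>x\<in>K. \<forall>y\<in>K'. \<bar>g x - g y\<bar> \<le> C * dist x y"
proof -
  have L0: "L \<ge> 0" using L(1) by (rule lipschitz_on_nonneg)
  have cK: "compact K" "compact K'" "convex K" "convex K'" using K compact_simplex convex_simplex by auto
  define E where "E = K \<inter> K'"
  have E: "E face_of K" "E face_of K'" using face by (auto simp: E_def Int_commute)
  have cE: "convex E" using E(1) by (rule face_of_imp_convex)
  show ?thesis
  proof (cases "E = {}")
    case True
    \<comment> \<open>Disjoint compact sets have positive distance, and a bound for \<open>g\<close>
      then takes the place of a Lipschitz constant.\<close>
    obtain d where d: "d > 0" "\<And>x y. x \<in> K \<Longrightarrow> y \<in> K' \<Longrightarrow> d \<le> dist x y"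
      using separate_compact_closed[OF cK(1) compact_imp_closed[OF cK(2)]] True by (auto simp: E_def)
    have "bounded (g ` (K \<union> K'))"
      unfolding image_Un using L cK by (auto intro!: compact_imp_bounded compact_continuous_image dest: lipschitz_on_continuous_on)
    then obtain B where B: "\<And>x. x \<in> K \<union> K' \<Longrightarrow> \<bar>g x\<bar> \<le> B" "B > 0"
      by (auto simp: bounded_pos)
    show ?thesis
    proof (intro exI[of _ "2 * B / d"] ballI)
      fix x y assume xy: "x \<in> K" "y \<in> K'"
      have "\<bar>g x - g y\<bar> \<le> 2 * B" using B(1)[of x] B(1)[of y] xy by auto
      also have "\<dots> = 2 * B / d * d" using d by simp
      also have "\<dots> \<le> 2 * B / d * dist x y" using d B xy by (intro mult_left_mono) auto
      finally show "\<bar>g x - g y\<bar> \<le> 2 * B / d * dist x y" .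
    qed
  next
    case False
    \<comment> \<open>From a relatively interior point of \<open>E\<close> one can move a little in
      every direction of the affine hull of \<open>E\<close>.\<close>
    then obtain e0 where e0: "e0 \<in> rel_interior E" using rel_interior_eq_empty[OF cE] by blast
    have e0E: "e0 \<in> E" using e0 rel_interior_subset by blast
    \<comment> \<open>A simplex is the join of its face \<open>E\<close> and the hull
      \<open>Q\<close> of the vertices off \<open>E\<close>; \<open>s\<close> is the weight on
      \<open>Q\<close>.\<close>
    have split: "\<exists>Q. compact Q \<and> Q \<subseteq> K0 \<and> Q \<inter> E = {} \<and>
        (\<forall>x\<in>K0. \<exists>s e q. 0 \<le> s \<and> s \<le> 1 \<and> e \<in> E \<and> q \<in> Q \<and> x = (1 - s) *\<^sub>R e + s *\<^sub>R q)"
      if K0: "k simplex K0" "E face_of K0" "\<not> K0 \<subseteq> E" for k K0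
    proof -
      obtain S where S: "finite S" "\<not> affine_dependent S" "K0 = convex hull S"
        using K0(1) unfolding simplex by blast
      obtain c where c: "c \<subseteq> S" "E = convex hull c"
        using K0(2) face_of_convex_hull_affine_independent[OF S(2), of E] S(3) by blast
      let ?Q = "convex hull (S - c)"
      have ne: "?Q \<noteq> {}" using K0(3) c S(3) by auto
      have "K0 = convex hull (c \<union> (S - c))" using S(3) c(1) by (simp add: Un_absorb1)
      also have "\<dots> = convex hull (E \<union> ?Q)" unfolding c(2) by (rule hull_Un) (auto intro: convex_Inter)
      also have "\<dots> = {u *\<^sub>R s + v *\<^sub>R t | u v s t. u \<ge> 0 \<and> v \<ge> 0 \<and> u + v = 1 \<and> s \<in> E \<and> t \<in> ?Q}"
        by (rule convex_hull_union_two[OF cE False _ ne]) simp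
      finally have eq: "K0 = {u *\<^sub>R s + v *\<^sub>R t | u v s t. u \<ge> 0 \<and> v \<ge> 0 \<and> u + v = 1 \<and> s \<in> E \<and> t \<in> ?Q}" .
      show ?thesis
      proof (intro exI[of _ ?Q] conjI ballI)
        show "compact ?Q" using S by (simp add: finite_imp_compact_convex_hull)
        show "?Q \<subseteq> K0" unfolding S(3) by (rule hull_mono) auto
        have "\<not> affine_dependent ((S - c) \<union> c)" using S(2) c(1) by (simp add: Un_absorb2)
        from convex_hull_Int[OF this] show "?Q \<inter> E = {}" unfolding c(2) by (simp add: Int_commute)
        fix x assume "x \<in> K0"
        then obtain u v s t where uv: "u \<ge> 0" "v \<ge> 0" "u + v = 1" "s \<in> E" "t \<in> ?Q" "x = u *\<^sub>R s + v *\<^sub>R t"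
          using eq by blast
        moreover have "u = 1 - v" "v \<le> 1" using uv by simp_all
        ultimately have "0 \<le> v \<and> v \<le> 1 \<and> s \<in> E \<and> t \<in> ?Q \<and> x = (1 - v) *\<^sub>R s + v *\<^sub>R t" by blast
        then show "\<exists>s e q. 0 \<le> s \<and> s \<le> 1 \<and> e \<in> E \<and> q \<in> ?Q \<and> x = (1 - s) *\<^sub>R e + s *\<^sub>R q" by blast
      qed
    qed
    consider "K \<subseteq> E" | "K' \<subseteq> E" | "\<not> K \<subseteq> E" "\<not> K' \<subseteq> E" by blast
    then show ?thesis
    proof cases
      case 1
      then have "K \<subseteq> K'" by (auto simp: E_def)
      then show ?thesis using lipschitz_onD[OF L(2)] by (intro exI[of _ L]) (auto simp: dist_real_def)
    next
      case 2
      then have "K' \<subseteq> K" by (auto simp: E_def)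
      then show ?thesis using lipschitz_onD[OF L(1)] by (intro exI[of _ L]) (auto simp: dist_real_def)
    next
      case 3
      obtain Q where Q: "compact Q" "Q \<subseteq> K" "Q \<inter> E = {}"
        "\<forall>x\<in>K. \<exists>s e q. 0 \<le> s \<and> s \<le> 1 \<and> e \<in> E \<and> q \<in> Q \<and> x = (1 - s) *\<^sub>R e + s *\<^sub>R q"
        using split[OF K(1) E(1) 3(1)] by (elim exE conjE) (rule that)
      obtain Q' where Q': "compact Q'" "Q' \<subseteq> K'" "Q' \<inter> E = {}"
        "\<forall>x\<in>K'. \<exists>s e q. 0 \<le> s \<and> s \<le> 1 \<and> e \<in> E \<and> q \<in> Q' \<and> x = (1 - s) *\<^sub>R e + s *\<^sub>R q"
        using split[OF K(2) E(2) 3(2)] by (elim exE conjE) (rule that)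
      \<comment> \<open>\<open>W\<close> is the direction space of \<open>E\<close>, and
        \<open>D\<close> collects the normalized differences between directions into
        \<open>K\<close> and into \<open>K'\<close>. Disjointness of \<open>D\<close> and
        \<open>W\<close> says that the two simplices open at a positive angle; compactness of
        \<open>D\<close> makes this quantitative.\<close>
      define W where "W = span ((\<lambda>e. e - e0) ` E)"
      define D where "D = (\<lambda>(s, q, q'). s *\<^sub>R (q - e0) - (1 - s) *\<^sub>R (q' - e0)) ` ({0..1} \<times> Q \<times> Q')"
      have "compact D"
        unfolding D_def split_def using Q(1) Q'(1)
        by (intro compact_continuous_image continuous_intros compact_Times) auto
      moreover have "closed W" unfolding W_def by (rule closed_span)
      moreover have "D \<inter> W = {}"
      proof (rule ccontr)
        assume "D \<inter> W \<noteq> {}"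
        then obtain v where v: "v \<in> {0..1} \<times> Q \<times> Q'"
          "(case v of (s, q, q') \<Rightarrow> s *\<^sub>R (q - e0) - (1 - s) *\<^sub>R (q' - e0)) \<in> W"
          unfolding D_def by blast
        obtain s q q' where "v = (s, q, q')" by (rule prod_cases3[of v]) (rule that)
        with v have sq: "0 \<le> s" "s \<le> 1" "q \<in> Q" "q' \<in> Q'"
          "s *\<^sub>R (q - e0) - (1 - s) *\<^sub>R (q' - e0) \<in> W" by simp_all
        define w where "w = s *\<^sub>R (q - e0) - (1 - s) *\<^sub>R (q' - e0)"
        have aff: "e0 + r *\<^sub>R v \<in> affine hull E" if "v \<in> W" for r v
        proof -
          have "r *\<^sub>R v \<in> W" using that unfolding W_def by (rule span_mul)
          moreover have "(\<lambda>e. e - e0) = (+) (- e0)" by auto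
          then have "affine hull E = (+) e0 ` W"
            using affine_hull_span_gen[OF hull_inc[OF e0E]] by (simp only: W_def)
          ultimately show ?thesis by blast
        qed
        obtain r where r: "r > 0" "ball e0 r \<inter> affine hull E \<subseteq> E"
          using e0 by (auto simp: mem_rel_interior_ball)
        \<comment> \<open>So small that \<open>e0 + (2 * \<rho>) *\<^sub>R w\<close> stays in
          \<open>E\<close> and the weights of \<open>q\<close> and \<open>q'\<close> below are at
          most 1.\<close>
        define \<rho> where "\<rho> = min (1/2) (r / (4 * (norm w + 1)))"
        have n: "norm w + 1 > 0" by (rule add_nonneg_pos) auto
        have "0 < r / (4 * (norm w + 1))" by (intro divide_pos_pos r(1) mult_pos_pos n) simp
        then have \<rho>: "0 < \<rho>" "\<rho> \<le> 1/2" unfolding \<rho>_def by (simp_all only: min_less_iff_conj min.cobounded1) simp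
        have "2 * \<rho> * norm w \<le> 2 * (r / (4 * (norm w + 1))) * (norm w + 1)"
          using r by (intro mult_mono) (auto simp: \<rho>_def)
        also have "\<dots> < r"
        proof -
          have "2 * (r / (4 * c)) * c < r" if "c > 0" for c :: real using that r by simp
          from this[OF n] show ?thesis .
        qed
        finally have "e0 + (2 * \<rho>) *\<^sub>R w \<in> ball e0 r" using \<rho> by (simp add: dist_norm)
        moreover have "w \<in> W" using sq(5) by (simp add: w_def)
        ultimately have eE: "e0 + (2 * \<rho>) *\<^sub>R w \<in> E" using r(2) aff by blast
        define z where "z = (1 - \<rho> * s) *\<^sub>R e0 + (\<rho> * s) *\<^sub>R q"
        have \<rho>s: "0 \<le> \<rho> * s" "\<rho> * s < 1"
          using \<rho> sq mult_mono[of \<rho> "1/2" s 1] by auto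
        have \<rho>t: "0 \<le> 2 * \<rho> * (1 - s)" "2 * \<rho> * (1 - s) \<le> 1"
          using \<rho> sq mult_mono[of "2 * \<rho>" 1 "1 - s" 1] by auto
        have e0K: "e0 \<in> K" "e0 \<in> K'" using e0E by (auto simp: E_def)
        have zK: "z \<in> K" unfolding z_def using \<rho>s e0K sq Q(2) by (intro convexD[OF cK(3)]) auto
        define y where "y = (1 - 2 * \<rho> * (1 - s)) *\<^sub>R e0 + (2 * \<rho> * (1 - s)) *\<^sub>R q'"
        have yK: "y \<in> K'" unfolding y_def using \<rho>t e0K sq Q'(2) by (intro convexD[OF cK(4)]) auto
        \<comment> \<open>The point \<open>z\<close> of \<open>K\<close> is the midpoint of a point
          of \<open>E\<close> and of the point \<open>y\<close> of \<open>K'\<close>, hence lies in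
          \<open>K'\<close> and so in \<open>E\<close>. Unless \<open>s = 0\<close>, it is also
          inside a segment from \<open>e0\<close> to the point \<open>q\<close> off
          \<open>E\<close>, against the face property.\<close>
        have "z = (1/2) *\<^sub>R (e0 + (2 * \<rho>) *\<^sub>R w) + (1/2) *\<^sub>R y"
        proof -
          have 1: "z = e0 + (\<rho> * s) *\<^sub>R (q - e0)" by (simp add: z_def algebra_simps)
          have "\<rho> *\<^sub>R w = (\<rho> * s) *\<^sub>R (q - e0) - (\<rho> * (1 - s)) *\<^sub>R (q' - e0)"
            by (simp only: w_def scaleR_right_diff_distrib scaleR_scaleR)
          then have 2: "(1/2) *\<^sub>R (e0 + (2 * \<rho>) *\<^sub>R w)
              = (1/2) *\<^sub>R e0 + ((\<rho> * s) *\<^sub>R (q - e0) - (\<rho> * (1 - s)) *\<^sub>R (q' - e0))"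
            by (simp add: scaleR_right_distrib)
          have "y = e0 + (2 * \<rho> * (1 - s)) *\<^sub>R (q' - e0)" by (simp add: y_def algebra_simps)
          then have 3: "(1/2) *\<^sub>R y = (1/2) *\<^sub>R e0 + (\<rho> * (1 - s)) *\<^sub>R (q' - e0)"
            by (simp add: scaleR_right_distrib)
          have "(1/2) *\<^sub>R e0 + (1/2) *\<^sub>R e0 = e0" by (simp flip: scaleR_left_distrib)
          moreover have "h + (a - b) + (h + b) = h + h + a" for h a b :: 'a by simp
          ultimately show ?thesis unfolding 1 2 3 by simp
        qed
        moreover have "e0 + (2 * \<rho>) *\<^sub>R w \<in> K'" using eE by (simp add: E_def)
        ultimately have "z \<in> K'" using yK by (auto intro!: convexD[OF cK(4)])
        then have zE: "z \<in> E" using zK by (simp add: E_def)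
        show False
        proof (cases "s = 0")
          case True
          \<comment> \<open>Here \<open>z = e0\<close> says nothing; instead \<open>q'\<close> lies
            in the affine hull of \<open>E\<close>, which meets \<open>K'\<close> only in
            \<open>E\<close>.\<close>
          then have "q' = e0 + (-1) *\<^sub>R w" by (simp add: w_def)
          then have "q' \<in> affine hull E" using aff[OF \<open>w \<in> W\<close>, of "-1"] by simp
          then have "q' \<in> E" using face_of_imp_eq_affine_Int[OF cK(4) E(2)] sq(4) Q'(2) by blast
          then show False using Q'(3) sq(4) by blast
        next
          case False
          have "q \<notin> E" using Q(3) sq(3) by blast
          then have "e0 \<noteq> q" using e0E by auto
          then have "z \<in> open_segment e0 q"
            unfolding in_segment z_def using \<rho>s \<rho> sq False by (auto intro!: exI[of _ "\<rho> * s"])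
          then have "q \<in> E" using face_ofD[OF E(1) _ e0K(1) _ zE] sq(3) Q(2) by blast
          then show False using \<open>q \<notin> E\<close> by blast
        qed
      qed
      ultimately obtain \<mu> where \<mu>: "\<mu> > 0" "\<And>d w. d \<in> D \<Longrightarrow> w \<in> W \<Longrightarrow> \<mu> \<le> dist d w"
        using separate_compact_closed by metis
      obtain B where B: "B > 0" "\<And>x. x \<in> K \<union> K' \<Longrightarrow> norm x \<le> B"
        using bounded_pos[of "K \<union> K'"] cK compact_imp_bounded by auto
      show ?thesis
      \<comment> \<open>The path from \<open>x\<close> to \<open>e\<close> to \<open>e'\<close> to
        \<open>y\<close> uses only estimates inside one simplex. Its first and last parts are at
        most \<open>2 * B\<close> times the weights \<open>s\<close> and \<open>t\<close>; each
        counts twice because the middle part is estimated through them.\<close>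
      proof (intro exI[of _ "L * (4 * B / \<mu> + 1)"] ballI)
        fix x y assume xy: "x \<in> K" "y \<in> K'"
        obtain s e q where s: "0 \<le> s" "s \<le> 1" "e \<in> E" "q \<in> Q" "x = (1 - s) *\<^sub>R e + s *\<^sub>R q"
          using bspec[OF Q(4) xy(1)] by blast
        obtain t e' q' where t: "0 \<le> t" "t \<le> 1" "e' \<in> E" "q' \<in> Q'" "y = (1 - t) *\<^sub>R e' + t *\<^sub>R q'"
          using bspec[OF Q'(4) xy(2)] by blast
        \<comment> \<open>Dividing \<open>x - y\<close> by \<open>s + t\<close> gives the difference
          of a point of \<open>D\<close> and a point of \<open>W\<close>.\<close>
        have st: "\<mu> * (s + t) \<le> dist x y"
        proof (cases "s + t = 0")
          case False
          define \<sigma> where "\<sigma> = s + t"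
          have \<sigma>: "\<sigma> > 0" using False s t by (simp add: \<sigma>_def)
          define d where "d = (s/\<sigma>) *\<^sub>R (q - e0) - (1 - s/\<sigma>) *\<^sub>R (q' - e0)"
          have "d \<in> D" unfolding D_def d_def
            using s t \<sigma> by (auto intro!: image_eqI[of _ _ "(s/\<sigma>, q, q')"] simp: \<sigma>_def)
          moreover define w where "w = (1/\<sigma>) *\<^sub>R ((1 - t) *\<^sub>R (e' - e0) - (1 - s) *\<^sub>R (e - e0))"
          have "w \<in> W" unfolding w_def W_def
            using s t by (intro span_mul span_diff span_base) auto
          ultimately have "\<mu> \<le> dist d w" using \<mu>(2) by blast
          moreover have "\<sigma> *\<^sub>R (d - w) = x - y"
          proof -
            have "\<sigma> *\<^sub>R d = s *\<^sub>R (q - e0) - t *\<^sub>R (q' - e0)"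
            proof -
              have 1: "\<sigma> * (s/\<sigma>) = s" using \<sigma> by simp
              have "\<sigma> * (1 - s/\<sigma>) = \<sigma> - \<sigma> * (s/\<sigma>)" by (simp only: right_diff_distrib mult_1_right)
              also have "\<dots> = t" unfolding 1 by (simp add: \<sigma>_def)
              finally have 2: "\<sigma> * (1 - s/\<sigma>) = t" .
              have "\<sigma> *\<^sub>R d = (\<sigma> * (s/\<sigma>)) *\<^sub>R (q - e0) - (\<sigma> * (1 - s/\<sigma>)) *\<^sub>R (q' - e0)"
                by (simp only: d_def scaleR_right_diff_distrib scaleR_scaleR)
              then show ?thesis unfolding 1 2 .
            qed
            moreover have "\<sigma> *\<^sub>R w = (1 - t) *\<^sub>R (e' - e0) - (1 - s) *\<^sub>R (e - e0)"
              using \<sigma> by (simp add: w_def)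
            ultimately show ?thesis by (simp add: scaleR_diff_right s(5) t(5)) (simp add: algebra_simps)
          qed
          then have "dist x y = \<sigma> * dist d w" using \<sigma> by (metis abs_of_pos dist_norm norm_scaleR)
          ultimately show ?thesis using \<sigma> by (simp add: \<sigma>_def mult.commute)
        qed simp
        have nrm: "norm (a - b) \<le> 2 * B" if "a \<in> K \<union> K'" "b \<in> K \<union> K'" for a b
          using norm_triangle_ineq4[of a b] B(2)[OF that(1)] B(2)[OF that(2)] by linarith
        have eK: "e \<in> K" "e \<in> K'" "e' \<in> K" "e' \<in> K'" using s t by (auto simp: E_def)
        have "x - e = s *\<^sub>R (q - e)" "y - e' = t *\<^sub>R (q' - e')" by (simp_all add: s(5) t(5) algebra_simps)
        then have dx: "dist x e \<le> s * (2 * B)" "dist y e' \<le> t * (2 * B)"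
          using nrm[of q e] nrm[of q' e'] eK s t Q(2) Q'(2) by (auto simp: dist_norm intro!: mult_left_mono)
        have g1: "\<bar>g x - g e\<bar> \<le> L * dist x e" "\<bar>g e - g e'\<bar> \<le> L * dist e e'" "\<bar>g e' - g y\<bar> \<le> L * dist y e'"
          using lipschitz_onD[OF L(1) xy(1) eK(1)] lipschitz_onD[OF L(1) eK(1,3)] lipschitz_onD[OF L(2) xy(2) eK(4)]
          by (auto simp: dist_real_def abs_minus_commute)
        have "dist e e' \<le> dist x e + dist x y + dist y e'"
          using dist_triangle[of e e' x] dist_triangle[of x e' y] by (simp add: dist_commute)
        then have "L * dist e e' \<le> L * (dist x e + dist x y + dist y e')" using L0 by (rule mult_left_mono)
        then have "\<bar>g x - g y\<bar> \<le> L * (2 * dist x e + 2 * dist y e' + dist x y)"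
          using g1 by (simp add: algebra_simps)
        also have "\<dots> \<le> L * (4 * B * (s + t) + dist x y)"
          using dx L0 by (intro mult_left_mono) (auto simp: algebra_simps)
        also have "\<dots> \<le> L * (4 * B * (dist x y / \<mu>) + dist x y)"
        proof -
          have "s + t \<le> dist x y / \<mu>" using st \<mu>(1) by (simp add: field_simps)
          then show ?thesis using L0 B(1) by (intro mult_left_mono add_right_mono) auto
        qed
        also have "\<dots> = L * (4 * B / \<mu> + 1) * dist x y" by (simp add: algebra_simps)
        finally show "\<bar>g x - g y\<bar> \<le> L * (4 * B / \<mu> + 1) * dist x y" .
      qed
    qed
  qed
qed

section \<open>A Lipschitz function on the whole plane\<close>

lemma lipschitz_on_triangulation:
  assumes tri: "triangulation_of \<Omega> \<tau>" and L: "\<And>K. K \<in> \<tau> \<Longrightarrow> L-lipschitz_on K g"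
  shows "\<exists>C. C-lipschitz_on (closure \<Omega>) (g :: real^2 \<Rightarrow> real)"
proof -
  note t = triangulation_ofD[OF tri]
  have "\<exists>C. \<forall>x\<in>K. \<forall>y\<in>K'. \<bar>g x - g y\<bar> \<le> C * dist x y" if "K \<in> \<tau>" "K' \<in> \<tau>" for K K'
    using lipschitz_across_common_face[OF t(2)[OF that(1)] t(2)[OF that(2)] t(4)[OF that] t(4)[OF that(2,1)] L[OF that(1)] L[OF that(2)]] .
  then obtain C where C: "\<And>K K' x y. K \<in> \<tau> \<Longrightarrow> K' \<in> \<tau> \<Longrightarrow> x \<in> K \<Longrightarrow> y \<in> K' \<Longrightarrow> \<bar>g x - g y\<bar> \<le> C K K' * dist x y"
    by metis
  define M where "M = (\<Sum>(K, K')\<in>\<tau> \<times> \<tau>. \<bar>C K K'\<bar>)"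
  have "M-lipschitz_on (closure \<Omega>) g"
  proof (rule lipschitz_onI)
    fix x y assume "x \<in> closure \<Omega>" "y \<in> closure \<Omega>"
    then obtain K K' where K: "K \<in> \<tau>" "K' \<in> \<tau>" "x \<in> K" "y \<in> K'" using t(3) by (metis UnionE)
    have "\<bar>C K K'\<bar> \<le> M"
      unfolding M_def using member_le_sum[of "(K, K')" "\<tau> \<times> \<tau>" "\<lambda>(K, K'). \<bar>C K K'\<bar>"] t(1) K by auto
    then have "C K K' * dist x y \<le> M * dist x y" by (intro mult_right_mono) auto
    then show "dist (g x) (g y) \<le> M * dist x y" using C[OF K] by (simp add: dist_real_def)
  qed (auto simp: M_def intro!: sum_nonneg)
  then show ?thesis by blast
qed

text \<open>McShane's extension is the infimum of the cones \<open>g y + C * dist x y\<close>.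
  Truncation at -B and B keeps the Lipschitz constant and makes the extension bounded, as
  mollification asks for.\<close>

lemma lipschitz_extension_real:
  fixes g :: "'a::metric_space \<Rightarrow> real"
  assumes g: "C-lipschitz_on S g" and S: "S \<noteq> {}" and B: "\<And>x. x \<in> S \<Longrightarrow> \<bar>g x\<bar> \<le> B"
  obtains h where "C-lipschitz_on UNIV h" "\<And>x. x \<in> S \<Longrightarrow> h x = g x" "\<And>x. \<bar>h x\<bar> \<le> B"
proof -
  have C: "C \<ge> 0" using g by (rule lipschitz_on_nonneg)
  have B0: "B \<ge> 0" using S B abs_ge_zero by (metis all_not_in_conv order_trans)
  define h where "h x = (INF y\<in>S. g y + C * dist x y)" for x
  have bdd: "bdd_below ((\<lambda>y. g y + C * dist x y) ` S)" for x
  proof (rule bdd_belowI2)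
    fix y assume "y \<in> S"
    then have "- B \<le> g y" using B[of y] by linarith
    then show "- B \<le> g y + C * dist x y" using C by (simp add: add_increasing2)
  qed
  have le: "h x \<le> h x' + C * dist x x'" for x x'
  proof -
    have "h x - C * dist x x' \<le> h x'"
      unfolding h_def[of x']
    proof (rule cINF_greatest[OF S])
      fix y assume y: "y \<in> S"
      have "h x \<le> g y + C * dist x y" unfolding h_def by (rule cINF_lower[OF bdd y])
      moreover have "C * dist x y \<le> C * (dist x x' + dist x' y)"
        using C dist_triangle by (intro mult_left_mono) auto
      ultimately show "h x - C * dist x x' \<le> g y + C * dist x' y" by (simp add: algebra_simps)
    qed
    then show ?thesis by simp
  qed
  have eq: "h x = g x" if x: "x \<in> S" for x
  proof (rule antisym)
    show "h x \<le> g x" unfolding h_def using cINF_lower[OF bdd x, of x] by simp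
    show "g x \<le> h x" unfolding h_def
    proof (rule cINF_greatest[OF S])
      fix y assume "y \<in> S"
      then show "g x \<le> g y + C * dist x y" using lipschitz_onD[OF g x, of y] by (simp add: dist_real_def)
    qed
  qed
  define k where "k x = max (- B) (min B (h x))" for x
  show thesis
  proof (rule that[of k])
    show "C-lipschitz_on UNIV k"
    proof (rule lipschitz_onI[OF _ C])
      fix x y
      have "\<bar>k x - k y\<bar> \<le> \<bar>h x - h y\<bar>" by (auto simp: k_def max_def min_def)
      also have "\<dots> \<le> C * dist x y" using le[of x y] le[of y x] by (simp add: dist_commute)
      finally show "dist (k x) (k y) \<le> C * dist x y" by (simp add: dist_real_def)
    qed
    show "k x = g x" if "x \<in> S" for x using eq[OF that] B[OF that] by (auto simp: k_def)
    show "\<bar>k x\<bar> \<le> B" for x using B0 by (auto simp: k_def)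
  qed
qed

section \<open>Divergence theorem on a triangle\<close>

text \<open>Makes Fubini's theorem for the product of two lines available on
  \<open>real^2\<close>.\<close>

lemma lborel_vec2:
  "(lborel :: (real^2) measure) = distr (lborel \<Otimes>\<^sub>M lborel) borel (\<lambda>(x, y). \<chi> i. if i = 1 then x else y)"
proof (rule lborel_eqI)
  let ?v = "\<lambda>(x::real, y::real). (\<chi> i. if i = 1 then x else y) :: real^2"
  have "continuous_on UNIV ?v"
    unfolding split_def
  proof (rule continuous_on_vec_lambda)
    show "continuous_on UNIV (\<lambda>x. if i = 1 then fst x else snd x)" for i :: 2
      by (cases "i = 1") (auto intro!: continuous_intros)
  qed
  then have m: "?v \<in> borel_measurable (lborel \<Otimes>\<^sub>M lborel)"
    unfolding lborel_prod by (simp add: borel_measurable_continuous_onI)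
  fix l u :: "real^2" assume le: "\<And>b. b \<in> Basis \<Longrightarrow> l \<bullet> b \<le> u \<bullet> b"
  have le': "l $ i \<le> u $ i" for i using le[of "axis i 1"] by (simp add: cart_eq_inner_axis axis_in_Basis_iff)
  have "?v -` box l u \<inter> space (lborel \<Otimes>\<^sub>M lborel) = box (l$1) (u$1) \<times> box (l$2) (u$2)"
    by (auto simp: mem_box_cart forall_2 space_pair_measure)
  then have "emeasure (distr (lborel \<Otimes>\<^sub>M lborel) borel ?v) (box l u) = emeasure (lborel \<Otimes>\<^sub>M lborel) (box (l$1) (u$1) \<times> box (l$2) (u$2))"
    using m by (subst emeasure_distr) (auto simp: )
  also have "\<dots> = emeasure lborel (box (l$1) (u$1)) * emeasure lborel (box (l$2) (u$2))"
    by (rule lborel.emeasure_pair_measure_Times) auto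
  also have "\<dots> = ennreal ((u - l)$1 * (u - l)$2)"
    using le'[of 1] le'[of 2] by (simp add: ennreal_mult box_real)
  also have "(u - l)$1 * (u - l)$2 = (\<Prod>b\<in>Basis. (u - l) \<bullet> b)"
  proof -
    have "(\<Prod>b\<in>Basis. (u - l) \<bullet> b) = (\<Prod>i\<in>UNIV. (u - l) \<bullet> axis i 1)"
      unfolding Basis_vec_def by (simp add: UNION_singleton_eq_range prod.reindex axis_eq_axis inj_on_def)
    then show ?thesis by (simp add: cart_eq_inner_axis[symmetric] UNIV_2)
  qed
  finally show "emeasure (distr (lborel \<Otimes>\<^sub>M lborel) borel ?v) (box l u) = (\<Prod>b\<in>Basis. (u - l) \<bullet> b)" .
qed simp

lemma integral_vec2:
  fixes h :: "real^2 \<Rightarrow> real"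
  assumes "integrable lborel h"
  shows "(LINT p|lborel. h p) = (LINT x|lborel. LINT y|lborel. h (\<chi> i. if i = 1 then x else y))"
proof -
  let ?v = "\<lambda>(x::real, y::real). (\<chi> i. if i = 1 then x else y) :: real^2"
  have "continuous_on UNIV ?v"
    unfolding split_def
  proof (rule continuous_on_vec_lambda)
    show "continuous_on UNIV (\<lambda>x. if i = 1 then fst x else snd x)" for i :: 2
      by (cases "i = 1") (auto intro!: continuous_intros)
  qed
  then have m: "?v \<in> (lborel \<Otimes>\<^sub>M lborel) \<rightarrow>\<^sub>M borel"
    unfolding lborel_prod by (simp add: borel_measurable_continuous_onI)
  have hb: "h \<in> borel_measurable borel" using assms by simp
  have i: "integrable (lborel \<Otimes>\<^sub>M lborel) (\<lambda>z. h (?v z))"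
    using assms unfolding lborel_vec2 by (subst (asm) integrable_distr_eq[OF m hb])
  have "(LINT p|lborel. h p) = (LINT z|(lborel \<Otimes>\<^sub>M lborel). h (?v z))"
    unfolding lborel_vec2 by (rule integral_distr[OF m hb])
  also have "\<dots> = (LINT x|lborel. LINT y|lborel. h (?v (x, y)))"
    using lborel_pair.integral_fst'[OF i] by simp
  finally show ?thesis by simp
qed

text \<open>The first coordinate scales from the vertex \<open>c\<close>, the second moves parallel
  to the side from \<open>a\<close> to \<open>b\<close>. Slices with fixed first coordinate are
  therefore segments in direction \<open>b - a\<close> that run from the side \<open>ca\<close> to
  the side \<open>cb\<close>.\<close>

lemma triangle_parametrization:
  fixes a b c :: "real^2"
  assumes ind: "\<not> affine_dependent {a, b, c}" "a \<noteq> b" "b \<noteq> c" "a \<noteq> c"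
  defines "T \<equiv> (\<lambda>p::real^2. c + (p$1) *\<^sub>R (a - c) + (p$2) *\<^sub>R (b - a))"
    and "S \<equiv> {p::real^2. 0 \<le> p$2 \<and> p$2 \<le> p$1 \<and> p$1 \<le> 1}"
  shows "T ` S = convex hull {a, b, c}" "inj T"
proof -
  show "T ` S = convex hull {a, b, c}"
  proof
    show "T ` S \<subseteq> convex hull {a, b, c}"
    proof
      fix x assume "x \<in> T ` S"
      then obtain p where p: "p \<in> S" "x = T p" by auto
      then have "x = (p$1 - p$2) *\<^sub>R a + (p$2) *\<^sub>R b + (1 - p$1) *\<^sub>R c"
        by (simp add: T_def algebra_simps)
      then show "x \<in> convex hull {a, b, c}"
        unfolding convex_hull_3 using p(1)
        by (intro CollectI exI[of _ "p$1 - p$2"] exI[of _ "p$2"] exI[of _ "1 - p$1"]) (auto simp: S_def)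
    qed
    show "convex hull {a, b, c} \<subseteq> T ` S"
    proof
      fix x assume "x \<in> convex hull {a, b, c}"
      then obtain u v w where u: "0 \<le> u" "0 \<le> v" "0 \<le> w" "u + v + w = 1" "x = u *\<^sub>R a + v *\<^sub>R b + w *\<^sub>R c"
        unfolding convex_hull_3 by auto
      define p :: "real^2" where "p = (\<chi> i. if i = 1 then u + v else v)"
      have w: "w = 1 - (u + v)" using u by simp
      have "x = T p" by (simp add: T_def p_def u(5) w algebra_simps)
      moreover have "p \<in> S" using u by (simp add: S_def p_def)
      ultimately show "x \<in> T ` S" by blast
    qed
  qed
  show "inj T"
  proof (rule injI)
    fix p q assume "T p = T q"
    then have eq: "(p$1 - q$1) *\<^sub>R (a - c) + (p$2 - q$2) *\<^sub>R (b - a) = 0"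
      by (simp add: T_def algebra_simps)
    show "p = q"
    proof (rule ccontr)
      assume ne: "p \<noteq> q"
      let ?s = "p$1 - q$1" and ?t = "p$2 - q$2"
      \<comment> \<open>The coefficients of \<open>a\<close>, \<open>b\<close> and \<open>c\<close>
        in \<open>T p - T q\<close>.\<close>
      define u where "u x = (if x = a then ?s - ?t else if x = b then ?t else - ?s)" for x
      have "sum u {a, b, c} = 0" using ind by (simp add: u_def)
      moreover have "(\<Sum>v\<in>{a, b, c}. u v *\<^sub>R v) = 0"
        using ind eq by (simp add: u_def algebra_simps)
      moreover have "\<exists>v\<in>{a, b, c}. u v \<noteq> 0"
      proof (rule ccontr)
        assume "\<not> ?thesis"
        then have "?t = 0" "?s = 0" using ind by (auto simp: u_def)
        then show False using ne by (simp add: vec_eq_iff forall_2)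
      qed
      ultimately have "affine_dependent {a, b, c}"
        unfolding affine_dependent_explicit by (intro exI[of _ "{a, b, c}"] exI[of _ u]) auto
      then show False using ind by blast
    qed
  qed
qed

text \<open>On each slice parallel to \<open>b - a\<close> the fundamental theorem of calculus
  leaves the values of \<phi> on the two other sides. \<Delta> is the Jacobian of the
  parametrization; since it is the same for all \<phi>, one example will determine it.\<close>

lemma triangle_directional_integral:
  fixes a b c :: "real^2"
  assumes ind: "\<not> affine_dependent {a, b, c}" "a \<noteq> b" "b \<noteq> c" "a \<noteq> c"
  shows "\<exists>\<Delta>. \<forall>\<phi> D. (\<forall>x. GDERIV \<phi> x :> D x) \<longrightarrow> continuous_on UNIV D \<longrightarrow>
    integral (convex hull {a, b, c}) D \<bullet> (b - a)
      = \<Delta> * (LINT s|lebesgue_on {0..1}. \<phi> (linepath c b s) - \<phi> (linepath c a s))"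
proof -
  define T where "T p = c + (p$1) *\<^sub>R (a - c) + (p$2) *\<^sub>R (b - a)" for p :: "real^2"
  define T' where "T' p = (p$1) *\<^sub>R (a - c) + (p$2) *\<^sub>R (b - a)" for p :: "real^2"
  define S where "S = {p::real^2. 0 \<le> p$2 \<and> p$2 \<le> p$1 \<and> p$1 \<le> 1}"
  have TS: "T ` S = convex hull {a, b, c}" and inj: "inj T"
    using triangle_parametrization[OF ind] by (simp_all add: T_def[abs_def] S_def)
  have der: "(T has_derivative T') (at x within X)" for x X
    unfolding T_def[abs_def] T'_def[abs_def] by (auto intro!: derivative_eq_intros bounded_linear.has_derivative[OF bounded_linear_vec_nth])
  have "closed S" unfolding S_def by (intro closed_Collect_conj closed_Collect_le continuous_intros)
  moreover have "bounded S"
    by (rule bounded_subset[OF bounded_cbox[of 0 One]]) (auto simp: S_def mem_box_cart forall_2)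
  ultimately have cS: "compact S" by (simp add: compact_eq_bounded_closed)
  define \<Delta> where "\<Delta> = \<bar>det (matrix T')\<bar>"
  have Tc: "continuous_on X T" for X unfolding T_def by (intro continuous_intros)
  show ?thesis
  proof (intro exI[of _ \<Delta>] allI impI)
    fix \<phi> :: "real^2 \<Rightarrow> real" and D assume "\<forall>x. GDERIV \<phi> x :> D x" and D: "continuous_on UNIV D"
    then have \<phi>: "\<And>x. GDERIV \<phi> x :> D x" by simp
    have DT: "continuous_on X (\<lambda>p. D (T p))" for X by (rule continuous_on_compose2[OF D Tc]) auto
    have ai: "(\<lambda>p. D (T p)) absolutely_integrable_on S"
      using borel_integrable_compact[OF cS DT] unfolding set_integrable_def
      by (subst integrable_completion) auto
    have "integral (T ` S) D = integral S (\<lambda>p. \<Delta> *\<^sub>R D (T p))"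
    proof -
      have "(\<lambda>p. \<bar>det (matrix T')\<bar> *\<^sub>R D (T p)) absolutely_integrable_on S"
        using ai by (rule absolutely_integrable_scaleR_left)
      then show ?thesis
        using has_absolute_integral_change_of_variables[of S T "\<lambda>_. T'" D "integral S (\<lambda>p. \<bar>det (matrix T')\<bar> *\<^sub>R D (T p))"]
          der inj cS by (auto simp: \<Delta>_def inj_on_subset compact_imp_closed)
    qed
    then have 1: "integral (convex hull {a, b, c}) D = \<Delta> *\<^sub>R integral S (\<lambda>p. D (T p))"
      unfolding TS by simp
    have "integral S (\<lambda>p. D (T p)) \<bullet> (b - a) = integral S (\<lambda>p. D (T p) \<bullet> (b - a))"
      using integral_linear[OF set_lebesgue_integral_eq_integral(1)[OF ai] bounded_linear_inner_left[of "b - a"]]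
      by (simp add: o_def)
    note 2 = this
    have ai2: "set_integrable lborel S (\<lambda>p. D (T p) \<bullet> (b - a))"
      unfolding set_integrable_def by (rule borel_integrable_compact[OF cS]) (auto intro!: continuous_intros DT)
    then have "integral S (\<lambda>p. D (T p) \<bullet> (b - a)) = (LINT p|lborel. indicat_real S p * (D (T p) \<bullet> (b - a)))"
      using set_borel_integral_eq_integral(2)[OF ai2] by (simp add: set_lebesgue_integral_def)
    also have "\<dots> = (LINT x|lborel. LINT y|lborel. indicat_real S (\<chi> i. if i = 1 then x else y) *
        (D (T (\<chi> i. if i = 1 then x else y)) \<bullet> (b - a)))"
      by (rule integral_vec2) (use ai2 in \<open>simp add: set_integrable_def\<close>)
    also have "\<dots> = (LINT x|lborel. indicat_real {0..1} x * (\<phi> (linepath c b x) - \<phi> (linepath c a x)))"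
    proof (rule Bochner_Integration.integral_cong[OF refl])
      fix x :: real
      define z where "z y = c + x *\<^sub>R (a - c) + y *\<^sub>R (b - a)" for y
      have "(LINT y|lborel. indicat_real S (\<chi> i. if i = 1 then x else y) * (D (T (\<chi> i. if i = 1 then x else y)) \<bullet> (b - a)))
          = (LINT y|lborel. indicat_real {0..1} x * (indicat_real {0..x} y *\<^sub>R (D (z y) \<bullet> (b - a))))"
        by (rule Bochner_Integration.integral_cong[OF refl]) (auto simp: indicator_def S_def T_def z_def)
      also have "\<dots> = indicat_real {0..1} x * (LINT y|lborel. indicat_real {0..x} y *\<^sub>R (D (z y) \<bullet> (b - a)))"
        by simp
      also have "\<dots> = indicat_real {0..1} x * (\<phi> (linepath c b x) - \<phi> (linepath c a x))"
      proof (cases "x \<in> {0..1}")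
        case True
        have "(LINT y|lborel. (D (z y) \<bullet> (b - a)) * indicat_real {0..x} y) = \<phi> (z x) - \<phi> (z 0)"
        proof (rule integral_FTC_Icc_real)
          show "0 \<le> x" using True by simp
          fix y
          have zd: "(z has_derivative (\<lambda>h. h *\<^sub>R (b - a))) (at y)"
            unfolding z_def[abs_def] by (auto intro!: derivative_eq_intros)
          have "(\<phi> has_derivative (\<lambda>h. h \<bullet> D (z y))) (at (z y))" using \<phi> by (simp add: gderiv_def)
          from has_derivative_compose[OF zd this]
          show "((\<lambda>y. \<phi> (z y)) has_real_derivative D (z y) \<bullet> (b - a)) (at y)"
            by (simp add: has_field_derivative_def inner_commute mult.commute[of _ "D (z y) \<bullet> (b - a)"])
          have "continuous_on UNIV z" unfolding z_def by (intro continuous_intros)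
          then have "continuous_on UNIV (\<lambda>y. D (z y) \<bullet> (b - a))"
            by (intro continuous_intros continuous_on_compose2[OF D]) auto
          then show "isCont (\<lambda>y. D (z y) \<bullet> (b - a)) y" by (simp add: continuous_on_eq_continuous_at)
        qed
        moreover have "z x = linepath c b x" "z 0 = linepath c a x"
          by (simp_all add: z_def linepath_def algebra_simps)
        ultimately show ?thesis by (simp add: mult.commute)
      qed simp
      finally show "(LINT y|lborel. indicat_real S (\<chi> i. if i = 1 then x else y) * (D (T (\<chi> i. if i = 1 then x else y)) \<bullet> (b - a)))
          = indicat_real {0..1} x * (\<phi> (linepath c b x) - \<phi> (linepath c a x))" .
    qed
    also have "\<dots> = (LINT s|lebesgue_on {0..1}. \<phi> (linepath c b s) - \<phi> (linepath c a s))"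
    proof -
      have \<phi>c: "continuous_on UNIV \<phi>"
        using \<phi> unfolding gderiv_def by (meson continuous_at_imp_continuous_on has_derivative_continuous)
      have "(\<lambda>x. indicat_real {0..1} x * (\<phi> (linepath c b x) - \<phi> (linepath c a x))) \<in> borel_measurable lborel"
        by (intro borel_measurable_times borel_measurable_indicator)
           (auto intro!: borel_measurable_continuous_onI continuous_intros continuous_on_compose2[OF \<phi>c])
      then show ?thesis
        by (subst integral_completion[symmetric]) (auto simp: integral_restrict_space)
    qed
    finally show "integral (convex hull {a, b, c}) D \<bullet> (b - a)
      = \<Delta> * (LINT s|lebesgue_on {0..1}. \<phi> (linepath c b s) - \<phi> (linepath c a s))"
      unfolding 1 using 2 by simp
  qed
qed

text \<open>Two sides of the triangle form a basis of the plane.\<close>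

lemma linear_iff_triangle_sides:
  fixes a b c :: "real^2"
  assumes ind: "\<not> affine_dependent {a, b, c}" "a \<noteq> b" "b \<noteq> c" "a \<noteq> c"
  shows "\<exists>w. w \<bullet> (a - c) = \<alpha> \<and> w \<bullet> (b - a) = \<beta>"
    "w \<bullet> (a - c) = w' \<bullet> (a - c) \<Longrightarrow> w \<bullet> (b - a) = w' \<bullet> (b - a) \<Longrightarrow> w = w'"
proof -
  let ?A = "\<lambda>p::real^2. (p$1) *\<^sub>R (a - c) + (p$2) *\<^sub>R (b - a)"
  let ?B = "\<lambda>w::real^2. (\<chi> i. if i = 1 then w \<bullet> (a - c) else w \<bullet> (b - a)) :: real^2"
  have linA: "linear ?A" by (rule linearI) (auto simp: algebra_simps)
  have "inj ?A"
  proof (rule injI)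
    fix p q assume "?A p = ?A q"
    then have "c + (p$1) *\<^sub>R (a - c) + (p$2) *\<^sub>R (b - a) = c + (q$1) *\<^sub>R (a - c) + (q$2) *\<^sub>R (b - a)"
      by (simp add: add.assoc)
    then show "p = q" using injD[OF triangle_parametrization(2)[OF ind]] by blast
  qed
  then have surjA: "surj ?A" using linA linear_injective_imp_surjective by blast
  have uniq: "w = w'" if w: "w \<bullet> (a - c) = w' \<bullet> (a - c)" "w \<bullet> (b - a) = w' \<bullet> (b - a)" for w w'
  proof -
    obtain p where p: "w - w' = ?A p" using surjD[OF surjA, of "w - w'"] by blast
    have "(w - w') \<bullet> (a - c) = 0" "(w - w') \<bullet> (b - a) = 0" using w by (simp_all only: inner_diff_left)
    then have "(w - w') \<bullet> ?A p = 0" by (simp only: inner_add_right inner_scaleR_right mult_zero_right add_0_left)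
    then show "w = w'" unfolding p[symmetric] by simp
  qed
  show "w = w'" if "w \<bullet> (a - c) = w' \<bullet> (a - c)" "w \<bullet> (b - a) = w' \<bullet> (b - a)" by (rule uniq[OF that])
  have "linear ?B" by (rule linearI) (auto simp: vec_eq_iff inner_add_left)
  moreover have "inj ?B"
  proof (rule injI)
    fix w w' assume eq: "?B w = ?B w'"
    show "w = w'"
      using arg_cong[OF eq, of "\<lambda>v. v $ 1"] arg_cong[OF eq, of "\<lambda>v. v $ 2"] by (intro uniq) simp_all
  qed
  ultimately have "surj ?B" using linear_injective_imp_surjective by blast
  then obtain w where w: "(\<chi> i. if i = 1 then \<alpha> else \<beta>) = ?B w"
    using surjD[OF \<open>surj ?B\<close>, of "\<chi> i. if i = 1 then \<alpha> else \<beta>"] by blast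
  have "w \<bullet> (a - c) = \<alpha>" "w \<bullet> (b - a) = \<beta>"
    using arg_cong[OF w, of "\<lambda>v. v $ 1"] arg_cong[OF w, of "\<lambda>v. v $ 2"] by simp_all
  then show "\<exists>w. w \<bullet> (a - c) = \<alpha> \<and> w \<bullet> (b - a) = \<beta>" by blast
qed

lemma affine_path_integral: "(LINT s|lebesgue_on {0..1}. d + w \<bullet> linepath x y s) = ((d + w \<bullet> x) + (d + w \<bullet> y)) / 2"
proof -
  have 1: "(LINT s|lborel. (d + w \<bullet> x + s * (w \<bullet> (y - x))) * indicat_real {0..1} s)
     = (1 * (d + w \<bullet> x) + 1\<^sup>2 / 2 * (w \<bullet> (y - x))) - (0 * (d + w \<bullet> x) + 0\<^sup>2 / 2 * (w \<bullet> (y - x)))"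
    by (rule integral_FTC_Icc_real) (auto intro!: derivative_eq_intros continuous_intros simp: field_simps)
  have "(LINT s|lebesgue_on {0..1}. d + w \<bullet> linepath x y s) = (LINT s|lebesgue. (d + w \<bullet> x + s * (w \<bullet> (y - x))) * indicat_real {0..1} s)"
    by (simp add: integral_restrict_space linepath_def inner_add_right inner_diff_right algebra_simps)
  also have "\<dots> = (LINT s|lborel. (d + w \<bullet> x + s * (w \<bullet> (y - x))) * indicat_real {0..1} s)"
    by (rule integral_completion) (intro borel_measurable_times borel_measurable_indicator, auto intro!: borel_measurable_continuous_onI continuous_intros)
  finally show ?thesis unfolding 1 by (simp add: inner_diff_right field_simps)
qed

text \<open>The constant \<Delta> is found by inserting the linear function with gradient
  \<open>b - a\<close>.\<close>

lemma triangle_directional_integral':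
  fixes a b c :: "real^2" and \<phi> :: "real^2 \<Rightarrow> real"
  assumes ind: "\<not> affine_dependent {a, b, c}" "a \<noteq> b" "b \<noteq> c" "a \<noteq> c"
    and \<phi>: "\<And>x. GDERIV \<phi> x :> D x" "continuous_on UNIV D"
  shows "integral (convex hull {a, b, c}) D \<bullet> (b - a)
      = 2 * measure lebesgue (convex hull {a, b, c}) * (LINT s|lebesgue_on {0..1}. \<phi> (linepath c b s) - \<phi> (linepath c a s))"
proof -
  obtain \<Delta> where "\<forall>\<phi> D. (\<forall>x. GDERIV \<phi> x :> D x) \<longrightarrow> continuous_on UNIV D \<longrightarrow>
    integral (convex hull {a, b, c}) D \<bullet> (b - a)
      = \<Delta> * (LINT s|lebesgue_on {0..1}. \<phi> (linepath c b s) - \<phi> (linepath c a s))"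
    using triangle_directional_integral[OF ind] ..
  note \<Delta> = this[rule_format]
  have m: "convex hull {a, b, c} \<in> lmeasurable"
    by (intro lmeasurable_compact finite_imp_compact_convex_hull) auto
  have "integral (convex hull {a, b, c}) (\<lambda>_. b - a) \<bullet> (b - a)
      = \<Delta> * (LINT s|lebesgue_on {0..1}. (b - a) \<bullet> linepath c b s - (b - a) \<bullet> linepath c a s)"
    by (rule \<Delta>) (auto simp: gderiv_def inner_commute intro!: derivative_eq_intros)
  also have "(\<lambda>s. (b - a) \<bullet> linepath c b s - (b - a) \<bullet> linepath c a s) = (\<lambda>s. 0 + (b - a) \<bullet> linepath 0 (b - a) s)"
    by (simp add: fun_eq_iff linepath_def algebra_simps)
  finally have "integral (convex hull {a, b, c}) (\<lambda>_. b - a) \<bullet> (b - a) = \<Delta> * (((b - a) \<bullet> (b - a)) / 2)"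
    unfolding affine_path_integral by simp
  moreover have "integral (convex hull {a, b, c}) (\<lambda>_. b - a) = measure lebesgue (convex hull {a, b, c}) *\<^sub>R (b - a)"
    using integral_linear[OF _ bounded_linear_scaleR_left[of "b - a"], of "\<lambda>_. 1" "convex hull {a, b, c}"]
      lmeasure_integral[OF m] m
    by (simp add: lmeasurable_iff_integrable_on o_def)
  ultimately have "\<Delta> = 2 * measure lebesgue (convex hull {a, b, c})"
    using ind(2) by simp
  then show ?thesis using \<Delta>[OF \<phi>] by simp
qed

section \<open>Edge means and the interpolant\<close>

definition edge_mean :: "(real^2 \<Rightarrow> real) \<Rightarrow> real^2 \<Rightarrow> real^2 \<Rightarrow> real" where
  "edge_mean t x y = (LINT s|lebesgue_on {0..1}. t (linepath x y s))"

lemma edge_mean_commute: "edge_mean t x y = edge_mean t y x"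
proof -
  have "edge_mean t x y = (LINT s|lebesgue. indicat_real {0..1} s * t (linepath x y s))"
    by (simp add: edge_mean_def integral_restrict_space)
  also have "\<dots> = (LINT s|lebesgue. indicat_real {0..1} (1 + (-1) * s) * t (linepath x y (1 + (-1) * s)))"
    by (subst lebesgue_integral_real_affine[where c = "-1" and t = 1]) auto
  also have "\<dots> = (LINT s|lebesgue. indicat_real {0..1} s * t (linepath y x s))"
    by (rule Bochner_Integration.integral_cong) (auto simp: indicator_def linepath_def algebra_simps)
  also have "\<dots> = edge_mean t y x"
    by (simp add: edge_mean_def integral_restrict_space)
  finally show ?thesis .
qed

text \<open>Faces of a simplex are the hulls of subsets of its vertices, and dimension one means two
  vertices.\<close>

lemma triangle_edges:
  fixes a b c :: "real^2"
  assumes ind: "\<not> affine_dependent {a, b, c}" "a \<noteq> b" "b \<noteq> c" "a \<noteq> c"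
  shows "closed_segment x y edge_of convex hull {a, b, c} \<longleftrightarrow> x \<noteq> y \<and> {x, y} \<subseteq> {a, b, c}"
proof
  assume "x \<noteq> y \<and> {x, y} \<subseteq> {a, b, c}"
  then show "closed_segment x y edge_of convex hull {a, b, c}"
    unfolding edge_of_def face_of_convex_hull_affine_independent[OF ind(1)]
    by (metis segment_convex_hull aff_dim_convex_hull aff_dim_2)
next
  assume e: "closed_segment x y edge_of convex hull {a, b, c}"
  then obtain S where S: "S \<subseteq> {a, b, c}" "closed_segment x y = convex hull S"
    unfolding edge_of_def face_of_convex_hull_affine_independent[OF ind(1)] by blast
  have fin: "finite S" using S(1) finite_subset by blast
  have d: "aff_dim (closed_segment x y) = 1" using e by (simp add: edge_of_def)
  then have xy: "x \<noteq> y" by auto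
  have "\<not> affine_dependent S" using affine_dependent_subset[OF _ S(1)] ind(1) by blast
  then have "aff_dim S = int (card S) - 1" by (simp add: affine_independent_iff_card)
  then have "card S = 2" using d S(2) by (simp add: aff_dim_convex_hull)
  then obtain p q where pq: "S = {p, q}" "p \<noteq> q" by (auto simp: card_2_iff)
  then have "closed_segment x y = closed_segment p q" using S(2) by (simp add: segment_convex_hull)
  then have "{x, y} = {p, q}" by simp
  then show "x \<noteq> y \<and> {x, y} \<subseteq> {a, b, c}" using xy pq S(1) by blast
qed

text \<open>An affine function is determined by its values at the midpoints of the edges, which are
  its means over the edges.\<close>
lemma CR_interpolant_eq:
  fixes a b c :: "real^2"
  assumes ind: "\<not> affine_dependent {a, b, c}" "a \<noteq> b" "b \<noteq> c" "a \<noteq> c"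
    and K: "K = convex hull {a, b, c}" and t: "t = boundary_trace K v"
    and int: "\<And>x y. closed_segment x y edge_of K \<Longrightarrow> segment_integrable x y t"
  obtains d w where "CR_interpolant K v = (\<lambda>x. d + w \<bullet> x)"
    "w \<bullet> (b - a) = 2 * (edge_mean t c b - edge_mean t c a)"
    "w \<bullet> (a - c) = 2 * (edge_mean t b a - edge_mean t b c)"
proof -
  let ?m = "edge_mean t"
  have cond: "segment_integral x y (\<lambda>z. t z - (d + w \<bullet> z)) = 0 \<longleftrightarrow> ((d + w \<bullet> x) + (d + w \<bullet> y)) / 2 = ?m x y"
    if e: "closed_segment x y edge_of K" for x y d w
  proof -
    have xy: "x \<noteq> y" using e triangle_edges[OF ind] by (simp add: K)
    have i: "integrable (lebesgue_on {0..1}) (\<lambda>s. d + w \<bullet> linepath x y s)"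
      by (intro continuous_imp_integrable_real continuous_intros)
    show ?thesis
      using xy int[OF e] i unfolding segment_integral_def segment_integrable_def
      by (subst Bochner_Integration.integral_diff) (auto simp: affine_path_integral edge_mean_def)
  qed
  have edges: "closed_segment x y edge_of K \<longleftrightarrow> x \<noteq> y \<and> {x, y} \<subseteq> {a, b, c}" for x y
    unfolding K by (rule triangle_edges[OF ind])
  have all: "(\<forall>x y. closed_segment x y edge_of K \<longrightarrow> segment_integral x y (\<lambda>z. t z - (d + w \<bullet> z)) = 0) \<longleftrightarrow>
      ((d + w \<bullet> a) + (d + w \<bullet> b)) / 2 = ?m a b \<and> ((d + w \<bullet> b) + (d + w \<bullet> c)) / 2 = ?m b c \<and> ((d + w \<bullet> c) + (d + w \<bullet> a)) / 2 = ?m c a"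
    (is "?A = ?B") for d w
  proof
    assume A: ?A
    have e: "closed_segment a b edge_of K" "closed_segment b c edge_of K" "closed_segment c a edge_of K"
      using edges ind by auto
    show ?B using A e cond[OF e(1), of d w] cond[OF e(2), of d w] cond[OF e(3), of d w] by simp
  next
    assume B: ?B
    show ?A
    proof (intro allI impI)
      fix x y assume e: "closed_segment x y edge_of K"
      then have "x \<noteq> y \<and> {x, y} \<subseteq> {a, b, c}" using edges by blast
      then show "segment_integral x y (\<lambda>z. t z - (d + w \<bullet> z)) = 0"
        unfolding cond[OF e] using B edge_mean_commute[of t] by (auto simp: add.commute)
    qed
  qed
  obtain w where w: "w \<bullet> (a - c) = 2 * (?m a b - ?m b c)" "w \<bullet> (b - a) = 2 * (?m b c - ?m c a)"
    using linear_iff_triangle_sides(1)[OF ind] by blast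
  \<comment> \<open>The value at \<open>a\<close> is the sum of the means over the two edges at
    \<open>a\<close> minus the mean over the opposite edge.\<close>
  define d where "d = ?m a b + ?m c a - ?m b c - w \<bullet> a"
  have dw: "((d + w \<bullet> a) + (d + w \<bullet> b)) / 2 = ?m a b \<and> ((d + w \<bullet> b) + (d + w \<bullet> c)) / 2 = ?m b c \<and> ((d + w \<bullet> c) + (d + w \<bullet> a)) / 2 = ?m c a"
    using w by (auto simp: d_def inner_diff_right field_simps)
  have "CR_interpolant K v = (\<lambda>x. d + w \<bullet> x)"
    unfolding CR_interpolant_def t[symmetric]
  proof (rule the_equality)
    show "(\<exists>c w'. (\<lambda>x. d + w \<bullet> x) = (\<lambda>x. c + w' \<bullet> x)) \<and>
      (\<forall>x y. closed_segment x y edge_of K \<longrightarrow> segment_integral x y (\<lambda>z. t z - (d + w \<bullet> z)) = 0)"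
      using all dw by blast
  next
    fix p assume p: "(\<exists>c w'. p = (\<lambda>x. c + w' \<bullet> x)) \<and>
      (\<forall>x y. closed_segment x y edge_of K \<longrightarrow> segment_integral x y (\<lambda>z. t z - p z) = 0)"
    then obtain d' w' where p': "p = (\<lambda>x. d' + w' \<bullet> x)" by blast
    have "((d' + w' \<bullet> a) + (d' + w' \<bullet> b)) / 2 = ?m a b \<and> ((d' + w' \<bullet> b) + (d' + w' \<bullet> c)) / 2 = ?m b c \<and> ((d' + w' \<bullet> c) + (d' + w' \<bullet> a)) / 2 = ?m c a"
      using p unfolding p' all by blast
    then have *: "w' \<bullet> (a - c) = w \<bullet> (a - c)" "w' \<bullet> (b - a) = w \<bullet> (b - a)" "d' + w' \<bullet> a = d + w \<bullet> a"
      using dw by (auto simp: inner_diff_right)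
    then have "w' = w" using linear_iff_triangle_sides(2)[OF ind] by blast
    then show "p = (\<lambda>x. d + w \<bullet> x)" using * p' by simp
  qed
  then show thesis
    using that[of d w] w edge_mean_commute[of t] by auto
qed

section \<open>Integrals of weak gradients and the Crouzeix--Raviart interpolant\<close>

lemma AE_lebesgue_onI:
  assumes "negligible N" "S \<in> sets lebesgue" "\<And>x. x \<in> S - N \<Longrightarrow> P x"
  shows "AE x in lebesgue_on S. P x"
proof -
  have "AE x in lebesgue. x \<in> S \<longrightarrow> P x"
    by (rule AE_I'[of N]) (use assms in \<open>auto simp: negligible_iff_null_sets\<close>)
  then show ?thesis using assms(2) by (simp add: AE_restrict_space_iff)
qed

lemma AE_lebesgue_onE:
  assumes "AE x in lebesgue_on S. P x" "S \<in> sets lebesgue"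
  obtains N where "negligible N" "\<And>x. x \<in> S - N \<Longrightarrow> P x"
proof -
  have "AE x in lebesgue. x \<in> S \<longrightarrow> P x" using assms by (simp add: AE_restrict_space_iff)
  then obtain N where "negligible N" "{x. \<not> (x \<in> S \<longrightarrow> P x)} \<subseteq> N"
    unfolding eventually_ae_filter_negligible by blast
  then show thesis using that[of N] by auto
qed

lemma integrable_lebesgue_on_bounded:
  fixes h :: "'a::euclidean_space \<Rightarrow> 'b::euclidean_space"
  assumes "S \<in> lmeasurable" "h \<in> borel_measurable (lebesgue_on S)" "AE x in lebesgue_on S. norm (h x) \<le> B"
  shows "integrable (lebesgue_on S) h"
proof -
  interpret finite_measure "lebesgue_on S"
    by (rule finite_measureI) (use assms(1) in \<open>auto simp: emeasure_restrict_space fmeasurable_def\<close>)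
  show ?thesis using assms(2,3) by (rule integrable_const_bound[rotated])
qed

lemma measurable_lebesgue_on_lebesgue:
  "h \<in> borel_measurable lebesgue \<Longrightarrow> h \<in> borel_measurable (lebesgue_on S)"
  by (rule measurable_restrict_space1)

lemma C1_obtain:
  assumes "C1 \<phi>"
  obtains "\<And>x. GDERIV \<phi> x :> grad \<phi> x" "continuous_on UNIV (grad \<phi>)"
proof -
  obtain D where D: "\<And>x. GDERIV \<phi> x :> D x" "continuous_on UNIV D" using assms by (auto simp: C1_def)
  then have "grad \<phi> = D" using grad_eq by blast
  then show thesis using that D by simp
qed

lemma C1_continuous: "C1 \<phi> \<Longrightarrow> continuous_on S \<phi>"
proof (rule continuous_at_imp_continuous_on, rule ballI)
  fix x assume "C1 \<phi>"
  then obtain D where "(\<phi> has_derivative (\<lambda>h. h \<bullet> D x)) (at x)" unfolding C1_def gderiv_def by blast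
  then show "isCont \<phi> x" by (rule has_derivative_continuous)
qed

lemma test_function_vanishes:
  assumes "test_function U \<phi>" "x \<notin> U"
  shows "\<phi> x = 0" "grad \<phi> x = 0"
proof -
  let ?S = "closure {x. \<phi> x \<noteq> 0}"
  have x: "x \<in> - ?S" using assms by (auto simp: test_function_def)
  then show "\<phi> x = 0" using closure_subset[of "{x. \<phi> x \<noteq> 0}"] by blast
  have "GDERIV \<phi> x :> 0"
    unfolding gderiv_def
  proof (rule has_derivative_transform_within_open[where s = "- ?S" and f = "\<lambda>_. 0"])
    show "((\<lambda>_. 0) has_derivative (\<lambda>h. h \<bullet> 0)) (at x)" by simp
    show "open (- ?S)" by (intro open_Compl closed_closure)
    show "x \<in> - ?S" by (rule x)
    show "0 = \<phi> y" if "y \<in> - ?S" for y using that closure_subset[of "{x. \<phi> x \<noteq> 0}"] by auto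
  qed
  then show "grad \<phi> x = 0" by (rule grad_eq)
qed

lemma test_function_mono: "test_function U \<phi> \<Longrightarrow> U \<subseteq> V \<Longrightarrow> test_function V \<phi>"
  by (auto simp: test_function_def)

lemma integral_lebesgue_on_superset:
  fixes F :: "'a::euclidean_space \<Rightarrow> 'b::euclidean_space"
  assumes "U \<subseteq> V" "U \<in> sets lebesgue" "V \<in> sets lebesgue" "\<And>x. x \<in> V - U \<Longrightarrow> F x = 0"
  shows "(LINT x|lebesgue_on V. F x) = (LINT x|lebesgue_on U. F x)"
proof -
  have "(\<lambda>x. indicat_real V x *\<^sub>R F x) = (\<lambda>x. indicat_real U x *\<^sub>R F x)"
    using assms(1,4) by (auto simp: fun_eq_iff indicator_def)
  then show ?thesis using assms(2,3) by (simp add: integral_restrict_space)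
qed

lemma weak_gradient_mono:
  assumes "weak_gradient V u G" "U \<subseteq> V" "U \<in> sets lebesgue" "V \<in> sets lebesgue"
  shows "weak_gradient U u G"
  unfolding weak_gradient_def
proof (intro allI impI)
  fix \<phi> assume \<phi>: "test_function U \<phi>"
  have "(LINT x|lebesgue_on V. u x *\<^sub>R grad \<phi> x) = (LINT x|lebesgue_on U. u x *\<^sub>R grad \<phi> x)"
    "(LINT x|lebesgue_on V. \<phi> x *\<^sub>R G x) = (LINT x|lebesgue_on U. \<phi> x *\<^sub>R G x)"
    using test_function_vanishes[OF \<phi>] assms(2-4) by (auto intro!: integral_lebesgue_on_superset)
  then show "(LINT x|lebesgue_on U. u x *\<^sub>R grad \<phi> x) = - (LINT x|lebesgue_on U. \<phi> x *\<^sub>R G x)"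
    using assms(1) test_function_mono[OF \<phi> assms(2)] unfolding weak_gradient_def by simp
qed

lemma integral_lebesgue_on_cong:
  fixes h h' :: "'a::euclidean_space \<Rightarrow> 'b::euclidean_space"
  assumes "h \<in> borel_measurable (lebesgue_on S)" "h' \<in> borel_measurable (lebesgue_on S)" "S \<in> sets lebesgue"
    and "negligible N" "\<And>x. x \<in> S - N \<Longrightarrow> h x = h' x"
  shows "(LINT x|lebesgue_on S. h x) = (LINT x|lebesgue_on S. h' x)"
  by (rule integral_cong_AE[OF assms(1,2)]) (rule AE_lebesgue_onI[OF assms(4,3,5)])

lemma weak_gradient_cong_AE:
  assumes "weak_gradient U u G" "U \<in> sets lebesgue" "negligible N" "\<And>x. x \<in> U - N \<Longrightarrow> u x = v x" "\<And>x. x \<in> U - N \<Longrightarrow> G x = H x"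
    and m: "u \<in> borel_measurable (lebesgue_on U)" "v \<in> borel_measurable (lebesgue_on U)"
      "G \<in> borel_measurable (lebesgue_on U)" "H \<in> borel_measurable (lebesgue_on U)"
  shows "weak_gradient U v H"
  unfolding weak_gradient_def
proof (intro allI impI)
  fix \<phi> assume \<phi>: "test_function U \<phi>"
  then have C1: "C1 \<phi>" by (simp add: test_function_def)
  have mg: "grad \<phi> \<in> borel_measurable (lebesgue_on U)" "\<phi> \<in> borel_measurable (lebesgue_on U)"
    using C1_obtain[OF C1] C1_continuous[OF C1]
    by (auto intro!: measurable_lebesgue_on_lebesgue continuous_imp_measurable_lebesgue)
  have "(LINT x|lebesgue_on U. v x *\<^sub>R grad \<phi> x) = (LINT x|lebesgue_on U. u x *\<^sub>R grad \<phi> x)"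
    by (rule integral_lebesgue_on_cong[OF _ _ assms(2,3)]) (use m mg assms(4) in \<open>auto intro!: borel_measurable_scaleR\<close>)
  moreover have "(LINT x|lebesgue_on U. \<phi> x *\<^sub>R H x) = (LINT x|lebesgue_on U. \<phi> x *\<^sub>R G x)"
    by (rule integral_lebesgue_on_cong[OF _ _ assms(2,3)]) (use m mg assms(5) in \<open>auto intro!: borel_measurable_scaleR\<close>)
  ultimately show "(LINT x|lebesgue_on U. v x *\<^sub>R grad \<phi> x) = - (LINT x|lebesgue_on U. \<phi> x *\<^sub>R H x)"
    using assms(1) \<phi> by (simp add: weak_gradient_def)
qed

lemma cutoff_integral_tendsto:
  fixes F :: "real^2 \<Rightarrow> 'b::euclidean_space"
  assumes \<phi>: "\<And>n::nat. test_function U (\<phi> n)" and b: "\<And>n x. 0 \<le> \<phi> n x" "\<And>n x. \<phi> n x \<le> 1"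
    and lim: "\<And>x. x \<in> U \<Longrightarrow> (\<lambda>n. \<phi> n x) \<longlonglongrightarrow> 1"
    and F: "integrable (lebesgue_on U) F"
  shows "(\<lambda>n. LINT x|lebesgue_on U. \<phi> n x *\<^sub>R F x) \<longlonglongrightarrow> (LINT x|lebesgue_on U. F x)"
proof (rule integral_dominated_convergence)
  show "integrable (lebesgue_on U) (\<lambda>x. norm (F x))" using F by simp
  show "F \<in> borel_measurable (lebesgue_on U)" using F by simp
  have "\<phi> n \<in> borel_measurable (lebesgue_on U)" for n
    using \<phi>[of n] C1_continuous by (auto simp: test_function_def intro!: measurable_lebesgue_on_lebesgue continuous_imp_measurable_lebesgue)
  then show "(\<lambda>x. \<phi> n x *\<^sub>R F x) \<in> borel_measurable (lebesgue_on U)" for n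
    using F by (intro borel_measurable_scaleR) auto
  show "AE x in lebesgue_on U. (\<lambda>n. \<phi> n x *\<^sub>R F x) \<longlonglongrightarrow> F x"
  proof (rule AE_I2)
    fix x assume "x \<in> space (lebesgue_on U)"
    then have "(\<lambda>n. \<phi> n x) \<longlonglongrightarrow> 1" using lim by (simp add: space_restrict_space)
    then show "(\<lambda>n. \<phi> n x *\<^sub>R F x) \<longlonglongrightarrow> F x" using tendsto_scaleR[OF _ tendsto_const] by fastforce
  qed
  show "AE x in lebesgue_on U. norm (\<phi> n x *\<^sub>R F x) \<le> norm (F x)" for n
    using b by (auto intro!: AE_I2 mult_left_le_one_le)
qed

text \<open>Testing with cutoffs that tend to 1 compares the two integrals directly, without passing
  through uniqueness almost everywhere.\<close>

lemma weak_gradient_integral_unique: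
  assumes U: "open U" "bounded U" and G: "integrable (lebesgue_on U) G" "integrable (lebesgue_on U) H"
    and w: "weak_gradient U u G" "weak_gradient U u H"
  shows "(LINT x|lebesgue_on U. G x) = (LINT x|lebesgue_on U. H x)"
proof -
  obtain \<phi> where \<phi>: "\<And>n::nat. test_function U (\<phi> n)" "\<And>n x. 0 \<le> \<phi> n x" "\<And>n x. \<phi> n x \<le> 1"
    "\<And>x. x \<in> U \<Longrightarrow> (\<lambda>n. \<phi> n x) \<longlonglongrightarrow> 1"
    by (rule cutoff_sequence[OF U]) (rule that)
  have "(LINT x|lebesgue_on U. \<phi> n x *\<^sub>R G x) = (LINT x|lebesgue_on U. \<phi> n x *\<^sub>R H x)" for n
  proof -
    have "- (LINT x|lebesgue_on U. \<phi> n x *\<^sub>R G x) = - (LINT x|lebesgue_on U. \<phi> n x *\<^sub>R H x)"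
      using w[unfolded weak_gradient_def, rule_format, OF \<phi>(1)[of n]] by simp
    then show ?thesis by simp
  qed
  then show ?thesis using cutoff_integral_tendsto[OF \<phi> G(1)] cutoff_integral_tendsto[OF \<phi> G(2)] LIMSEQ_unique by fastforce
qed

lemma triangle_vertices:
  assumes "2 simplex (K :: (real^2) set)"
  obtains a b c where "\<not> affine_dependent {a, b, c}" "a \<noteq> b" "b \<noteq> c" "a \<noteq> c" "K = convex hull {a, b, c}"
proof -
  obtain C where C: "\<not> affine_dependent C" "int (card C) = 2 + 1" "K = convex hull C"
    using assms by (auto simp: simplex_def)
  then have "card C = 3" by simp
  then obtain a b c where "C = {a, b, c}" "a \<noteq> b" "b \<noteq> c" "a \<noteq> c" by (auto simp: card_3_iff)
  then show thesis using that C by blast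
qed

lemma measure_triangle:
  assumes "2 simplex (K :: (real^2) set)"
  shows "K \<in> lmeasurable" "interior K \<in> lmeasurable" "measure lebesgue (interior K) = measure lebesgue K" "measure lebesgue K > 0"
proof -
  note T = triangleD[OF assms]
  show K: "K \<in> lmeasurable" using T by (intro lmeasurable_compact)
  show iK: "interior K \<in> lmeasurable" using T by (simp add: bounded_subset[OF _ interior_subset] lmeasurable_open)
  have "sym_diff K (interior K) = K - interior K" using interior_subset by blast
  then show eq: "measure lebesgue (interior K) = measure lebesgue K"
    using T(7) by (intro measure_negligible_symdiff) (use K in \<open>auto simp: Un_commute\<close>)
  have "\<not> negligible (interior K)" using T(4) open_not_negligible by blast
  then show "measure lebesgue K > 0"
    using iK eq by (metis negligible_iff_measure measure_nonneg order_less_le)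
qed

lemma elementary_area_affine:
  assumes "S \<in> lmeasurable"
  shows "elementary_area S (\<lambda>x. d + w \<bullet> x) = measure lebesgue S * sqrt (1 + (norm w)\<^sup>2)"
proof -
  have "GDERIV (\<lambda>x. d + w \<bullet> x) x :> w" for x
    unfolding gderiv_def by (auto intro!: derivative_eq_intros simp: inner_commute)
  then have "grad (\<lambda>x. d + w \<bullet> x) x = w" for x by (rule grad_eq)
  then show ?thesis using assms by (simp add: elementary_area_def measure_restrict_space fmeasurableD)
qed

text \<open>The divergence theorem turns the edge means of \<open>f\<close> into the integral of its gradient, so the
  interpolant has the mean gradient of \<open>f\<close>, whichever trace has been selected.\<close>
lemma elementary_area_CR_interpolant:
  assumes K: "2 simplex (K :: (real^2) set)" and tr: "has_trace K f t0"
    and G: "integrable (lebesgue_on (interior K)) G" and w: "weak_gradient (interior K) f G"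
  shows "elementary_area K (CR_interpolant K f) =
    measure lebesgue K * sqrt (1 + (norm ((LINT x|lebesgue_on (interior K). G x) /\<^sub>R measure lebesgue K))\<^sup>2)"
proof -
  obtain a b c where abc: "\<not> affine_dependent {a, b, c}" "a \<noteq> b" "b \<noteq> c" "a \<noteq> c" "K = convex hull {a, b, c}"
    using triangle_vertices[OF K] by blast
  note ind = abc(1-4)
  \<comment> \<open>Rotating the vertices gives the same integral identity for the direction
    \<open>a - c\<close>.\<close>
  have ind': "\<not> affine_dependent {c, a, b}" "c \<noteq> a" "a \<noteq> b" "c \<noteq> b" using ind by (auto simp: insert_commute)
  have K': "K = convex hull {c, a, b}" using abc(5) by (simp add: insert_commute)
  define t where "t = boundary_trace K f"
  \<comment> \<open>The selected trace brings its own weak gradient \<open>H\<close> and its own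
    \<open>C1\<close> approximations.\<close>
  have "has_trace K f t" unfolding t_def boundary_trace_def by (rule someI[of "has_trace K f", OF tr])
  then obtain H \<phi> where H: "integrable (lebesgue_on (interior K)) H" "weak_gradient (interior K) f H"
    and \<phi>: "\<And>n. C1 (\<phi> n)" "(\<lambda>n. LINT x|lebesgue_on (interior K). norm (grad (\<phi> n) x - H x)) \<longlonglongrightarrow> 0"
    and seg: "\<And>a b. closed_segment a b edge_of K \<Longrightarrow> segment_integrable a b t"
      "\<And>a b. closed_segment a b edge_of K \<Longrightarrow> (\<lambda>n. segment_integral a b (\<lambda>x. \<bar>\<phi> n x - t x\<bar>)) \<longlonglongrightarrow> 0"
    unfolding has_trace_def by blast
  obtain d v where CR: "CR_interpolant K f = (\<lambda>x. d + v \<bullet> x)"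
    "v \<bullet> (b - a) = 2 * (edge_mean t c b - edge_mean t c a)"
    "v \<bullet> (a - c) = 2 * (edge_mean t b a - edge_mean t b c)"
    using CR_interpolant_eq[OF ind abc(5) t_def seg(1)] by blast
  have D: "GDERIV (\<phi> n) x :> grad (\<phi> n) x" "continuous_on S (grad (\<phi> n))" for n x S
    using C1_obtain[OF \<phi>(1)[of n]] continuous_on_subset by blast+
  have \<phi>c: "continuous_on S (\<phi> n)" for S n by (rule C1_continuous[OF \<phi>(1)])
  let ?I = "LINT x|lebesgue_on (interior K). H x"
  have intD: "integrable (lebesgue_on (interior K)) (grad (\<phi> n))" for n
  proof -
    have "bounded (grad (\<phi> n) ` K)" using D(2) triangleD(1)[OF K] by (intro compact_imp_bounded compact_continuous_image)
    then obtain B where "\<And>x. x \<in> K \<Longrightarrow> norm (grad (\<phi> n) x) \<le> B" by (auto simp: bounded_iff)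
    then show ?thesis
      using measure_triangle(2)[OF K] interior_subset[of K]
      by (intro integrable_lebesgue_on_bounded[where B = B] measurable_lebesgue_on_lebesgue continuous_imp_measurable_lebesgue D(2))
         (auto intro!: AE_I2 simp: space_restrict_space)
  qed
  have D_int: "integral K (grad (\<phi> n)) = (LINT x|lebesgue_on (interior K). grad (\<phi> n) x)" for n
  proof -
    have "integral (interior K) (grad (\<phi> n)) = (LINT x|lebesgue_on (interior K). grad (\<phi> n) x)"
      using lebesgue_integral_eq_integral[OF intD] by simp
    moreover have "integral K (grad (\<phi> n)) = integral (interior K) (grad (\<phi> n))"
      by (rule integral_subset_negligible[symmetric, OF interior_subset triangleD(7)[OF K]])
    ultimately show ?thesis by simp
  qed
  have lim1: "(\<lambda>n. integral K (grad (\<phi> n))) \<longlonglongrightarrow> ?I"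
  proof (rule Lim_transform2[where f = "\<lambda>n. ?I"])
    show "(\<lambda>n. ?I - integral K (grad (\<phi> n))) \<longlonglongrightarrow> 0"
    proof (rule Lim_null_comparison[OF _ \<phi>(2)], intro always_eventually allI)
      fix n
      have "?I - integral K (grad (\<phi> n)) = - (LINT x|lebesgue_on (interior K). grad (\<phi> n) x - H x)"
        unfolding D_int using intD H(1) by simp
      then show "norm (?I - integral K (grad (\<phi> n))) \<le> (LINT x|lebesgue_on (interior K). norm (grad (\<phi> n) x - H x))"
        by (simp del: Bochner_Integration.integral_diff)
    qed
  qed simp
  have lim2: "(\<lambda>n. edge_mean (\<phi> n) x y) \<longlonglongrightarrow> edge_mean t x y" if e: "closed_segment x y edge_of K" for x y
  proof (rule Lim_transform2[where f = "\<lambda>n. edge_mean t x y"])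
    have xy: "x \<noteq> y" using e triangle_edges[OF ind] abc(5) by simp
    have "(\<lambda>n. segment_integral x y (\<lambda>x. \<bar>\<phi> n x - t x\<bar>) / dist x y) \<longlonglongrightarrow> 0 / dist x y"
      using seg(2)[OF e] xy by (intro tendsto_intros) auto
    then have *: "(\<lambda>n. LINT s|lebesgue_on {0..1}. \<bar>\<phi> n (linepath x y s) - t (linepath x y s)\<bar>) \<longlonglongrightarrow> 0"
      using xy by (simp add: segment_integral_def)
    show "(\<lambda>n. edge_mean t x y - edge_mean (\<phi> n) x y) \<longlonglongrightarrow> 0"
    proof (rule Lim_null_comparison[OF _ *], intro always_eventually allI)
      fix n
      have i: "integrable (lebesgue_on {0..1}) (\<lambda>s. \<phi> n (linepath x y s))"
        by (intro continuous_imp_integrable_real continuous_on_compose2[OF \<phi>c[of UNIV]] continuous_intros) auto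
      have "edge_mean t x y - edge_mean (\<phi> n) x y = - (LINT s|lebesgue_on {0..1}. \<phi> n (linepath x y s) - t (linepath x y s))"
        using i seg(1)[OF e] by (simp add: edge_mean_def segment_integrable_def)
      then show "norm (edge_mean t x y - edge_mean (\<phi> n) x y) \<le> (LINT s|lebesgue_on {0..1}. \<bar>\<phi> n (linepath x y s) - t (linepath x y s)\<bar>)"
        by (simp del: Bochner_Integration.integral_diff)
    qed
  qed simp
  have edges: "closed_segment x y edge_of K" if "x \<noteq> y" "{x, y} \<subseteq> {a, b, c}" for x y
    using that triangle_edges[OF ind] abc(5) by blast
  have diffm: "(LINT s|lebesgue_on {0..1}. \<phi> n (linepath x y s) - \<phi> n (linepath x' y' s)) = edge_mean (\<phi> n) x y - edge_mean (\<phi> n) x' y'" for n x y x' y'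
    unfolding edge_mean_def
    by (intro Bochner_Integration.integral_diff continuous_imp_integrable_real continuous_on_compose2[OF \<phi>c[of UNIV]] continuous_intros) auto
  have "?I \<bullet> (b - a) = 2 * measure lebesgue K * (edge_mean t c b - edge_mean t c a)"
  proof (rule LIMSEQ_unique)
    show "(\<lambda>n. integral K (grad (\<phi> n)) \<bullet> (b - a)) \<longlonglongrightarrow> ?I \<bullet> (b - a)"
      by (intro tendsto_intros lim1)
    have "integral K (grad (\<phi> n)) \<bullet> (b - a) = 2 * measure lebesgue K * (edge_mean (\<phi> n) c b - edge_mean (\<phi> n) c a)" for n
      using triangle_directional_integral'[OF ind D] unfolding diffm abc(5)[symmetric] .
    then show "(\<lambda>n. integral K (grad (\<phi> n)) \<bullet> (b - a)) \<longlonglongrightarrow> 2 * measure lebesgue K * (edge_mean t c b - edge_mean t c a)"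
      using ind by (auto intro!: tendsto_intros lim2 edges)
  qed
  moreover have "?I \<bullet> (a - c) = 2 * measure lebesgue K * (edge_mean t b a - edge_mean t b c)"
  proof (rule LIMSEQ_unique)
    show "(\<lambda>n. integral K (grad (\<phi> n)) \<bullet> (a - c)) \<longlonglongrightarrow> ?I \<bullet> (a - c)"
      by (intro tendsto_intros lim1)
    have "integral K (grad (\<phi> n)) \<bullet> (a - c) = 2 * measure lebesgue K * (edge_mean (\<phi> n) b a - edge_mean (\<phi> n) b c)" for n
      using triangle_directional_integral'[OF ind' D] unfolding diffm K'[symmetric] .
    then show "(\<lambda>n. integral K (grad (\<phi> n)) \<bullet> (a - c)) \<longlonglongrightarrow> 2 * measure lebesgue K * (edge_mean t b a - edge_mean t b c)"
      using ind by (auto intro!: tendsto_intros lim2 edges)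
  qed
  ultimately have I: "?I = measure lebesgue K *\<^sub>R v"
    using CR(2,3) by (intro linear_iff_triangle_sides(2)[OF ind]) auto
  \<comment> \<open>\<open>G\<close> and \<open>H\<close> may be different representatives, but both
    are weak gradients of \<open>f\<close>.\<close>
  have "(LINT x|lebesgue_on (interior K). G x) = ?I"
    by (rule weak_gradient_integral_unique[OF _ _ G H(1) w H(2)])
       (use triangleD(6)[OF K] bounded_interior in auto)
  then have "v = (LINT x|lebesgue_on (interior K). G x) /\<^sub>R measure lebesgue K"
    unfolding I using measure_triangle(4)[OF K] by simp
  then show ?thesis
    unfolding CR(1) elementary_area_affine[OF measure_triangle(1)[OF K]] by (simp only:)
qed

section \<open>Traces of Lipschitz functions\<close>

lemma lipschitz_measurable:
  fixes g :: "real^2 \<Rightarrow> real"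
  assumes "L-lipschitz_on UNIV g"
  shows "g \<in> borel_measurable lebesgue"
  using assms by (intro continuous_imp_measurable_lebesgue lipschitz_on_continuous_on)

lemma mollify_grad_measurable:
  assumes lip: "L-lipschitz_on UNIV g" and gB: "\<And>x. \<bar>g x\<bar> \<le> B"
  shows "mollify_grad (eps n) g \<in> borel_measurable lebesgue"
  by (intro continuous_imp_measurable_lebesgue continuous_mollify_grad[OF _ lipschitz_measurable[OF lip] gB]) simp

lemma grad_mollify:
  assumes lip: "L-lipschitz_on UNIV g" and gB: "\<And>x. \<bar>g x\<bar> \<le> B"
  shows "grad (mollify (eps n) g) = mollify_grad (eps n) g"
proof
  fix x
  show "grad (mollify (eps n) g) x = mollify_grad (eps n) g x"
    by (intro grad_eq GDERIV_mollify[OF _ lipschitz_measurable[OF lip] gB]) simp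
qed

context
  fixes \<Omega> :: "(real^2) set" and g :: "real^2 \<Rightarrow> real" and G :: "real^2 \<Rightarrow> real^2" and L B M :: real
  assumes open\<Omega>: "open \<Omega>" and bnd\<Omega>: "bounded \<Omega>"
    and lip: "L-lipschitz_on UNIV g" and gB: "\<And>x. \<bar>g x\<bar> \<le> B"
    and Gm: "G \<in> borel_measurable lebesgue" and GM: "\<And>x. norm (G x) \<le> M"
    and wg: "weak_gradient \<Omega> g G"
begin

text \<open>Once the cube at \<open>x\<close> lies in \<Omega>, the gradient of the mollification is
  the mollification of \<open>G\<close>.\<close>

lemma mollify_grad_tendsto_AE:
  obtains N where "negligible N" "\<And>x. x \<in> \<Omega> - N \<Longrightarrow> (\<lambda>n. mollify_grad (eps n) g x) \<longlonglongrightarrow> G x"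
proof -
  obtain N where N: "negligible N" "\<And>x. x \<notin> N \<Longrightarrow> (\<lambda>n. mollify (eps n) G x) \<longlonglongrightarrow> G x"
    by (rule mollify_tendsto_AE[OF Gm GM]) (rule that)
  show thesis
  proof (rule that[OF N(1)])
    fix x assume x: "x \<in> \<Omega> - N"
    obtain r where r: "r > 0" "ball x r \<subseteq> \<Omega>" using open\<Omega> x openE by blast
    have "\<forall>\<^sub>F n in sequentially. eps n < r / 2" using r by (intro eventually_eps_less) simp
    then have "\<forall>\<^sub>F n in sequentially. mollify (eps n) G x = mollify_grad (eps n) g x"
    proof eventually_elim
      case (elim n)
      have "cbox x (x + eps n *\<^sub>R One) \<subseteq> ball x r"
        using ecube_ball[of _ x "eps n"] elim by force
      then have "GDERIV (mollify (eps n) g) x :> mollify (eps n) G x"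
        using r open\<Omega> by (intro GDERIV_mollify_weak[OF _ lipschitz_measurable[OF lip] gB _ wg]) auto
      moreover have "GDERIV (mollify (eps n) g) x :> mollify_grad (eps n) g x"
        by (intro GDERIV_mollify[OF _ lipschitz_measurable[OF lip] gB]) simp
      ultimately show ?case by (rule GDERIV_unique)
    qed
    then show "(\<lambda>n. mollify_grad (eps n) g x) \<longlonglongrightarrow> G x"
      using N(2)[of x] x by (auto intro: Lim_transform_eventually)
  qed
qed

text \<open>Near the boundary the cubes leave \<Omega> and \<open>mollify_grad\<close> is no longer
  a mean of \<open>G\<close>, but the global Lipschitz constant \<open>L\<close> still bounds it, so
  dominated convergence with \<open>L + M\<close> applies.\<close>

lemma mollify_grad_tendsto_L1:
  assumes "S \<subseteq> \<Omega>" "S \<in> sets lebesgue"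
  shows "(\<lambda>n. LINT x|lebesgue_on S. norm (mollify_grad (eps n) g x - G x)) \<longlonglongrightarrow> 0"
proof -
  obtain N where N: "negligible N" "\<And>x. x \<in> \<Omega> - N \<Longrightarrow> (\<lambda>n. mollify_grad (eps n) g x) \<longlonglongrightarrow> G x"
    by (rule mollify_grad_tendsto_AE) (rule that)
  have S: "S \<in> lmeasurable" using assms bnd\<Omega> by (meson bounded_set_imp_lmeasurable bounded_subset)
  have m: "(\<lambda>x. norm (mollify_grad (eps n) g x - G x)) \<in> borel_measurable (lebesgue_on S)" for n
    using Gm mollify_grad_measurable[OF lip gB, of n] by (intro measurable_lebesgue_on_lebesgue) measurable
  have b: "norm (mollify_grad (eps n) g x - G x) \<le> L + M" for n x
    using norm_triangle_ineq4[of "mollify_grad (eps n) g x" "G x"] GM[of x]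
      norm_mollify_grad_le[OF _ lip gB, of "eps n" x] by simp
  have "(\<lambda>n. LINT x|lebesgue_on S. norm (mollify_grad (eps n) g x - G x)) \<longlonglongrightarrow> (LINT x|lebesgue_on S. 0)"
  proof (rule integral_dominated_convergence[where w = "\<lambda>_. L + M"])
    show "integrable (lebesgue_on S) (\<lambda>_. L + M)"
      by (rule integrable_lebesgue_on_bounded[OF S, where B = "\<bar>L + M\<bar>"]) auto
    show "AE x in lebesgue_on S. (\<lambda>n. norm (mollify_grad (eps n) g x - G x)) \<longlonglongrightarrow> 0"
    proof (rule AE_lebesgue_onI[OF N(1) assms(2)])
      fix x assume "x \<in> S - N"
      then have "(\<lambda>n. mollify_grad (eps n) g x - G x) \<longlonglongrightarrow> G x - G x"
        using assms N(2)[of x] by (intro tendsto_diff tendsto_const) auto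
      then show "(\<lambda>n. norm (mollify_grad (eps n) g x - G x)) \<longlonglongrightarrow> 0"
        by (simp add: tendsto_norm_zero)
    qed
    show "AE x in lebesgue_on S. norm (norm (mollify_grad (eps n) g x - G x)) \<le> L + M" for n
      using b by simp
  qed (use m in simp_all)
  then show ?thesis by simp
qed

text \<open>The mollifications of \<open>g\<close> serve as the approximating sequence. They
  converge uniformly at the rate \<open>L * (2 * eps n)\<close>, which settles the values in the
  triangle and along the edges, and their gradients converge in L1.\<close>

lemma has_trace_lipschitz:
  assumes K: "2 simplex K" "interior K \<subseteq> \<Omega>"
    and f: "f \<in> borel_measurable (lebesgue_on \<Omega>)" "negligible N" "\<And>x. x \<in> \<Omega> - N \<Longrightarrow> f x = g x"
  shows "has_trace K f g" "weak_gradient (interior K) f G" "integrable (lebesgue_on (interior K)) G"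
proof -
  have m\<Omega>: "\<Omega> \<in> sets lebesgue" using open\<Omega> by simp
  have fK: "f \<in> borel_measurable (lebesgue_on (interior K))"
    using f(1) K(2) by (rule measurable_restrict_mono)
  note mK = measure_triangle[OF K(1)]
  have wf: "weak_gradient \<Omega> f G"
    by (rule weak_gradient_cong_AE[OF wg m\<Omega> f(2)])
       (use f measurable_lebesgue_on_lebesgue[OF lipschitz_measurable[OF lip]] measurable_lebesgue_on_lebesgue[OF Gm] in auto)
  show w: "weak_gradient (interior K) f G"
    by (rule weak_gradient_mono[OF wf K(2)]) (use m\<Omega> in auto)
  show iG: "integrable (lebesgue_on (interior K)) G"
    by (rule integrable_lebesgue_on_bounded[OF mK(2) measurable_lebesgue_on_lebesgue[OF Gm], where B = M]) (use GM in simp)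
  have ae: "AE x in lebesgue_on (interior K). f x = g x"
    by (rule AE_lebesgue_onI[OF f(2)]) (use K f in auto)
  have if': "integrable (lebesgue_on (interior K)) f"
    by (rule integrable_lebesgue_on_bounded[OF mK(2) fK, where B = B]) (use ae gB in \<open>auto elim: eventually_mono\<close>)
  have gc: "continuous_on S g" for S using lip lipschitz_on_continuous_on continuous_on_subset by blast
  have dist: "\<bar>mollify (eps n) g x - g x\<bar> \<le> L * (2 * eps n)" for n x
    by (intro mollify_lipschitz_dist[OF _ lip gB]) simp
  have z: "(\<lambda>n. L * (2 * eps n) * c) \<longlonglongrightarrow> 0" for c
    using tendsto_mult_right[OF tendsto_mult_left[OF tendsto_mult_left[OF eps_tendsto, of 2], of L], of c] by simp
  have C: "C1 (mollify (eps n) g)" for n by (intro C1_mollify[OF _ lipschitz_measurable[OF lip] gB]) simp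
  show "has_trace K f g"
    unfolding has_trace_def
  proof (intro exI[of _ G] exI[of _ "\<lambda>n. mollify (eps n) g"] conjI allI impI)
    show "(\<lambda>n. LINT x|lebesgue_on (interior K). \<bar>mollify (eps n) g x - f x\<bar>) \<longlonglongrightarrow> 0"
    proof (rule Lim_null_comparison[OF _ z[of "measure lebesgue (interior K)"]], intro always_eventually allI)
      fix n
      have "(LINT x|lebesgue_on (interior K). \<bar>mollify (eps n) g x - f x\<bar>) \<le> (LINT x|lebesgue_on (interior K). L * (2 * eps n))"
      proof (rule integral_mono_AE)
        show "integrable (lebesgue_on (interior K)) (\<lambda>x. L * (2 * eps n))"
          by (rule integrable_lebesgue_on_bounded[OF mK(2), where B = "\<bar>L * (2 * eps n)\<bar>"]) auto
        then show "integrable (lebesgue_on (interior K)) (\<lambda>x. \<bar>mollify (eps n) g x - f x\<bar>)"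
        proof (rule Bochner_Integration.integrable_bound)
          show "(\<lambda>x. \<bar>mollify (eps n) g x - f x\<bar>) \<in> borel_measurable (lebesgue_on (interior K))"
            using fK measurable_lebesgue_on_lebesgue[OF continuous_imp_measurable_lebesgue[OF C1_continuous[OF C[of n]]]]
            by (intro borel_measurable_abs borel_measurable_diff)
          show "AE x in lebesgue_on (interior K). norm \<bar>mollify (eps n) g x - f x\<bar> \<le> norm (L * (2 * eps n))"
            using ae
          proof eventually_elim
            case (elim x)
            then show ?case using dist[of n x] unfolding real_norm_def by linarith
          qed
        qed
        show "AE x in lebesgue_on (interior K). \<bar>mollify (eps n) g x - f x\<bar> \<le> L * (2 * eps n)"
          using ae by eventually_elim (use dist in force)
      qed
      also have "\<dots> = L * (2 * eps n) * measure lebesgue (interior K)"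
        using mK(2) by (simp add: measure_restrict_space)
      finally show "norm (LINT x|lebesgue_on (interior K). \<bar>mollify (eps n) g x - f x\<bar>) \<le> L * (2 * eps n) * measure lebesgue (interior K)"
        by (simp add: integral_nonneg_AE)
    qed
    show "(\<lambda>n. LINT x|lebesgue_on (interior K). norm (grad (mollify (eps n) g) x - G x)) \<longlonglongrightarrow> 0"
      unfolding grad_mollify[OF lip gB] by (rule mollify_grad_tendsto_L1[OF K(2)]) auto
    fix a b
    have gl: "continuous_on {0..1} (\<lambda>s. g (linepath a b s))"
      by (intro continuous_on_compose2[OF gc[of UNIV]] continuous_intros) auto
    show "segment_integrable a b g"
      unfolding segment_integrable_def by (rule continuous_imp_integrable_real[OF gl])
    show "(\<lambda>n. segment_integral a b (\<lambda>x. \<bar>mollify (eps n) g x - g x\<bar>)) \<longlonglongrightarrow> 0"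
    proof (rule Lim_null_comparison[OF _ z[of "dist a b"]], intro always_eventually allI)
      fix n
      have "(LINT s|lebesgue_on {0..1}. \<bar>mollify (eps n) g (linepath a b s) - g (linepath a b s)\<bar>) \<le> (LINT s|lebesgue_on {0..1::real}. L * (2 * eps n))"
        by (intro integral_mono continuous_imp_integrable_real continuous_intros continuous_on_compose2[OF C1_continuous[OF C[of n], of UNIV]] gl dist) auto
      also have "\<dots> = L * (2 * eps n)" by (simp add: measure_restrict_space)
      finally show "norm (segment_integral a b (\<lambda>x. \<bar>mollify (eps n) g x - g x\<bar>)) \<le> L * (2 * eps n) * dist a b"
        by (simp add: segment_integral_def abs_mult integral_nonneg_AE mult.commute[of "dist a b"] mult_right_mono)
    qed
  qed (use C if' iG w in auto)
qed

end

section \<open>Means of gradients over small triangles\<close>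

lemma integrable_lebesgue_on_subset:
  fixes h :: "'a::euclidean_space \<Rightarrow> 'b::euclidean_space"
  assumes "integrable (lebesgue_on V) h" "U \<subseteq> V" "U \<in> sets lebesgue" "V \<in> sets lebesgue"
  shows "integrable (lebesgue_on U) h"
proof -
  have "set_integrable lebesgue V h"
    using assms(1,4) by (simp add: integrable_restrict_space set_integrable_def)
  then have "set_integrable lebesgue U h"
    by (rule set_integrable_subset) (use assms in auto)
  then show ?thesis using assms(3) by (simp add: integrable_restrict_space set_integrable_def)
qed

lemma integral_lebesgue_on_partition:
  fixes h :: "'a::euclidean_space \<Rightarrow> 'b::euclidean_space"
  assumes h: "integrable (lebesgue_on V) h" and V: "V \<in> sets lebesgue"
    and I: "finite I" "\<And>i. i \<in> I \<Longrightarrow> U i \<in> sets lebesgue" "\<And>i. i \<in> I \<Longrightarrow> U i \<subseteq> V"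
      "\<And>i j. i \<in> I \<Longrightarrow> j \<in> I \<Longrightarrow> i \<noteq> j \<Longrightarrow> U i \<inter> U j = {}"
    and N: "negligible (V - (\<Union>i\<in>I. U i))"
  shows "(LINT x|lebesgue_on V. h x) = (\<Sum>i\<in>I. LINT x|lebesgue_on (U i). h x)"
proof -
  have iU: "integrable lebesgue (\<lambda>x. indicat_real (U i) x *\<^sub>R h x)" if "i \<in> I" for i
    using integrable_lebesgue_on_subset[OF h I(3)[OF that] I(2)[OF that] V] I(2)[OF that]
    by (simp add: integrable_restrict_space set_integrable_def)
  have iV: "integrable lebesgue (\<lambda>x. indicat_real V x *\<^sub>R h x)"
    using h V by (simp add: integrable_restrict_space set_integrable_def)
  have eq: "indicat_real V x *\<^sub>R h x = (\<Sum>i\<in>I. indicat_real (U i) x *\<^sub>R h x)" if x: "x \<notin> V - (\<Union>i\<in>I. U i)" for x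
  proof (cases "x \<in> (\<Union>i\<in>I. U i)")
    case True
    then obtain i where i: "i \<in> I" "x \<in> U i" by blast
    have "(\<Sum>j\<in>I. indicat_real (U j) x *\<^sub>R h x) = (\<Sum>j\<in>I. if j = i then h x else 0)"
      using I(4)[OF i(1)] i by (intro sum.cong) (auto simp: indicator_def)
    then show ?thesis using i I(1,3) by (auto simp: indicator_def)
  next
    case False
    then show ?thesis using x by (auto simp: indicator_def intro!: sum.neutral)
  qed
  have "(LINT x|lebesgue_on V. h x) = (LINT x|lebesgue. indicat_real V x *\<^sub>R h x)"
    using V by (simp add: integral_restrict_space)
  also have "\<dots> = (LINT x|lebesgue. (\<Sum>i\<in>I. indicat_real (U i) x *\<^sub>R h x))"
  proof (rule integral_cong_AE)
    show "(\<lambda>x. indicat_real V x *\<^sub>R h x) \<in> borel_measurable lebesgue" by (rule borel_measurable_integrable[OF iV])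
    show "(\<lambda>x. \<Sum>i\<in>I. indicat_real (U i) x *\<^sub>R h x) \<in> borel_measurable lebesgue"
      by (intro borel_measurable_sum borel_measurable_integrable iU)
    show "AE x in lebesgue. indicat_real V x *\<^sub>R h x = (\<Sum>i\<in>I. indicat_real (U i) x *\<^sub>R h x)"
      unfolding eventually_ae_filter_negligible using N eq by (intro exI[of _ "V - (\<Union>i\<in>I. U i)"]) blast
  qed
  also have "\<dots> = (\<Sum>i\<in>I. LINT x|lebesgue. indicat_real (U i) x *\<^sub>R h x)"
    using iU by (rule Bochner_Integration.integral_sum)
  also have "\<dots> = (\<Sum>i\<in>I. LINT x|lebesgue_on (U i). h x)"
    using I(2) by (intro sum.cong) (simp_all add: integral_restrict_space)
  finally show ?thesis .
qed

text \<open>The area integrand is the norm of the pair (1, p), so this is the reverse triangle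
  inequality.\<close>

lemma sqrt_one_plus_lipschitz:
  fixes p q :: "'a::real_inner"
  shows "\<bar>sqrt (1 + (norm p)\<^sup>2) - sqrt (1 + (norm q)\<^sup>2)\<bar> \<le> norm (p - q)"
proof -
  have e: "sqrt (1 + (norm v)\<^sup>2) = norm (1::real, v)" for v :: 'a by (simp add: norm_Pair)
  have "\<bar>norm (1::real, p) - norm (1::real, q)\<bar> \<le> norm ((1::real, p) - (1, q))" by (rule norm_triangle_ineq3)
  moreover have "norm ((1::real, p) - (1, q)) = norm (p - q)" by (simp add: norm_Pair)
  ultimately show ?thesis by (simp only: e)
qed

text \<open>\<open>H\<close> is nearly constant on \<open>K\<close>: with d the L1 distance of
  \<open>G\<close> and \<open>H\<close> and m the area, the mean of \<open>G\<close> is within d / m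
  + e of every value of \<open>H\<close>. Integrating |mean - H| + |H - G| gives 2 d + e m, with no
  reference to the shape of \<open>K\<close>.\<close>

lemma mean_gradient_error:
  fixes G H :: "real^2 \<Rightarrow> real^2"
  assumes K: "2 simplex K" and G: "integrable (lebesgue_on (interior K)) G" and H: "integrable (lebesgue_on (interior K)) H"
    and osc: "\<And>x y. x \<in> K \<Longrightarrow> y \<in> K \<Longrightarrow> norm (H x - H y) \<le> e"
  shows "\<bar>measure lebesgue K * sqrt (1 + (norm ((LINT x|lebesgue_on (interior K). G x) /\<^sub>R measure lebesgue K))\<^sup>2)
     - (LINT x|lebesgue_on (interior K). sqrt (1 + (norm (G x))\<^sup>2))\<bar>
     \<le> 2 * (LINT x|lebesgue_on (interior K). norm (G x - H x)) + e * measure lebesgue K"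
proof -
  note mK = measure_triangle[OF K]
  define m where "m = measure lebesgue K"
  have m: "m > 0" using mK by (simp add: m_def)
  define q where "q = (LINT x|lebesgue_on (interior K). G x) /\<^sub>R m"
  let ?s = "\<lambda>p::real^2. sqrt (1 + (norm p)\<^sup>2)"
  let ?M = "lebesgue_on (interior K)"
  define d where "d = (LINT x|?M. norm (G x - H x))"
  have ic: "integrable ?M (\<lambda>_. c)" for c :: "'b::euclidean_space"
    by (rule integrable_lebesgue_on_bounded[OF mK(2), where B = "norm c"]) auto
  have cI: "(LINT x|?M. c) = m *\<^sub>R c" for c :: "'b::euclidean_space"
    using mK by (simp add: measure_restrict_space m_def)
  have iGH: "integrable ?M (\<lambda>x. G x - H x)" using G H by simp
  have sG: "integrable ?M (\<lambda>x. ?s (G x))"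
  proof (rule Bochner_Integration.integrable_bound[where f = "\<lambda>x. 1 + norm (G x)"])
    show "integrable ?M (\<lambda>x. 1 + norm (G x))" using G ic[of "1::real"] by simp
    show "(\<lambda>x. ?s (G x)) \<in> borel_measurable ?M"
      using borel_measurable_integrable[OF G] by measurable
    have "?s p \<le> 1 + norm p" for p
      using sqrt_one_plus_lipschitz[of p 0] by simp
    then show "AE x in ?M. norm (?s (G x)) \<le> norm (1 + norm (G x))"
      by (auto intro!: AE_I2 simp: abs_of_nonneg add_nonneg_nonneg)
  qed
  have dq: "norm (q - H x) \<le> d / m + e" if x: "x \<in> K" for x
  proof -
    have "q - H x = (LINT y|?M. G y - H x) /\<^sub>R m"
      using m G ic[of "H x"] by (simp add: q_def cI scaleR_diff_right del: lebesgue_integral_const)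
    then have "norm (q - H x) = norm (LINT y|?M. G y - H x) / m" using m by (simp add: divide_inverse mult.commute)
    also have "norm (LINT y|?M. G y - H x) \<le> (LINT y|?M. norm (G y - H y) + e)"
    proof (rule order_trans[OF integral_norm_bound], rule integral_mono)
      show "integrable ?M (\<lambda>y. norm (G y - H x))" using G ic[of "H x"] by simp
      show "integrable ?M (\<lambda>y. norm (G y - H y) + e)" using iGH ic[of e] by simp
      fix y assume "y \<in> space ?M"
      then have y: "y \<in> K" using interior_subset by (auto simp: space_restrict_space)
      show "norm (G y - H x) \<le> norm (G y - H y) + e"
        using norm_triangle_ineq[of "G y - H y" "H y - H x"] osc[OF y x] by simp
    qed
    also have "\<dots> = d + m * e" using iGH ic[of e] by (simp add: d_def cI del: lebesgue_integral_const)
    finally have "norm (q - H x) \<le> (d + m * e) / m" using m by (simp add: divide_right_mono)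
    then show ?thesis using m by (simp add: add_divide_distrib)
  qed
  have iq: "integrable ?M (\<lambda>x. norm (q - G x))" using G ic[of q] by simp
  have "m * ?s q - (LINT x|?M. ?s (G x)) = (LINT x|?M. ?s q - ?s (G x))"
    using sG ic[of "?s q"] by (simp add: cI del: lebesgue_integral_const)
  also have "norm \<dots> \<le> (LINT x|?M. norm (q - G x))"
    by (rule order_trans[OF integral_norm_bound], rule integral_mono)
       (use sG ic[of "?s q"] iq sqrt_one_plus_lipschitz in auto)
  also have "\<dots> \<le> (LINT x|?M. (d / m + e) + norm (G x - H x))"
  proof (rule integral_mono[OF iq])
    show "integrable ?M (\<lambda>x. (d / m + e) + norm (G x - H x))" using iGH ic[of "d/m+e"] by simp
    fix x assume "x \<in> space ?M"
    then have x: "x \<in> K" using interior_subset by (auto simp: space_restrict_space)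
    show "norm (q - G x) \<le> (d / m + e) + norm (G x - H x)"
      using norm_triangle_ineq[of "q - H x" "H x - G x"] dq[OF x] by (simp add: norm_minus_commute)
  qed
  also have "\<dots> = m * (d / m + e) + d"
    using iGH ic[of "d/m+e"] by (simp add: cI d_def del: lebesgue_integral_const)
  also have "\<dots> = 2 * d + e * m" using m by (simp add: field_simps)
  finally show ?thesis unfolding q_def m_def d_def by simp
qed

section \<open>Lower bound for the Lebesgue area\<close>

lemma borel_measurable_lebesgue_on_spike:
  fixes f h :: "'a::euclidean_space \<Rightarrow> 'b::euclidean_space"
  assumes f: "f \<in> borel_measurable (lebesgue_on S)" and S: "S \<in> sets lebesgue"
    and N: "negligible N" "\<And>x. x \<in> S - N \<Longrightarrow> h x = f x"
  shows "h \<in> borel_measurable (lebesgue_on S)"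
proof (rule borel_measurableI)
  fix U :: "'b set" assume "open U"
  then have 1: "f -` U \<inter> S \<in> sets lebesgue"
    using measurable_sets[OF f, of U] S by (auto simp: space_restrict_space sets_restrict_space_iff)
  have NS: "N \<in> sets lebesgue" "h -` U \<inter> S \<inter> N \<in> sets lebesgue"
    using N(1) negligible_subset[OF N(1), of "h -` U \<inter> S \<inter> N"] negligible_imp_sets by auto
  have "h -` U \<inter> S = ((f -` U \<inter> S) - N) \<union> (h -` U \<inter> S \<inter> N)"
    using N(2) by auto
  moreover have "((f -` U \<inter> S) - N) \<union> (h -` U \<inter> S \<inter> N) \<in> sets lebesgue"
    using 1 NS by (intro sets.Un sets.Diff)
  ultimately have "h -` U \<inter> S \<in> sets lebesgue" by (simp only:)
  then show "h -` U \<inter> space (lebesgue_on S) \<in> sets (lebesgue_on S)"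
    using S by (simp add: space_restrict_space sets_restrict_space_iff)
qed

lemma integral_translate_continuous:
  fixes u :: "'a::euclidean_space \<Rightarrow> real"
  assumes "continuous_on UNIV u"
  shows "(LINT x|lebesgue. u (x + a)) = (LINT x|lebesgue. u x)"
proof -
  have m: "u \<in> borel_measurable lborel" "(\<lambda>x. u (x + a)) \<in> borel_measurable lborel"
    by (auto intro!: borel_measurable_continuous_onI continuous_on_compose2[OF assms] continuous_intros assms)
  have "(LINT x|lebesgue. u (x + a)) = (LINT x|lborel. u (x + a))" by (rule integral_completion[OF m(2)])
  also have "\<dots> = (LINT x|distr lborel borel ((+) a). u x)"
    using m by (subst integral_distr) (auto simp: add.commute)
  also have "\<dots> = (LINT x|lebesgue. u x)"
    by (simp add: lborel_distr_plus integral_completion[OF m(1)])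
  finally show ?thesis .
qed

text \<open>The integral of a difference quotient vanishes by translation invariance.\<close>
lemma integral_gradient_compact_support:
  fixes u :: "real^2 \<Rightarrow> real"
  assumes lip: "L-lipschitz_on UNIV u" and supp: "\<And>x. x \<notin> cball 0 R \<Longrightarrow> u x = 0"
    and B: "\<And>x. \<bar>u x\<bar> \<le> B"
    and N: "negligible N" "\<And>x. x \<notin> N \<Longrightarrow> GDERIV u x :> D x"
    and D: "integrable lebesgue D"
  shows "(LINT x|lebesgue. D x) = 0"
proof -
  have uc: "continuous_on UNIV u" using lip by (rule lipschitz_on_continuous_on)
  have L0: "L \<ge> 0" using lip by (rule lipschitz_on_nonneg)
  have "(LINT x|lebesgue. D x) \<bullet> v = 0" if v: "norm v \<le> 1" for v
  proof -
    define Q where "Q n x = (u (x + eps n *\<^sub>R v) - u x) / eps n" for n x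
    have e1: "eps n \<le> 1" "0 < eps n" for n by (auto simp: inverse_le_1_iff)
    \<comment> \<open>The steps are at most 1 long, so the quotients vanish outside radius
      \<open>R + 1\<close> and share an integrable majorant.\<close>
    have Qb: "\<bar>Q n x\<bar> \<le> L * indicat_real (cball 0 (R + 1)) x" for n x
    proof (cases "x \<in> cball 0 (R + 1)")
      case True
      have "\<bar>u (x + eps n *\<^sub>R v) - u x\<bar> \<le> L * norm (eps n *\<^sub>R v)"
        using lipschitz_onD[OF lip, of "x + eps n *\<^sub>R v" x] by (simp add: dist_norm)
      also have "\<dots> \<le> L * eps n" using v e1[of n] L0 by (intro mult_left_mono) (auto simp: mult_left_le)
      finally show ?thesis using True e1[of n] unfolding Q_def by (simp add: abs_divide divide_le_eq del: of_nat_Suc)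
    next
      case False
      have "norm (eps n *\<^sub>R v) \<le> 1" using v e1[of n] mult_mono[of "eps n" 1 "norm v" 1] by simp
      then have "x \<notin> cball 0 R" "x + eps n *\<^sub>R v \<notin> cball 0 R"
        using False norm_triangle_ineq4[of "x + eps n *\<^sub>R v" "eps n *\<^sub>R v"] by auto
      then show ?thesis using False supp by (simp add: Q_def)
    qed
    have Qm: "Q n \<in> borel_measurable lebesgue" for n
      unfolding Q_def by (intro continuous_imp_measurable_lebesgue continuous_intros continuous_on_compose2[OF uc]) (use e1 in auto)
    have "(\<lambda>n. LINT x|lebesgue. Q n x) \<longlonglongrightarrow> (LINT x|lebesgue. D x \<bullet> v)"
    proof (rule integral_dominated_convergence[where w = "\<lambda>x. L * indicat_real (cball 0 (R + 1)) x"])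
      show "(\<lambda>x. D x \<bullet> v) \<in> borel_measurable lebesgue" using D by simp
      show "integrable lebesgue (\<lambda>x. L * indicat_real (cball (0::real^2) (R + 1)) x)"
        using lmeasurable_cball[of "0::real^2" "R + 1"]
        by (intro integrable_mult_right integrable_real_indicator) (auto simp: fmeasurable_def)
      show "AE x in lebesgue. (\<lambda>n. Q n x) \<longlonglongrightarrow> D x \<bullet> v"
        unfolding eventually_ae_filter_negligible
      proof (intro exI[of _ N] conjI N(1) subsetI)
        fix x assume "x \<in> {x. \<not> (\<lambda>n. Q n x) \<longlonglongrightarrow> D x \<bullet> v}"
        then have nl: "\<not> (\<lambda>n. Q n x) \<longlonglongrightarrow> D x \<bullet> v" by simp
        show "x \<in> N"
        proof (rule ccontr)
          assume "x \<notin> N"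
          then have 1: "(u has_derivative (\<lambda>h. h \<bullet> D x)) (at (x + 0 *\<^sub>R v))" using N(2) by (simp add: gderiv_def)
          have "((\<lambda>t::real. x + t *\<^sub>R v) has_derivative (\<lambda>t. t *\<^sub>R v)) (at 0)"
            by (auto intro!: derivative_eq_intros)
          from has_derivative_compose[OF this 1]
          have "((\<lambda>t. u (x + t *\<^sub>R v)) has_derivative (\<lambda>t. (t *\<^sub>R v) \<bullet> D x)) (at 0)" .
          moreover have "(\<lambda>t. (t *\<^sub>R v) \<bullet> D x) = (*) (D x \<bullet> v)"
            by (simp add: fun_eq_iff mult.commute inner_commute)
          ultimately have "((\<lambda>t. u (x + t *\<^sub>R v)) has_real_derivative (D x \<bullet> v)) (at 0)"
            by (simp only: has_field_derivative_def)
          then have "(\<lambda>h. (u (x + h *\<^sub>R v) - u x) / h) \<midarrow>0\<rightarrow> D x \<bullet> v" by (simp add: DERIV_def)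
          then have "(\<lambda>n. Q n x) \<longlonglongrightarrow> D x \<bullet> v"
            unfolding Q_def by (rule filterlim_compose) (use eps_tendsto in \<open>simp add: filterlim_at\<close>)
          then show False using nl by blast
        qed
      qed
      show "AE x in lebesgue. norm (Q n x) \<le> L * indicat_real (cball 0 (R + 1)) x" for n
        using Qb by (intro AE_I2) simp
    qed (rule Qm)
    moreover have "(LINT x|lebesgue. Q n x) = 0" for n
    proof -
      have iu: "integrable lebesgue (\<lambda>x. u (x + a))" for a
      proof (rule integrable_bounded_support(1)[where S = "cball (-a) R" and B = B])
        show "(\<lambda>x. u (x + a)) \<in> borel_measurable lebesgue"
          by (intro continuous_imp_measurable_lebesgue continuous_on_compose2[OF uc] continuous_intros) auto
        show "norm (u (y + a)) \<le> B" for y using B by simp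
        show "u (y + a) = 0" if "y \<notin> cball (-a) R" for y
          using that supp[of "y + a"] by (simp add: dist_norm norm_minus_commute add.commute)
      qed simp
      have "(LINT x|lebesgue. Q n x) = ((LINT x|lebesgue. u (x + eps n *\<^sub>R v)) - (LINT x|lebesgue. u x)) / eps n"
        unfolding Q_def using iu[of "eps n *\<^sub>R v"] iu[of 0] by simp
      then show ?thesis using integral_translate_continuous[OF uc] by simp
    qed
    ultimately have "(\<lambda>n::nat. 0) \<longlonglongrightarrow> (LINT x|lebesgue. D x \<bullet> v)" by simp
    then have "(LINT x|lebesgue. D x \<bullet> v) = 0" using LIMSEQ_unique tendsto_const by blast
    then show ?thesis using integral_inner_left[of v lebesgue D] D by simp
  qed
  from this[of "axis 1 1"] this[of "axis 2 1"] show ?thesis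
    by (simp add: norm_axis_1 cart_eq_inner_axis[symmetric] vec_eq_iff forall_2)
qed

lemma C1_compact_support_lipschitz:
  fixes \<phi> :: "real^2 \<Rightarrow> real"
  assumes "C1 \<phi>" "compact S" "\<And>x. x \<notin> S \<Longrightarrow> \<phi> x = 0" "\<And>x. x \<notin> S \<Longrightarrow> grad \<phi> x = 0"
  obtains L B where "L-lipschitz_on UNIV \<phi>" "\<And>x. \<bar>\<phi> x\<bar> \<le> B" "0 \<le> B" "\<And>x. norm (grad \<phi> x) \<le> L"
proof -
  have D: "\<And>x. GDERIV \<phi> x :> grad \<phi> x" "continuous_on UNIV (grad \<phi>)"
    using C1_obtain[OF assms(1)] by blast+
  have "bounded (grad \<phi> ` S)" "bounded (\<phi> ` S)"
    using assms(2) continuous_on_subset[OF D(2)] C1_continuous[OF assms(1)]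
    by (auto intro!: compact_imp_bounded compact_continuous_image)
  then obtain L B where L: "L > 0" "\<And>x. x \<in> S \<Longrightarrow> norm (grad \<phi> x) \<le> L" and B: "B > 0" "\<And>x. x \<in> S \<Longrightarrow> \<bar>\<phi> x\<bar> \<le> B"
    by (auto simp: bounded_pos)
  have L': "norm (grad \<phi> x) \<le> L" for x using L assms(4)[of x] by (cases "x \<in> S") auto
  have B': "\<bar>\<phi> x\<bar> \<le> B" for x using B assms(3)[of x] by (cases "x \<in> S") auto
  have "L-lipschitz_on UNIV \<phi>"
  proof (rule lipschitz_onI)
    fix x y
    show "dist (\<phi> x) (\<phi> y) \<le> L * dist x y"
      using GDERIV_bound[of UNIV \<phi> "grad \<phi>" L x y] D(1) L' by (simp add: dist_norm)
  qed (use L in simp)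
  then show thesis using that B' B(1) L' by (metis less_imp_le)
qed

text \<open>The product of \<phi> and \<open>F\<close> is Lipschitz with compact support, so the
  integral of its gradient vanishes, and the product rule turns this into integration by parts. A
  bounded Lipschitz extension \<open>E\<close> of \<open>F\<close> makes the product available on
  the whole plane; \<phi> vanishes where \<open>E\<close> and \<open>F\<close> may differ.\<close>

lemma weak_gradient_of_lipschitz:
  fixes F :: "real^2 \<Rightarrow> real"
  assumes K: "2 simplex K" and lip: "L-lipschitz_on K F"
    and N: "negligible N" "\<And>x. x \<in> interior K - N \<Longrightarrow> GDERIV F x :> D x"
    and D: "D \<in> borel_measurable (lebesgue_on (interior K))" "\<And>x. x \<in> interior K - N \<Longrightarrow> norm (D x) \<le> M"
  shows "weak_gradient (interior K) F D"
  unfolding weak_gradient_def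
proof (intro allI impI)
  fix \<phi> assume \<phi>: "test_function (interior K) \<phi>"
  note TK = triangleD[OF K]
  let ?U = "interior K" and ?S = "closure {x. \<phi> x \<noteq> 0}"
  have S: "compact ?S" "?S \<subseteq> ?U" "C1 \<phi>" using \<phi> by (auto simp: test_function_def)
  have D\<phi>: "GDERIV \<phi> x :> grad \<phi> x" for x using C1_obtain[OF S(3)] by blast
  have D\<phi>c: "continuous_on UNIV (grad \<phi>)" using C1_obtain[OF S(3)] by blast
  have \<phi>0: "\<phi> x = 0" "grad \<phi> x = 0" if "x \<notin> ?U" for x using test_function_vanishes[OF \<phi> that] by auto
  obtain L' B' where \<phi>L: "L'-lipschitz_on UNIV \<phi>" "\<And>x. \<bar>\<phi> x\<bar> \<le> B'" "0 \<le> B'" "\<And>x. norm (grad \<phi> x) \<le> L'"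
    by (rule C1_compact_support_lipschitz[OF S(3) TK(1)]) (use \<phi>0 interior_subset that in blast)+
  have "bounded (F ` K)" using lip TK(1) by (intro compact_imp_bounded compact_continuous_image lipschitz_on_continuous_on)
  then obtain B where B: "\<And>x. x \<in> K \<Longrightarrow> \<bar>F x\<bar> \<le> B" by (auto simp: bounded_iff)
  obtain E where E: "L-lipschitz_on UNIV E" "\<And>x. x \<in> K \<Longrightarrow> E x = F x" "\<And>x. \<bar>E x\<bar> \<le> B"
    by (rule lipschitz_extension_real[OF lip _ B]) (use TK(4) interior_subset that in blast)+
  have B0: "B \<ge> 0" using E(3)[of 0] by linarith
  define u where "u x = \<phi> x * E x" for x
  define P where "P x = \<phi> x *\<^sub>R D x + F x *\<^sub>R grad \<phi> x" for x
  define Q where "Q x = (if x \<in> ?U then P x else 0)" for x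
  obtain R where R: "\<And>x. x \<in> K \<Longrightarrow> norm x \<le> R" using TK(6) by (auto simp: bounded_iff)
  have mF: "F \<in> borel_measurable (lebesgue_on ?U)"
  proof -
    have "E \<in> borel_measurable (lebesgue_on ?U)"
      using E(1) by (intro measurable_lebesgue_on_lebesgue continuous_imp_measurable_lebesgue lipschitz_on_continuous_on)
    then show ?thesis
      by (rule borel_measurable_lebesgue_on_spike[where N = "{}"]) (use E(2) subsetD[OF interior_subset[of K]] in auto)
  qed
  have m\<phi>: "\<phi> \<in> borel_measurable (lebesgue_on ?U)" "grad \<phi> \<in> borel_measurable (lebesgue_on ?U)"
    using C1_continuous[OF S(3)] D\<phi>c by (auto intro!: measurable_lebesgue_on_lebesgue continuous_imp_measurable_lebesgue)
  note mU = measure_triangle(2)[OF K]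
  have i1: "integrable (lebesgue_on ?U) (\<lambda>x. \<phi> x *\<^sub>R D x)"
  proof (rule integrable_lebesgue_on_bounded[OF mU, where B = "B' * M"])
    show "(\<lambda>x. \<phi> x *\<^sub>R D x) \<in> borel_measurable (lebesgue_on ?U)" using m\<phi> D(1) by (intro borel_measurable_scaleR)
    show "AE x in lebesgue_on ?U. norm (\<phi> x *\<^sub>R D x) \<le> B' * M"
      by (rule AE_lebesgue_onI[OF N(1)]) (use D(2) \<phi>L(2,3) in \<open>auto intro!: mult_mono\<close>)
  qed
  have i2: "integrable (lebesgue_on ?U) (\<lambda>x. F x *\<^sub>R grad \<phi> x)"
  proof (rule integrable_lebesgue_on_bounded[OF mU, where B = "B * L'"])
    show "(\<lambda>x. F x *\<^sub>R grad \<phi> x) \<in> borel_measurable (lebesgue_on ?U)" using m\<phi> mF by (intro borel_measurable_scaleR)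
    show "AE x in lebesgue_on ?U. norm (F x *\<^sub>R grad \<phi> x) \<le> B * L'"
      by (rule AE_lebesgue_onI[of "{}"]) (use B \<phi>L(4) B0 interior_subset in \<open>auto intro!: mult_mono\<close>)
  qed
  have iP: "integrable (lebesgue_on ?U) P" unfolding P_def using i1 i2 by simp
  have Qeq: "Q = (\<lambda>x. indicat_real ?U x *\<^sub>R P x)" by (auto simp: Q_def fun_eq_iff)
  have iQ: "integrable lebesgue Q"
    using iP unfolding Qeq by (simp add: integrable_restrict_space set_integrable_def)
  have "(LINT x|lebesgue. Q x) = 0"
  proof (rule integral_gradient_compact_support[of "B' * L + B * L'" u R "B' * B" N])
    show "(B' * L + B * L')-lipschitz_on UNIV u"
    proof (rule lipschitz_onI)
      fix x y
      have "u x - u y = \<phi> x * (E x - E y) + E y * (\<phi> x - \<phi> y)" by (simp add: u_def algebra_simps)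
      then have "\<bar>u x - u y\<bar> \<le> \<bar>\<phi> x\<bar> * \<bar>E x - E y\<bar> + \<bar>E y\<bar> * \<bar>\<phi> x - \<phi> y\<bar>"
        using abs_triangle_ineq[of "\<phi> x * (E x - E y)" "E y * (\<phi> x - \<phi> y)"] by (simp add: abs_mult)
      also have "\<dots> \<le> B' * (L * dist x y) + B * (L' * dist x y)"
        using \<phi>L(2,3) E(3) B0 lipschitz_onD[OF E(1), of x y] lipschitz_onD[OF \<phi>L(1), of x y]
        by (intro add_mono mult_mono) (auto simp: dist_real_def)
      finally show "dist (u x) (u y) \<le> (B' * L + B * L') * dist x y" by (simp add: dist_real_def algebra_simps)
    next
      show "0 \<le> B' * L + B * L'"
        using \<phi>L(3) B0 lipschitz_on_nonneg[OF lip] lipschitz_on_nonneg[OF \<phi>L(1)] by simp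
    qed
    show "u x = 0" if "x \<notin> cball 0 R" for x
      using that R[of x] \<phi>0(1)[of x] interior_subset[of K] by (auto simp: u_def)
    show "\<bar>u x\<bar> \<le> B' * B" for x
      unfolding u_def abs_mult using \<phi>L(2,3) E(3) by (intro mult_mono) auto
    show "GDERIV u x :> Q x" if x: "x \<notin> N" for x
    proof (cases "x \<in> ?U")
      case True
      have "GDERIV E x :> D x"
        unfolding gderiv_def
      proof (rule has_derivative_transform_within_open[where s = ?U and f = F])
        show "(F has_derivative (\<lambda>h. h \<bullet> D x)) (at x)" using N(2)[of x] True x by (simp add: gderiv_def)
        show "F y = E y" if "y \<in> ?U" for y using E(2) that interior_subset by (metis subsetD)
      qed (use True in auto)
      from GDERIV_mult[OF D\<phi> this] have "GDERIV u x :> \<phi> x *\<^sub>R D x + E x *\<^sub>R grad \<phi> x"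
        unfolding u_def[abs_def] .
      then show ?thesis using True E(2)[of x] interior_subset[of K] by (auto simp: Q_def P_def)
    next
      case False
      have "GDERIV u x :> 0"
        unfolding gderiv_def
      proof (rule has_derivative_transform_within_open[where s = "- ?S" and f = "\<lambda>_. 0"])
        show "((\<lambda>_. 0) has_derivative (\<lambda>h. h \<bullet> 0)) (at x)" by simp
        show "x \<in> - ?S" using False S(2) by blast
        show "0 = u y" if "y \<in> - ?S" for y
          using that closure_subset[of "{x. \<phi> x \<noteq> 0}"] by (auto simp: u_def)
        show "open (- ?S)" by (intro open_Compl closed_closure)
      qed
      then show ?thesis using False by (simp add: Q_def)
    qed
  qed (rule N(1), rule iQ)
  then have "(LINT x|lebesgue_on ?U. P x) = 0"
    unfolding Qeq by (simp add: integral_restrict_space)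
  then have "(LINT x|lebesgue_on ?U. \<phi> x *\<^sub>R D x) + (LINT x|lebesgue_on ?U. F x *\<^sub>R grad \<phi> x) = 0"
    unfolding P_def using i1 i2 by simp
  then show "(LINT x|lebesgue_on ?U. F x *\<^sub>R grad \<phi> x) = - (LINT x|lebesgue_on ?U. \<phi> x *\<^sub>R D x)"
    by (simp add: add_eq_0_iff)
qed

text \<open>Off the null set of the edges the gradient is one of finitely many slopes, and
  \<open>L\<close> is the sum of their norms. The Lipschitz bound is confined to convex sets: along
  a segment in the closure of \<Omega>, finitely many closed pieces on which \<open>F\<close> is
  affine cover the parameter interval.\<close>

lemma piecewise_affine_gradient:
  assumes dom: "polygonal_domain \<Omega>" and bnd: "bounded \<Omega>" and tri: "triangulation_of \<Omega> \<sigma>"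
    and F: "continuous_on (closure \<Omega>) F" "piecewise_affine \<sigma> F"
  obtains L N where "negligible N" "\<And>x. x \<in> \<Omega> - N \<Longrightarrow> GDERIV F x :> grad F x"
    "\<And>x. x \<in> \<Omega> - N \<Longrightarrow> norm (grad F x) \<le> L" "grad F \<in> borel_measurable (lebesgue_on \<Omega>)"
    "\<And>K. convex K \<Longrightarrow> K \<subseteq> closure \<Omega> \<Longrightarrow> L-lipschitz_on K F"
proof -
  note t = triangulation_ofD[OF tri]
  obtain c w where cw: "\<And>S x. S \<in> \<sigma> \<Longrightarrow> x \<in> S \<Longrightarrow> F x = c S + w S \<bullet> x"
    using F(2) unfolding piecewise_affine_def by metis
  define N where "N = closure \<Omega> - (\<Union>S\<in>\<sigma>. interior S)"
  have N: "negligible N" unfolding N_def by (rule triangulation_negligible_rest[OF tri])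
  define L where "L = (\<Sum>S\<in>\<sigma>. norm (w S))"
  have wL: "norm (w S) \<le> L" if "S \<in> \<sigma>" for S
    unfolding L_def using t(1) that by (intro member_le_sum) auto
  have L0: "L \<ge> 0" unfolding L_def by (intro sum_nonneg) auto
  have gd: "GDERIV F x :> w S" if "S \<in> \<sigma>" "x \<in> interior S" for x S
    unfolding gderiv_def
  proof (rule has_derivative_transform_within_open[where s = "interior S" and f = "\<lambda>x. c S + w S \<bullet> x"])
    show "((\<lambda>x. c S + w S \<bullet> x) has_derivative (\<lambda>h. h \<bullet> w S)) (at x)"
      by (auto intro!: derivative_eq_intros simp: inner_commute)
    show "c S + w S \<bullet> y = F y" if "y \<in> interior S" for y
      using cw[OF \<open>S \<in> \<sigma>\<close>, of y] that interior_subset by (metis subsetD)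
  qed (use that in auto)
  have ex: "\<exists>S\<in>\<sigma>. x \<in> interior S" if "x \<in> \<Omega> - N" for x
    using that closure_subset[of \<Omega>] by (auto simp: N_def)
  define P where "P x = (\<Sum>S\<in>\<sigma>. indicat_real (interior S) x *\<^sub>R w S)" for x
  have P: "grad F x = P x" if x: "x \<in> \<Omega> - N" for x
  proof -
    obtain S where S: "S \<in> \<sigma>" "x \<in> interior S" using ex[OF x] by blast
    have "P x = (\<Sum>S'\<in>\<sigma>. if S' = S then w S else 0)"
      unfolding P_def
    proof (rule sum.cong[OF refl])
      fix S' assume S': "S' \<in> \<sigma>"
      show "indicat_real (interior S') x *\<^sub>R w S' = (if S' = S then w S else 0)"
        using triangulation_interior_disjoint[OF tri S' S(1)] S interior_subset by (auto simp: indicator_def)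
    qed
    then show ?thesis using grad_eq[OF gd[OF S]] S(1) t(1) by simp
  qed
  show thesis
  proof (rule that[of N L])
    show "negligible N" by (rule N)
    show "GDERIV F x :> grad F x" if x: "x \<in> \<Omega> - N" for x
    proof -
      obtain S where S: "S \<in> \<sigma>" "x \<in> interior S" using ex[OF x] by blast
      then show ?thesis using gd[OF S] grad_eq by metis
    qed
    show "norm (grad F x) \<le> L" if x: "x \<in> \<Omega> - N" for x
    proof -
      obtain S where S: "S \<in> \<sigma>" "x \<in> interior S" using ex[OF x] by blast
      then show ?thesis using grad_eq[OF gd[OF S]] wL by simp
    qed
    have "P \<in> borel_measurable lebesgue"
      unfolding P_def by (intro borel_measurable_sum borel_measurable_scaleR borel_measurable_indicator borel_measurable_const) simp
    then show "grad F \<in> borel_measurable (lebesgue_on \<Omega>)"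
      using dom by (intro borel_measurable_lebesgue_on_spike[OF measurable_lebesgue_on_lebesgue _ N P])
        (auto simp: polygonal_domain_def)
    fix K assume K: "convex K" "K \<subseteq> closure \<Omega>"
    show "L-lipschitz_on K F"
    proof (rule lipschitz_onI[OF _ L0])
      fix x y assume xy: "x \<in> K" "y \<in> K"
      have sub: "linepath x y ` {0..1} \<subseteq> closure \<Omega>"
        using K xy closed_segment_subset by (metis linepath_image_01 order_trans)
      define U where "U S = {0..1} \<inter> linepath x y -` S" for S
      have "(L * dist x y)-lipschitz_on {0..1} (\<lambda>s. F (linepath x y s))"
      proof (rule lipschitz_on_closed_Union[where I = \<sigma> and U = U])
        fix S assume S: "S \<in> \<sigma>"
        show "closed (U S)"
          unfolding U_def by (intro continuous_closed_preimage continuous_intros triangleD(3)[OF t(2)[OF S]] closed_real_atLeastAtMost)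
        show "(L * dist x y)-lipschitz_on (U S) (\<lambda>s. F (linepath x y s))"
        proof (rule lipschitz_onI)
          fix s r assume "s \<in> U S" "r \<in> U S"
          then have "F (linepath x y s) - F (linepath x y r) = w S \<bullet> (linepath x y s - linepath x y r)"
            using cw[OF S] by (simp add: U_def inner_diff_right)
          also have "linepath x y s - linepath x y r = (s - r) *\<^sub>R (y - x)" by (simp add: linepath_def algebra_simps)
          finally have "\<bar>F (linepath x y s) - F (linepath x y r)\<bar> \<le> norm (w S) * norm ((s - r) *\<^sub>R (y - x))"
            using Cauchy_Schwarz_ineq2[of "w S" "(s - r) *\<^sub>R (y - x)"] by simp
          also have "\<dots> \<le> L * norm ((s - r) *\<^sub>R (y - x))" by (intro mult_right_mono wL[OF S]) simp
          finally show "dist (F (linepath x y s)) (F (linepath x y r)) \<le> L * dist x y * dist s r"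
            by (simp add: dist_real_def dist_norm norm_minus_commute mult_ac)
        qed (use L0 in simp)
      next
        show "{0..1} \<subseteq> (\<Union>S\<in>\<sigma>. U S)" using sub t(3) by (fastforce simp: U_def)
      qed (use t(1) L0 in auto)
      from lipschitz_onD[OF this, of 0 1] show "dist (F x) (F y) \<le> L * dist x y"
        by (simp add: linepath_def)
    qed
  qed
qed

text \<open>Cauchy-Schwarz for the vectors (1, q) and (1, p). The left side, as a function of
  \<open>p\<close>, is the tangent plane of the area integrand at \<open>q\<close>.\<close>

lemma area_integrand_minorant:
  fixes p q :: "'a::real_inner"
  shows "(1 + q \<bullet> p) / sqrt (1 + (norm q)\<^sup>2) \<le> sqrt (1 + (norm p)\<^sup>2)"
proof -
  have "(1::real, q) \<bullet> (1, p) \<le> norm (1::real, q) * norm (1::real, p)" by (rule norm_cauchy_schwarz)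
  then have "1 + q \<bullet> p \<le> sqrt (1 + (norm p)\<^sup>2) * sqrt (1 + (norm q)\<^sup>2)" by (simp add: norm_Pair mult.commute)
  moreover have "sqrt (1 + (norm q)\<^sup>2) > 0" by (simp add: add_pos_nonneg)
  ultimately show ?thesis by (simp add: divide_le_eq)
qed

lemma integrable_area_integrand:
  fixes D :: "real^2 \<Rightarrow> real^2"
  assumes "S \<in> lmeasurable" "D \<in> borel_measurable (lebesgue_on S)" "AE x in lebesgue_on S. norm (D x) \<le> L"
  shows "integrable (lebesgue_on S) (\<lambda>x. sqrt (1 + (norm (D x))\<^sup>2))"
proof (rule integrable_lebesgue_on_bounded[OF assms(1), where B = "1 + L"])
  show "(\<lambda>x. sqrt (1 + (norm (D x))\<^sup>2)) \<in> borel_measurable (lebesgue_on S)"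
    using assms(2) by measurable
  have "sqrt (1 + (norm p)\<^sup>2) \<le> 1 + norm p" for p :: "real^2"
    using sqrt_one_plus_lipschitz[of p 0] by simp
  then have b: "norm (sqrt (1 + (norm p)\<^sup>2)) \<le> 1 + norm p" for p :: "real^2"
    by (simp add: abs_of_nonneg add_nonneg_nonneg)
  show "AE x in lebesgue_on S. norm (sqrt (1 + (norm (D x))\<^sup>2)) \<le> 1 + L"
    using assms(3)
  proof eventually_elim
    case (elim x)
    show ?case using b[of "D x"] elim by linarith
  qed
qed

context
  fixes \<Omega> :: "(real^2) set" and g :: "real^2 \<Rightarrow> real" and G :: "real^2 \<Rightarrow> real^2"
    and F :: "nat \<Rightarrow> real^2 \<Rightarrow> real" and \<sigma> :: "nat \<Rightarrow> (real^2) set set" and M :: real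
  assumes dom: "polygonal_domain \<Omega>" and bnd: "bounded \<Omega>"
    and tri: "\<And>n. triangulation_of \<Omega> (\<sigma> n)"
    and F: "\<And>n. continuous_on (closure \<Omega>) (F n)" "\<And>n. piecewise_affine (\<sigma> n) (F n)"
    and lim: "uniform_limit (closure \<Omega>) F g sequentially"
    and wg: "weak_gradient \<Omega> g G"
    and Gm: "G \<in> borel_measurable lebesgue" and GM: "\<And>x. norm (G x) \<le> M"
begin

lemma open_bounded_domain: "open \<Omega>" "\<Omega> \<in> lmeasurable" "\<Omega> \<in> sets lebesgue" "compact (closure \<Omega>)"
  using dom bnd by (auto simp: polygonal_domain_def lmeasurable_open)

lemma limit_continuous: "continuous_on (closure \<Omega>) g"
  by (rule uniform_limit_theorem[OF _ lim]) (use F(1) in auto)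

lemma area_integrand_integrable:
  "S \<subseteq> \<Omega> \<Longrightarrow> S \<in> sets lebesgue \<Longrightarrow> integrable (lebesgue_on S) (\<lambda>x. sqrt (1 + (norm (grad (F n) x))\<^sup>2))"
proof -
  assume S: "S \<subseteq> \<Omega>" "S \<in> sets lebesgue"
  obtain L N where N: "negligible N" "\<And>x. x \<in> \<Omega> - N \<Longrightarrow> norm (grad (F n) x) \<le> L" "grad (F n) \<in> borel_measurable (lebesgue_on \<Omega>)"
    by (rule piecewise_affine_gradient[OF dom bnd tri[of n] F(1) F(2)]) (rule that)
  have "integrable (lebesgue_on \<Omega>) (\<lambda>x. sqrt (1 + (norm (grad (F n) x))\<^sup>2))"
    by (rule integrable_area_integrand[OF open_bounded_domain(2) N(3)])
       (rule AE_lebesgue_onI[OF N(1) open_bounded_domain(3)], rule N(2))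
  then show ?thesis by (rule integrable_lebesgue_on_subset[OF _ S open_bounded_domain(3)])
qed

text \<open>Integration by parts moves the derivative to \<phi>, where the uniform convergence of
  \<open>F n\<close> suffices; the gradients of \<open>F n\<close> need no common bound.\<close>

lemma tested_gradient_tendsto:
  assumes K: "2 simplex K" "interior K \<subseteq> \<Omega>" and \<phi>: "test_function (interior K) \<phi>"
  shows "(\<lambda>n. LINT x|lebesgue_on (interior K). \<phi> x *\<^sub>R grad (F n) x) \<longlonglongrightarrow> (LINT x|lebesgue_on (interior K). \<phi> x *\<^sub>R G x)"
    "integrable (lebesgue_on (interior K)) (\<lambda>x. \<phi> x *\<^sub>R grad (F n) x)"
proof -
  let ?U = "interior K"
  note TK = triangleD[OF K(1)]
  have Kcl: "K \<subseteq> closure \<Omega>" using TK(5) K(2) closure_mono by metis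
  have C1: "C1 \<phi>" using \<phi> by (simp add: test_function_def)
  have \<phi>0: "\<phi> x = 0" "grad \<phi> x = 0" if "x \<notin> K" for x
    using test_function_vanishes[OF \<phi>, of x] that interior_subset by blast+
  obtain L' B' where \<phi>L: "L'-lipschitz_on UNIV \<phi>" "\<And>x. \<bar>\<phi> x\<bar> \<le> B'" "0 \<le> B'" "\<And>x. norm (grad \<phi> x) \<le> L'"
    by (rule C1_compact_support_lipschitz[OF C1 TK(1) \<phi>0]) (assumption, assumption, rule that)
  have m\<phi>: "\<phi> \<in> borel_measurable (lebesgue_on ?U)" "grad \<phi> \<in> borel_measurable (lebesgue_on ?U)"
    using C1_continuous[OF C1] C1_obtain[OF C1] by (auto intro!: measurable_lebesgue_on_lebesgue continuous_imp_measurable_lebesgue)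
  note mU = measure_triangle(2)[OF K(1)]
  have mU': "?U \<in> sets lebesgue" by simp
  have int_test: "integrable (lebesgue_on ?U) (\<lambda>x. h x *\<^sub>R grad \<phi> x)" if h: "continuous_on (closure \<Omega>) h" for h :: "real^2 \<Rightarrow> real"
  proof -
    have "bounded (h ` K)" using TK(1) continuous_on_subset[OF h Kcl] by (intro compact_imp_bounded compact_continuous_image)
    then obtain B where B: "\<And>x. x \<in> K \<Longrightarrow> \<bar>h x\<bar> \<le> B" by (auto simp: bounded_iff)
    have "h \<in> borel_measurable (lebesgue_on ?U)"
      using continuous_on_subset[OF h] Kcl interior_subset[of K] by (intro continuous_imp_measurable_on_sets_lebesgue) auto
    then show ?thesis
      using m\<phi> B \<phi>L(4) subsetD[OF interior_subset[of K]]
      by (intro integrable_lebesgue_on_bounded[OF mU, where B = "B * L'"] borel_measurable_scaleR AE_lebesgue_onI[of "{}"])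
         (auto intro!: mult_mono order_trans[OF abs_ge_zero B])
  qed
  have parts: "integrable (lebesgue_on ?U) (\<lambda>x. \<phi> x *\<^sub>R grad (F n) x) \<and>
     (LINT x|lebesgue_on ?U. F n x *\<^sub>R grad \<phi> x) = - (LINT x|lebesgue_on ?U. \<phi> x *\<^sub>R grad (F n) x)" for n
  proof -
    obtain L N where N: "negligible N" "\<And>x. x \<in> \<Omega> - N \<Longrightarrow> GDERIV (F n) x :> grad (F n) x"
      "\<And>x. x \<in> \<Omega> - N \<Longrightarrow> norm (grad (F n) x) \<le> L" "grad (F n) \<in> borel_measurable (lebesgue_on \<Omega>)"
      "\<And>K. convex K \<Longrightarrow> K \<subseteq> closure \<Omega> \<Longrightarrow> L-lipschitz_on K (F n)"
      by (rule piecewise_affine_gradient[OF dom bnd tri[of n] F(1) F(2)]) (rule that)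
    have m: "grad (F n) \<in> borel_measurable (lebesgue_on ?U)" using N(4) K(2) by (rule measurable_restrict_mono)
    have "weak_gradient ?U (F n) (grad (F n))"
      by (rule weak_gradient_of_lipschitz[OF K(1) N(5)[OF TK(2) Kcl] N(1) _ m, where M = L]) (use N(2,3) K(2) in blast)+
    moreover have "integrable (lebesgue_on ?U) (\<lambda>x. \<phi> x *\<^sub>R grad (F n) x)"
      using m m\<phi> \<phi>L(2,3) N(3) K(2)
      by (intro integrable_lebesgue_on_bounded[OF mU, where B = "B' * L"] borel_measurable_scaleR AE_lebesgue_onI[OF N(1) mU'])
         (auto intro!: mult_mono)
    ultimately show ?thesis using \<phi> by (simp add: weak_gradient_def)
  qed
  show "integrable (lebesgue_on ?U) (\<lambda>x. \<phi> x *\<^sub>R grad (F n) x)" using parts by blast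
  have wK: "(LINT x|lebesgue_on ?U. g x *\<^sub>R grad \<phi> x) = - (LINT x|lebesgue_on ?U. \<phi> x *\<^sub>R G x)"
    using weak_gradient_mono[OF wg K(2) mU' open_bounded_domain(3)] \<phi> by (simp add: weak_gradient_def)
  have "(\<lambda>n. LINT x|lebesgue_on ?U. F n x *\<^sub>R grad \<phi> x) \<longlonglongrightarrow> (LINT x|lebesgue_on ?U. g x *\<^sub>R grad \<phi> x)"
  proof (rule tendstoI)
    fix e :: real assume e: "e > 0"
    define c where "c = L' * measure lebesgue ?U"
    have L'0: "L' \<ge> 0" using \<phi>L(1) by (rule lipschitz_on_nonneg)
    have c0: "c \<ge> 0" unfolding c_def using L'0 by simp
    have "\<forall>\<^sub>F n in sequentially. \<forall>x\<in>closure \<Omega>. dist (F n x) (g x) < e / (c + 1)"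
      by (rule uniform_limitD[OF lim]) (use e c0 in simp)
    then show "\<forall>\<^sub>F n in sequentially. dist (LINT x|lebesgue_on ?U. F n x *\<^sub>R grad \<phi> x) (LINT x|lebesgue_on ?U. g x *\<^sub>R grad \<phi> x) < e"
    proof eventually_elim
      case (elim n)
      note i1 = int_test[OF F(1)[of n]] and i2 = int_test[OF limit_continuous]
      have ic: "integrable (lebesgue_on ?U) (\<lambda>x. e / (c + 1) * L')"
        by (rule integrable_lebesgue_on_bounded[OF mU, where B = "\<bar>e / (c + 1) * L'\<bar>"]) auto
      have "dist (LINT x|lebesgue_on ?U. F n x *\<^sub>R grad \<phi> x) (LINT x|lebesgue_on ?U. g x *\<^sub>R grad \<phi> x)
        = norm (LINT x|lebesgue_on ?U. F n x *\<^sub>R grad \<phi> x - g x *\<^sub>R grad \<phi> x)"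
        using i1 i2 by (simp add: dist_norm)
      also have "\<dots> \<le> (LINT x|lebesgue_on ?U. e / (c + 1) * L')"
      proof (rule order_trans[OF integral_norm_bound], rule integral_mono[OF _ ic])
        show "integrable (lebesgue_on ?U) (\<lambda>x. norm (F n x *\<^sub>R grad \<phi> x - g x *\<^sub>R grad \<phi> x))" using i1 i2 by simp
        fix x assume "x \<in> space (lebesgue_on ?U)"
        then have "x \<in> closure \<Omega>" using Kcl interior_subset[of K] by (auto simp: space_restrict_space)
        then have "\<bar>F n x - g x\<bar> \<le> e / (c + 1)" using elim by (auto simp: dist_real_def intro: less_imp_le)
        then show "norm (F n x *\<^sub>R grad \<phi> x - g x *\<^sub>R grad \<phi> x) \<le> e / (c + 1) * L'"
          unfolding scaleR_diff_left[symmetric] norm_scaleR using \<phi>L(4)[of x] e c0 by (intro mult_mono) auto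
      qed
      also have "\<dots> = e / (c + 1) * c" using mU by (simp add: measure_restrict_space c_def)
      also have "\<dots> < e" using e c0 by (simp add: field_simps)
      finally show ?case .
    qed
  qed
  then have "(\<lambda>n. - (LINT x|lebesgue_on ?U. \<phi> x *\<^sub>R grad (F n) x)) \<longlonglongrightarrow> - (LINT x|lebesgue_on ?U. \<phi> x *\<^sub>R G x)"
    using parts wK by simp
  then show "(\<lambda>n. LINT x|lebesgue_on ?U. \<phi> x *\<^sub>R grad (F n) x) \<longlonglongrightarrow> (LINT x|lebesgue_on ?U. \<phi> x *\<^sub>R G x)"
    by (simp add: tendsto_minus_cancel_left)
qed

text \<open>Jensen's inequality on each triangle, in the form of the tangent plane minorant at the mean
  gradient, which is stable under uniform convergence after testing with a cutoff.\<close>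
lemma liminf_area_ge_mean_gradients:
  assumes \<tau>: "triangulation_of \<Omega> \<tau>"
  shows "ereal (\<Sum>K\<in>\<tau>. measure lebesgue K * sqrt (1 + (norm ((LINT x|lebesgue_on (interior K). G x) /\<^sub>R measure lebesgue K))\<^sup>2))
     \<le> liminf (\<lambda>n. ereal (elementary_area \<Omega> (F n)))"
proof -
  note t = triangulation_ofD[OF \<tau>]
  define q where "q K = (LINT x|lebesgue_on (interior K). G x) /\<^sub>R measure lebesgue K" for K
  define s where "s K = sqrt (1 + (norm (q K))\<^sup>2)" for K
  have s1: "s K \<noteq> 0" "s K * s K = 1 + (norm (q K))\<^sup>2" "s K > 0" for K by (auto simp: s_def add_pos_nonneg add_nonneg_eq_0_iff)
  have iU: "interior K \<subseteq> \<Omega>" if "K \<in> \<tau>" for K by (rule triangle_interior_subset[OF dom \<tau> that])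
  have "\<exists>\<phi>. (\<forall>n::nat. test_function (interior K) (\<phi> n)) \<and> (\<forall>n x. 0 \<le> \<phi> n x) \<and> (\<forall>n x. \<phi> n x \<le> 1) \<and>
      (\<forall>x\<in>interior K. (\<lambda>n. \<phi> n x) \<longlonglongrightarrow> 1)" if "K \<in> \<tau>" for K
  proof -
    obtain \<psi> where "\<And>n::nat. test_function (interior K) (\<psi> n)" "\<And>n x. 0 \<le> \<psi> n x" "\<And>n x. \<psi> n x \<le> 1"
      "\<And>x. x \<in> interior K \<Longrightarrow> (\<lambda>n. \<psi> n x) \<longlonglongrightarrow> 1"
      by (rule cutoff_sequence[OF open_interior bounded_interior[OF triangleD(6)[OF t(2)[OF \<open>K \<in> \<tau>\<close>]]]]) (rule that)
    then show ?thesis by (intro exI[of _ \<psi>]) simp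
  qed
  then obtain \<phi> where \<phi>: "\<And>K n. K \<in> \<tau> \<Longrightarrow> test_function (interior K) (\<phi> K n)" "\<And>K n x. K \<in> \<tau> \<Longrightarrow> 0 \<le> \<phi> K n x"
      "\<And>K n x. K \<in> \<tau> \<Longrightarrow> \<phi> K n x \<le> 1" "\<And>K x. K \<in> \<tau> \<Longrightarrow> x \<in> interior K \<Longrightarrow> (\<lambda>n::nat. \<phi> K n x) \<longlonglongrightarrow> 1"
    by metis
  have i1: "integrable (lebesgue_on (interior K)) (\<phi> K j)" if K: "K \<in> \<tau>" for K j
    using \<phi>(1)[OF K, of j] \<phi>(2,3)[OF K] C1_continuous measure_triangle(2)[OF t(2)[OF K]]
    by (intro integrable_lebesgue_on_bounded[where B = 1])
       (auto simp: test_function_def intro!: measurable_lebesgue_on_lebesgue continuous_imp_measurable_lebesgue)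
  \<comment> \<open>The tangent planes at the means \<open>q K\<close>, weighted with the cutoffs
    number \<open>j\<close> and evaluated at the limit gradient \<open>G\<close>; \<open>a n\<close>
    below is the same expression for the gradient of \<open>F n\<close>.\<close>
  define b where "b j = (\<Sum>K\<in>\<tau>. ((LINT x|lebesgue_on (interior K). \<phi> K j x) + q K \<bullet> (LINT x|lebesgue_on (interior K). \<phi> K j x *\<^sub>R G x)) / s K)" for j
  have b_le: "ereal (b j) \<le> liminf (\<lambda>n. ereal (elementary_area \<Omega> (F n)))" for j
  proof -
    define a where "a n = (\<Sum>K\<in>\<tau>. ((LINT x|lebesgue_on (interior K). \<phi> K j x) + q K \<bullet> (LINT x|lebesgue_on (interior K). \<phi> K j x *\<^sub>R grad (F n) x)) / s K)" for n
    have "a \<longlonglongrightarrow> b j"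
      unfolding a_def b_def using tested_gradient_tendsto(1)[OF t(2) iU \<phi>(1)] s1
      by (intro tendsto_sum tendsto_divide tendsto_add tendsto_inner tendsto_const) auto
    then have "(\<lambda>n. ereal (a n)) \<longlonglongrightarrow> ereal (b j)" by simp
    then have "ereal (b j) = liminf (\<lambda>n. ereal (a n))" by (metis lim_imp_Liminf trivial_limit_sequentially)
    also have "\<dots> \<le> liminf (\<lambda>n. ereal (elementary_area \<Omega> (F n)))"
    proof (rule Liminf_mono, intro always_eventually allI)
      fix n
      let ?A = "\<lambda>x. sqrt (1 + (norm (grad (F n) x))\<^sup>2)"
      have "a n \<le> (\<Sum>K\<in>\<tau>. LINT x|lebesgue_on (interior K). ?A x)"
        unfolding a_def
      proof (rule sum_mono)
        fix K assume K: "K \<in> \<tau>"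
        note i2 = tested_gradient_tendsto(2)[OF t(2)[OF K] iU[OF K] \<phi>(1)[OF K, of j], of n]
        have "((LINT x|lebesgue_on (interior K). \<phi> K j x) + q K \<bullet> (LINT x|lebesgue_on (interior K). \<phi> K j x *\<^sub>R grad (F n) x)) / s K
          = (LINT x|lebesgue_on (interior K). (\<phi> K j x + q K \<bullet> (\<phi> K j x *\<^sub>R grad (F n) x)) / s K)"
          using i1[OF K, of j] i2 integrable_inner_right[OF i2, of "q K"] integral_inner_right[of "q K", OF i2]
          by (simp del: inner_scaleR_right)
        also have "\<dots> \<le> (LINT x|lebesgue_on (interior K). ?A x)"
        proof (rule integral_mono)
          show "integrable (lebesgue_on (interior K)) (\<lambda>x. (\<phi> K j x + q K \<bullet> (\<phi> K j x *\<^sub>R grad (F n) x)) / s K)"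
            using i1[OF K, of j] integrable_inner_right[OF i2, of "q K"] by (intro integrable_divide Bochner_Integration.integrable_add)
          show "integrable (lebesgue_on (interior K)) ?A" by (rule area_integrand_integrable[OF iU[OF K]]) simp
          fix x
          \<comment> \<open>The minorant may be negative, so it is compared with the integrand first
            and the cutoff is dropped afterwards.\<close>
          have "(\<phi> K j x + q K \<bullet> (\<phi> K j x *\<^sub>R grad (F n) x)) / s K = \<phi> K j x * ((1 + q K \<bullet> grad (F n) x) / s K)"
            by (simp add: algebra_simps add_divide_distrib)
          also have "\<dots> \<le> \<phi> K j x * ?A x"
            using area_integrand_minorant[of "q K" "grad (F n) x"] \<phi>(2)[OF K] unfolding s_def by (intro mult_left_mono) auto
          also have "\<dots> \<le> 1 * ?A x" using \<phi>(3)[OF K] by (intro mult_right_mono) auto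
          finally show "(\<phi> K j x + q K \<bullet> (\<phi> K j x *\<^sub>R grad (F n) x)) / s K \<le> ?A x" by simp
        qed
        finally show "((LINT x|lebesgue_on (interior K). \<phi> K j x) + q K \<bullet> (LINT x|lebesgue_on (interior K). \<phi> K j x *\<^sub>R grad (F n) x)) / s K
          \<le> (LINT x|lebesgue_on (interior K). ?A x)" .
      qed
      also have "\<dots> = (LINT x|lebesgue_on \<Omega>. ?A x)"
      proof (rule integral_lebesgue_on_partition[symmetric, OF area_integrand_integrable[OF order_refl] _ t(1)])
        show "negligible (\<Omega> - (\<Union>K\<in>\<tau>. interior K))"
          by (rule negligible_subset[OF triangulation_negligible_rest[OF \<tau>]]) (use closure_subset[of \<Omega>] in blast)
        show "interior K \<inter> interior K' = {}" if "K \<in> \<tau>" "K' \<in> \<tau>" "K \<noteq> K'" for K K'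
          using triangulation_interior_disjoint[OF \<tau> that] interior_subset[of K] by blast
      qed (use open_bounded_domain iU in auto)
      finally show "ereal (a n) \<le> ereal (elementary_area \<Omega> (F n))" by (simp add: elementary_area_def)
    qed
    finally show ?thesis .
  qed
  \<comment> \<open>When the cutoffs tend to 1, each tangent plane is evaluated at its own point of
    contact, where it equals the integrand.\<close>
  have "b \<longlonglongrightarrow> (\<Sum>K\<in>\<tau>. measure lebesgue K * s K)"
    unfolding b_def
  proof (rule tendsto_sum)
    fix K assume K: "K \<in> \<tau>"
    note mK = measure_triangle[OF t(2)[OF K]]
    have iG: "integrable (lebesgue_on (interior K)) G"
      using GM by (intro integrable_lebesgue_on_bounded[OF mK(2) measurable_lebesgue_on_lebesgue[OF Gm], where B = M]) simp
    have i1': "integrable (lebesgue_on (interior K)) (\<lambda>_. 1::real)"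
      by (rule integrable_lebesgue_on_bounded[OF mK(2), where B = 1]) auto
    have "(\<lambda>j. LINT x|lebesgue_on (interior K). \<phi> K j x *\<^sub>R (1::real)) \<longlonglongrightarrow> (LINT x|lebesgue_on (interior K). 1)"
      by (rule cutoff_integral_tendsto[OF \<phi>(1-3)[OF K] _ i1']) (rule \<phi>(4)[OF K])
    then have 1: "(\<lambda>j. LINT x|lebesgue_on (interior K). \<phi> K j x) \<longlonglongrightarrow> measure lebesgue K"
      using mK by (simp add: measure_restrict_space)
    have "(\<lambda>j. LINT x|lebesgue_on (interior K). \<phi> K j x *\<^sub>R G x) \<longlonglongrightarrow> (LINT x|lebesgue_on (interior K). G x)"
      by (rule cutoff_integral_tendsto[OF \<phi>(1-3)[OF K] _ iG]) (rule \<phi>(4)[OF K])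
    then have 2: "(\<lambda>j. LINT x|lebesgue_on (interior K). \<phi> K j x *\<^sub>R G x) \<longlonglongrightarrow> measure lebesgue K *\<^sub>R q K"
      using mK by (simp add: q_def)
    have "(\<lambda>j. ((LINT x|lebesgue_on (interior K). \<phi> K j x) + q K \<bullet> (LINT x|lebesgue_on (interior K). \<phi> K j x *\<^sub>R G x)) / s K)
        \<longlonglongrightarrow> (measure lebesgue K + q K \<bullet> (measure lebesgue K *\<^sub>R q K)) / s K"
      by (intro tendsto_intros 1 2 s1)
    also have "(measure lebesgue K + q K \<bullet> (measure lebesgue K *\<^sub>R q K)) / s K = measure lebesgue K * (s K * s K) / s K"
      unfolding s1(2) by (simp add: dot_square_norm algebra_simps)
    also have "\<dots> = measure lebesgue K * s K" using s1(1)[of K] by simp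
    finally show "(\<lambda>j. ((LINT x|lebesgue_on (interior K). \<phi> K j x) + q K \<bullet> (LINT x|lebesgue_on (interior K). \<phi> K j x *\<^sub>R G x)) / s K)
        \<longlonglongrightarrow> measure lebesgue K * s K" .
  qed
  then have "(\<lambda>j. ereal (b j)) \<longlonglongrightarrow> ereal (\<Sum>K\<in>\<tau>. measure lebesgue K * s K)" by simp
  then have "ereal (\<Sum>K\<in>\<tau>. measure lebesgue K * s K) \<le> liminf (\<lambda>n. ereal (elementary_area \<Omega> (F n)))"
    by (rule LIMSEQ_le_const2) (use b_le in blast)
  then show ?thesis by (simp only: s_def q_def)
qed

end

section \<open>Recovery sequence\<close>

text \<open>Continuous functions that agree at every point with one of finitely many affine functions:
  this form makes the closure under sums and maxima immediate, and hyperplane arrangements recover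
  the pieces.\<close>
definition pw_affine :: "('a::real_inner \<Rightarrow> real) \<Rightarrow> bool" where
  "pw_affine u \<longleftrightarrow> continuous_on UNIV u \<and> (\<exists>A. finite A \<and> (\<forall>x. \<exists>(c, w)\<in>A. u x = c + w \<bullet> x))"

lemma pw_affine_affine: "pw_affine (\<lambda>x. c + w \<bullet> x)"
  unfolding pw_affine_def by (auto intro!: continuous_intros exI[of _ "{(c, w)}"])

text \<open>Finite choices of affine functions for \<open>u\<close> and for \<open>v\<close> leave
  finitely many combinations, each of which \<open>f\<close> turns into another finite
  choice.\<close>

lemma pw_affine_comb:
  fixes u v :: "'a::real_inner \<Rightarrow> real"
  assumes "pw_affine u" "pw_affine v"
    and f: "\<And>c (w::'a) c' w'. \<exists>B. finite B \<and> (\<forall>x. \<exists>(d, z)\<in>B. f (c + w \<bullet> x) (c' + w' \<bullet> x) = d + z \<bullet> x)"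
    and cont: "continuous_on UNIV (\<lambda>x. f (u x) (v x))"
  shows "pw_affine (\<lambda>x. f (u x) (v x))"
proof -
  obtain A A' where A: "finite A" "\<And>x. \<exists>(c, w)\<in>A. u x = c + w \<bullet> x" and A': "finite A'" "\<And>x. \<exists>(c, w)\<in>A'. v x = c + w \<bullet> x"
    using assms(1,2) unfolding pw_affine_def by blast
  define B where "B c w c' w' = (SOME B. finite B \<and> (\<forall>x. \<exists>(d, z)\<in>B. f (c + w \<bullet> x) (c' + w' \<bullet> x) = d + z \<bullet> x))" for c c' and w w' :: 'a
  have B: "finite (B c w c' w')" "\<exists>(d, z)\<in>B c w c' w'. f (c + w \<bullet> x) (c' + w' \<bullet> x) = d + z \<bullet> x" for c c' and w w' x :: 'a
    using someI_ex[OF f, of c w c' w'] unfolding B_def by simp_all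
  define C where "C = (\<Union>(c, w)\<in>A. \<Union>(c', w')\<in>A'. B c w c' w')"
  have fin: "finite C" unfolding C_def using A(1) A'(1) B(1) by auto
  have sel: "\<exists>(d, z)\<in>C. f (u x) (v x) = d + z \<bullet> x" for x
  proof -
    obtain c w where cw: "(c, w) \<in> A" "u x = c + w \<bullet> x" using A(2)[of x] by blast
    obtain c' w' where cw': "(c', w') \<in> A'" "v x = c' + w' \<bullet> x" using A'(2)[of x] by blast
    obtain d z where dz: "(d, z) \<in> B c w c' w'" "f (c + w \<bullet> x) (c' + w' \<bullet> x) = d + z \<bullet> x" using B(2)[of c w c' w' x] by blast
    have "(d, z) \<in> C" unfolding C_def using cw(1) cw'(1) dz(1) by blast
    then show ?thesis using dz(2) cw(2) cw'(2) by auto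
  qed
  show ?thesis unfolding pw_affine_def by (intro conjI exI[of _ C] allI cont fin sel)
qed

lemma pw_affine_continuous: "pw_affine u \<Longrightarrow> continuous_on UNIV u"
  by (simp add: pw_affine_def)

lemma pw_affine_add: assumes "pw_affine u" "pw_affine v" shows "pw_affine (\<lambda>x. u x + v x)"
proof (rule pw_affine_comb[OF assms, where f = "(+)"])
  show "\<exists>B. finite B \<and> (\<forall>x. \<exists>(d, z)\<in>B. (c + w \<bullet> x) + (c' + w' \<bullet> x) = d + z \<bullet> x)" for c c' and w w' :: 'a
    by (rule exI[of _ "{(c + c', w + w')}"]) (simp add: inner_add_left)
qed (intro continuous_on_add assms[THEN pw_affine_continuous])

lemma pw_affine_max: assumes "pw_affine u" "pw_affine v" shows "pw_affine (\<lambda>x. max (u x) (v x))"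
proof (rule pw_affine_comb[OF assms, where f = max])
  show "\<exists>B. finite B \<and> (\<forall>x. \<exists>(d, z)\<in>B. max (c + w \<bullet> x) (c' + w' \<bullet> x) = d + z \<bullet> x)" for c c' and w w' :: 'a
    by (rule exI[of _ "{(c, w), (c', w')}"]) (simp add: max_def)
qed (intro continuous_on_max assms[THEN pw_affine_continuous])

lemma pw_affine_cmult: assumes "pw_affine u" shows "pw_affine (\<lambda>x. k * u x)"
proof (rule pw_affine_comb[OF assms assms, where f = "\<lambda>s t. k * s"])
  show "\<exists>B. finite B \<and> (\<forall>x. \<exists>(d, z)\<in>B. k * (c + w \<bullet> x) = d + z \<bullet> x)" for c and w :: 'a
    by (rule exI[of _ "{(k * c, k *\<^sub>R w)}"]) (simp add: distrib_left)
qed (intro continuous_on_mult_left assms[THEN pw_affine_continuous])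

lemma pw_affine_const: "pw_affine (\<lambda>x. c)"
  using pw_affine_affine[of c 0] by simp

lemma pw_affine_abs: assumes "pw_affine u" shows "pw_affine (\<lambda>x. \<bar>u x\<bar>)"
proof -
  have "\<bar>u x\<bar> = max (u x) ((-1) * u x)" for x by simp
  then show ?thesis using pw_affine_max[OF assms pw_affine_cmult[OF assms, of "-1"]] by presburger
qed

lemma pw_affine_diff: "pw_affine u \<Longrightarrow> pw_affine v \<Longrightarrow> pw_affine (\<lambda>x. u x - v x)"
  using pw_affine_add[of u "\<lambda>x. (-1) * v x"] pw_affine_cmult[of v "-1"] by simp

lemma pw_affine_sum: "finite I \<Longrightarrow> (\<And>i. i \<in> I \<Longrightarrow> pw_affine (u i)) \<Longrightarrow> pw_affine (\<lambda>x. \<Sum>i\<in>I. u i x)"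
  by (induction I rule: finite_induct) (auto intro: pw_affine_const pw_affine_add)

text \<open>From a relatively interior \<open>x\<close> the segment from \<open>y\<close> can be
  continued a little beyond \<open>x\<close> inside \<open>X\<close>; there the affine function has
  the opposite sign unless it vanishes at \<open>y\<close>.\<close>

lemma affine_one_sided_vanishes:
  fixes X :: "'a::euclidean_space set"
  assumes X: "convex X" "x \<in> rel_interior X" "y \<in> X"
    and d: "\<And>x y. x \<in> X \<Longrightarrow> y \<in> X \<Longrightarrow> (w \<bullet> x \<le> b \<and> w \<bullet> y \<le> b) \<or> (w \<bullet> x \<ge> b \<and> w \<bullet> y \<ge> b)"
    and "w \<bullet> x = b"
  shows "w \<bullet> y = b"
proof -
  obtain e where e: "e > 1" "(1 - e) *\<^sub>R y + e *\<^sub>R x \<in> X"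
    using convex_rel_interior_iff[OF X(1), of x] X by blast
  have "w \<bullet> ((1 - e) *\<^sub>R y + e *\<^sub>R x) - b = (1 - e) * (w \<bullet> y - b)"
    using assms(5) by (simp add: inner_add_right algebra_simps)
  then have "(w \<bullet> y - b \<le> 0 \<and> (1 - e) * (w \<bullet> y - b) \<le> 0) \<or> (w \<bullet> y - b \<ge> 0 \<and> (1 - e) * (w \<bullet> y - b) \<ge> 0)"
    using d[OF X(3) e(2)] by auto
  then show ?thesis using e(1) by (auto simp: mult_le_0_iff zero_le_mult_iff)
qed

text \<open>If two of the affine functions agree at a relatively interior point of \<open>X\<close>,
  the separation property makes them agree on all of \<open>X\<close>. Hence the set where
  \<open>u\<close> follows one of them and the set where it follows a different one are disjoint and
  closed in the connected relative interior.\<close>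

lemma selection_constant_on_cell:
  fixes u :: "'a::euclidean_space \<Rightarrow> real"
  assumes u: "continuous_on UNIV u" and A: "finite A" "\<And>x. \<exists>(c, w)\<in>A. u x = c + w \<bullet> x"
    and X: "convex X"
    and sep: "\<And>c w c' w' x y. (c, w) \<in> A \<Longrightarrow> (c', w') \<in> A \<Longrightarrow> x \<in> X \<Longrightarrow> y \<in> X \<Longrightarrow>
       ((w - w') \<bullet> x \<le> c' - c \<and> (w - w') \<bullet> y \<le> c' - c) \<or> ((w - w') \<bullet> x \<ge> c' - c \<and> (w - w') \<bullet> y \<ge> c' - c)"
  shows "\<exists>c w. \<forall>x\<in>X. u x = c + w \<bullet> x"
proof (cases "X = {}")
  case False
  let ?R = "rel_interior X"
  obtain x0 where x0: "x0 \<in> ?R" using False rel_interior_eq_empty[OF X] by blast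
  obtain c w where cw: "(c, w) \<in> A" "u x0 = c + w \<bullet> x0" using A(2)[of x0] by blast
  \<comment> \<open>Only functions that differ from the chosen one somewhere on \<open>X\<close>
    count as different.\<close>
  define B where "B = {(c', w')\<in>A. \<exists>y\<in>X. c' + w' \<bullet> y \<noteq> c + w \<bullet> y}"
  define T1 where "T1 = {x. u x = c + w \<bullet> x}"
  define T2 where "T2 = (\<Union>(c', w')\<in>B. {x. u x = c' + w' \<bullet> x})"
  have "closed T1" unfolding T1_def by (intro closed_Collect_eq u continuous_intros)
  moreover have "closed T2" unfolding T2_def
    using A(1) by (intro closed_UN) (auto simp: B_def split_def intro!: finite_subset[OF _ A(1)] closed_Collect_eq u continuous_intros)
  moreover have "?R \<subseteq> T1 \<union> T2"
  proof
    fix x assume x: "x \<in> ?R"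
    obtain c' w' where c': "(c', w') \<in> A" "u x = c' + w' \<bullet> x" using A(2)[of x] by blast
    show "x \<in> T1 \<union> T2"
    proof (cases "(c', w') \<in> B")
      case True
      then show ?thesis using c'(2) unfolding T2_def by blast
    next
      case False
      then have "c' + w' \<bullet> x = c + w \<bullet> x" using c'(1) x rel_interior_subset unfolding B_def by blast
      then show ?thesis using c'(2) by (simp add: T1_def)
    qed
  qed
  moreover have "T1 \<inter> T2 \<inter> ?R = {}"
  proof (rule ccontr)
    assume "T1 \<inter> T2 \<inter> ?R \<noteq> {}"
    then obtain x c' w' where x: "x \<in> ?R" "u x = c + w \<bullet> x" "u x = c' + w' \<bullet> x" "(c', w') \<in> B"
      unfolding T1_def T2_def by blast
    have c'A: "(c', w') \<in> A" using x(4) by (simp add: B_def)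
    obtain y where y: "y \<in> X" "c' + w' \<bullet> y \<noteq> c + w \<bullet> y" using x(4) unfolding B_def by blast
    have "(w - w') \<bullet> y = c' - c"
      by (rule affine_one_sided_vanishes[OF X x(1) y(1) sep[OF cw(1) c'A]]) (use x in \<open>simp_all add: inner_diff_left\<close>)
    then show False using y(2) by (simp add: inner_diff_left)
  qed
  moreover have "connected ?R" using convex_rel_interior[OF X] convex_connected by blast
  moreover have "T1 \<inter> ?R \<noteq> {}" using x0 cw(2) by (auto simp: T1_def)
  ultimately have "T2 \<inter> ?R = {}" unfolding connected_closed by blast
  then have "?R \<subseteq> T1" using \<open>?R \<subseteq> T1 \<union> T2\<close> by blast
  then have "closure ?R \<subseteq> T1" using \<open>closed T1\<close> by (simp add: closure_minimal)
  then have "X \<subseteq> T1" using convex_closure_rel_interior[OF X] closure_subset by blast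
  then show ?thesis unfolding T1_def by blast
qed simp

text \<open>The triangles are cut along all lines on which two of the selected affine functions
  agree, so that no cell crosses such a line. The cells are then subdivided into triangles below the
  prescribed diameter.\<close>

lemma pw_affine_triangulation:
  assumes dom: "polygonal_domain \<Omega>" and tri: "triangulation_of \<Omega> \<tau>" and u: "pw_affine u" and e: "e > 0"
  obtains \<sigma> where "triangulation_of \<Omega> \<sigma>" "fineness \<sigma> < e" "piecewise_affine \<sigma> u"
proof -
  note t = triangulation_ofD[OF tri]
  obtain A where A: "finite A" "\<And>x. \<exists>(c, w)\<in>A. u x = c + w \<bullet> x" and uc: "continuous_on UNIV u"
    using u unfolding pw_affine_def by blast
  define I where "I = (\<lambda>((c, w), (c', w')). (w - w', c' - c)) ` (A \<times> A)"
  have "finite I" unfolding I_def using A(1) by simp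
  have ad: "aff_dim X \<le> 2" for X :: "(real^2) set" using aff_dim_le_DIM[of X] by simp
  have "\<exists>\<G>. \<Union>\<G> = \<Union>\<tau> \<and> finite \<G> \<and> (\<forall>C\<in>\<G>. \<exists>D. D \<in> \<tau> \<and> C \<subseteq> D) \<and>
      (\<forall>C\<in>\<tau>. \<forall>x\<in>C. \<exists>D. D \<in> \<G> \<and> x \<in> D \<and> D \<subseteq> C) \<and> (\<forall>X\<in>\<G>. polytope X) \<and> (\<forall>X\<in>\<G>. aff_dim X \<le> 2) \<and>
      (\<forall>X\<in>\<G>. \<forall>Y\<in>\<G>. X \<inter> Y face_of X) \<and>
      (\<forall>X\<in>\<G>. \<forall>x\<in>X. \<forall>y\<in>X. \<forall>a b. (a,b) \<in> I \<longrightarrow> a \<bullet> x \<le> b \<and> a \<bullet> y \<le> b \<or> a \<bullet> x \<ge> b \<and> a \<bullet> y \<ge> b)"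
    by (rule cell_subdivision_lemma[OF t(1) _ ad t(4) \<open>finite I\<close>]) (use t(2) simplex_imp_polytope in blast)+
  then obtain \<G> where G: "\<Union>\<G> = \<Union>\<tau>" "finite \<G>" "\<forall>C\<in>\<G>. \<exists>D. D \<in> \<tau> \<and> C \<subseteq> D"
      "\<forall>C\<in>\<tau>. \<forall>x\<in>C. \<exists>D. D \<in> \<G> \<and> x \<in> D \<and> D \<subseteq> C" "\<forall>X\<in>\<G>. polytope X" "\<forall>X\<in>\<G>. aff_dim X \<le> 2"
      "\<forall>X\<in>\<G>. \<forall>Y\<in>\<G>. X \<inter> Y face_of X"
      "\<forall>X\<in>\<G>. \<forall>x\<in>X. \<forall>y\<in>X. \<forall>a b. (a,b) \<in> I \<longrightarrow> a \<bullet> x \<le> b \<and> a \<bullet> y \<le> b \<or> a \<bullet> x \<ge> b \<and> a \<bullet> y \<ge> b"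
    by (elim exE conjE) (rule that)
  have poly: "polytope X" if "X \<in> \<G>" for X using G(5) that by (rule bspec)
  have face: "X \<inter> Y face_of X" if "X \<in> \<G>" "Y \<in> \<G>" for X Y using G(7) that by simp
  \<comment> \<open>Cells of lower dimension are discarded. They form a null set, while the part of
    \<Omega> not covered by the remaining cells is open, hence empty.\<close>
  define \<H> where "\<H> = {C\<in>\<G>. aff_dim C = 2}"
  have \<H>fin: "finite \<H>" using G(2) by (simp add: \<H>_def)
  have \<H>cl: "closed (\<Union>\<H>)" using \<H>fin poly polytope_imp_compact compact_imp_closed by (auto simp: \<H>_def intro!: closed_Union)
  have "\<Omega> \<subseteq> \<Union>\<H>"
  proof -
    have "negligible (\<Union>(\<G> - \<H>))"
    proof (rule negligible_Union)
      show "finite (\<G> - \<H>)" using G(2) by simp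
      fix C assume C: "C \<in> \<G> - \<H>"
      then have "aff_dim C < 2" using ad[of C] by (auto simp: \<H>_def)
      then have "interior C = {}" using low_dim_interior[of C] by auto
      moreover have "convex C" "closed C" using C poly polytope_imp_convex polytope_imp_closed by auto
      ultimately show "negligible C"
        using negligible_convex_frontier[of C] by (simp add: frontier_def)
    qed
    moreover have "\<Omega> - \<Union>\<H> \<subseteq> \<Union>(\<G> - \<H>)" using closure_subset[of \<Omega>] t(3) G(1) by blast
    ultimately have "negligible (\<Omega> - \<Union>\<H>)" using negligible_subset by blast
    moreover have "open (\<Omega> - \<Union>\<H>)" using dom \<H>cl by (auto simp: polygonal_domain_def)
    ultimately show ?thesis using open_not_negligible by blast
  qed
  then have "closure \<Omega> \<subseteq> \<Union>\<H>" using \<H>cl by (simp add: closure_minimal)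
  then have \<H>U: "\<Union>\<H> = closure \<Omega>" using G(1) t(3) by (auto simp: \<H>_def)
  have hp: "C \<in> \<H> \<Longrightarrow> polytope C" and ha: "C \<in> \<H> \<Longrightarrow> aff_dim C = 2"
    and hf: "C \<in> \<H> \<Longrightarrow> C' \<in> \<H> \<Longrightarrow> C \<inter> C' face_of C" for C C'
    using poly face by (auto simp: \<H>_def)
  obtain \<T> where T: "triangulation \<T>" "\<And>k. k \<in> \<T> \<Longrightarrow> diameter k < e" "\<And>k. k \<in> \<T> \<Longrightarrow> aff_dim k = 2"
      "\<Union>\<T> = \<Union>\<H>" "\<And>k. k \<in> \<T> \<Longrightarrow> \<exists>C. C \<in> \<H> \<and> k \<subseteq> C"
    by (rule fine_triangular_subdivision_of_cell_complex[OF e \<H>fin, of 2]) (erule hp, erule ha, erule (1) hf, rule that)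
  show thesis
  proof (rule that[of \<T>])
    show "triangulation_of \<Omega> \<T>"
      unfolding triangulation_of_def
    proof (intro conjI ballI)
      fix K assume K: "K \<in> \<T>"
      then obtain n where "n simplex K" using T(1) unfolding triangulation_def by blast
      then show "2 simplex K" using aff_dim_simplex T(3)[OF K] by metis
    qed (use T \<H>U in auto)
    have "finite \<T>" using T(1) by (simp add: triangulation_def)
    moreover have "\<T> \<noteq> {}"
    proof
      assume "\<T> = {}"
      then have "closure \<Omega> = {}" using \<H>U T(4) by simp
      then show False using dom by (simp add: polygonal_domain_def)
    qed
    ultimately show "fineness \<T> < e" unfolding fineness_def using T(2) by auto
    show "piecewise_affine \<T> u"
      unfolding piecewise_affine_def
    proof
      fix K assume "K \<in> \<T>"
      then obtain C where C: "C \<in> \<H>" "K \<subseteq> C" using T(5) by blast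
      have CG: "C \<in> \<G>" using C(1) by (simp add: \<H>_def)
      have "\<exists>c w. \<forall>x\<in>C. u x = c + w \<bullet> x"
      proof (rule selection_constant_on_cell[OF uc A polytope_imp_convex[OF poly[OF CG]]])
        fix c w c' w' x y assume "(c, w) \<in> A" "(c', w') \<in> A" "x \<in> C" "y \<in> C"
        moreover have "(w - w', c' - c) \<in> I"
          unfolding I_def using calculation by (force intro!: image_eqI[of _ _ "((c, w), (c', w'))"])
        ultimately show "((w - w') \<bullet> x \<le> c' - c \<and> (w - w') \<bullet> y \<le> c' - c) \<or> ((w - w') \<bullet> x \<ge> c' - c \<and> (w - w') \<bullet> y \<ge> c' - c)"
          using G(8)[rule_format, OF CG, of x y "w - w'" "c' - c"] by simp
      qed
      then show "\<exists>c w. \<forall>x\<in>K. u x = c + w \<bullet> x" using C(2) by blast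
    qed
  qed
qed

text \<open>The hat function of the uniform triangulation with edges along the two axes and the diagonal.\<close>
definition hat :: "real^2 \<Rightarrow> real" where
  "hat v = max 0 (1 - max (max \<bar>v$1\<bar> \<bar>v$2\<bar>) \<bar>v$1 - v$2\<bar>)"

definition grid_node :: "real \<Rightarrow> int^2 \<Rightarrow> real^2" where
  "grid_node h m = (\<chi> r. h * of_int (m$r))"

definition grid_index :: "int \<Rightarrow> (int^2) set" where
  "grid_index N = {m. \<forall>r. \<bar>m$r\<bar> \<le> N}"

text \<open>Restricting to indices of modulus at most \<open>N\<close> keeps the sum finite; the
  errors are estimated only in cells whose nodes all belong to the index set.\<close>

definition grid_interp :: "real \<Rightarrow> int \<Rightarrow> (real^2 \<Rightarrow> real) \<Rightarrow> real^2 \<Rightarrow> real" where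
  "grid_interp h N \<phi> x = (\<Sum>m\<in>grid_index N. \<phi> (grid_node h m) * hat ((x - grid_node h m) /\<^sub>R h))"

lemma finite_grid_index: "finite (grid_index N)"
proof (rule finite_subset)
  show "grid_index N \<subseteq> (\<lambda>(a, b). \<chi> r. if r = 1 then a else b) ` ({-N..N} \<times> {-N..N})"
  proof
    fix m :: "int^2" assume "m \<in> grid_index N"
    then have "\<bar>m$1\<bar> \<le> N" "\<bar>m$2\<bar> \<le> N" by (simp_all add: grid_index_def)
    moreover have "m = (\<chi> r. if r = 1 then m$1 else m$2)" by (simp add: vec_eq_iff forall_2)
    ultimately show "m \<in> (\<lambda>(a, b). \<chi> r. if r = 1 then a else b) ` ({-N..N} \<times> {-N..N})"
      by (intro image_eqI[of _ _ "(m$1, m$2)"]) auto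
  qed
qed auto

lemma pw_affine_grid_interp: "pw_affine (grid_interp h N \<phi>)"
proof -
  have c: "pw_affine (\<lambda>x::real^2. ((x - z) /\<^sub>R h) $ r)" for z r
  proof -
    have "(\<lambda>x::real^2. ((x - z) /\<^sub>R h) $ r) = (\<lambda>x. - (z $ r) / h + (axis r 1 /\<^sub>R h) \<bullet> x)"
      by (simp add: fun_eq_iff inner_axis' field_simps)
    then show ?thesis by (simp only: pw_affine_affine)
  qed
  have "pw_affine (\<lambda>x. hat ((x - z) /\<^sub>R h))" for z
    unfolding hat_def by (intro pw_affine_max pw_affine_const pw_affine_diff pw_affine_abs c)
  then show ?thesis
    unfolding grid_interp_def by (intro pw_affine_sum finite_grid_index pw_affine_cmult)
qed

lemma two_indices: "(k::2) \<noteq> l \<Longrightarrow> (k = 1 \<and> l = 2) \<or> (k = 2 \<and> l = 1)"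
  using exhaust_2 by metis

text \<open>The hat is symmetric in the two axes, so both triangles of a grid square are treated at
  once by calling \<open>k\<close> the axis with the larger fractional part.\<close>

lemma hat_swap: "k \<noteq> l \<Longrightarrow> hat v = max 0 (1 - max (max \<bar>v$k\<bar> \<bar>v$l\<bar>) \<bar>v$k - v$l\<bar>)"
  using two_indices[of k l] by (auto simp: hat_def abs_minus_commute max.commute)

text \<open>The cell is the open triangle with nodes \<open>m0\<close>, \<open>m0 + axis k 1\<close>
  and \<open>m0 + axis k 1 + axis l 1\<close>, and the three values are the barycentric
  coordinates.\<close>

lemma hat_on_cell:
  fixes m m0 :: "int^2"
  assumes kl: "k \<noteq> l" and h: "h > 0"
    and \<alpha>: "\<alpha> = (y$k - grid_node h m0 $ k) / h" and \<beta>: "\<beta> = (y$l - grid_node h m0 $ l) / h"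
    and cell: "0 < \<beta>" "\<beta> < \<alpha>" "\<alpha> < 1"
  shows "hat ((y - grid_node h m) /\<^sub>R h) = (if m = m0 then 1 - \<alpha> else if m = m0 + axis k 1 then \<alpha> - \<beta>
    else if m = m0 + axis k 1 + axis l 1 then \<beta> else 0)"
proof -
  define a where "a = m0$k - m$k"
  define b where "b = m0$l - m$l"
  let ?v = "(y - grid_node h m) /\<^sub>R h"
  have vk: "?v $ k = \<alpha> + of_int a" using h by (simp add: \<alpha> a_def grid_node_def field_simps)
  have vl: "?v $ l = \<beta> + of_int b" using h by (simp add: \<beta> b_def grid_node_def field_simps)
  have hv: "hat ?v = max 0 (1 - max (max \<bar>\<alpha> + of_int a\<bar> \<bar>\<beta> + of_int b\<bar>) \<bar>(\<alpha> + of_int a) - (\<beta> + of_int b)\<bar>)"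
    unfolding hat_swap[OF kl] vk vl ..
  have meq: "m = m' \<longleftrightarrow> m$k = m'$k \<and> m$l = m'$l" for m' :: "int^2"
    using two_indices[OF kl] by (auto simp: vec_eq_iff forall_2)
  have ax: "axis k 1 $ k = (1::int)" "axis k 1 $ l = (0::int)" "axis l 1 $ k = (0::int)" "axis l 1 $ l = (1::int)"
    using kl by (auto simp: axis_def)
  have m0: "m = m0 \<longleftrightarrow> a = 0 \<and> b = 0" "m = m0 + axis k 1 \<longleftrightarrow> a = -1 \<and> b = 0"
    "m = m0 + axis k 1 + axis l 1 \<longleftrightarrow> a = -1 \<and> b = -1"
    unfolding meq by (auto simp: a_def b_def ax)
  \<comment> \<open>Offsets outside {-1, 0} put the node too far away. The last case is the fourth
    corner of the square, across the diagonal.\<close>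
  consider "a \<ge> 1" | "a \<le> -2" | "b \<ge> 1" | "b \<le> -2" | "a = 0" "b = 0" | "a = -1" "b = 0" | "a = -1" "b = -1" | "a = 0" "b = -1"
    by linarith
  then show ?thesis
  proof cases
    case 1
    then have "real_of_int a \<ge> 1" by simp
    then show ?thesis unfolding hv m0 using 1 cell by auto
  next
    case 2
    then have "real_of_int a \<le> -2" by simp
    then show ?thesis unfolding hv m0 using 2 cell by auto
  next
    case 3
    then have "real_of_int b \<ge> 1" by simp
    then show ?thesis unfolding hv m0 using 3 cell by auto
  next
    case 4
    then have "real_of_int b \<le> -2" by simp
    then show ?thesis unfolding hv m0 using 4 cell by auto
  qed (unfold hv m0, use cell in auto)
qed

lemma grid_interp_on_cell:
  fixes m0 :: "int^2"
  assumes kl: "k \<noteq> l" and h: "h > 0"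
    and \<alpha>: "\<alpha> = (y$k - grid_node h m0 $ k) / h" and \<beta>: "\<beta> = (y$l - grid_node h m0 $ l) / h"
    and cell: "0 < \<beta>" "\<beta> < \<alpha>" "\<alpha> < 1"
    and m0: "\<And>r. \<bar>m0$r\<bar> + 1 \<le> N"
  shows "grid_interp h N \<phi> y = \<phi> (grid_node h m0) * (1 - \<alpha>) + \<phi> (grid_node h (m0 + axis k 1)) * (\<alpha> - \<beta>)
     + \<phi> (grid_node h (m0 + axis k 1 + axis l 1)) * \<beta>"
proof -
  let ?m1 = "m0 + axis k 1" and ?m2 = "m0 + axis k 1 + axis l 1"
  let ?f = "\<lambda>m. \<phi> (grid_node h m) * hat ((y - grid_node h m) /\<^sub>R h)"
  note H = hat_on_cell[OF kl h \<alpha> \<beta> cell]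
  have "axis i 1 $ r = (if r = i then 1 else 0 :: int)" for i r :: 2
    by (auto simp: axis_def)
  \<comment> \<open>The spare 1 in the bound for \<open>m0\<close> admits the two other nodes of the
    cell.\<close>
  then have "\<bar>?m2 $ r\<bar> \<le> N" "\<bar>?m1 $ r\<bar> \<le> N" "\<bar>m0 $ r\<bar> \<le> N" for r
    using m0[of r] kl by auto
  then have sub: "{m0, ?m1, ?m2} \<subseteq> grid_index N" by (simp add: grid_index_def)
  have ne: "?m1 \<noteq> m0" "?m2 \<noteq> m0" "?m2 \<noteq> ?m1"
    using kl by (auto simp: vec_eq_iff axis_def)
  have "grid_interp h N \<phi> y = sum ?f {m0, ?m1, ?m2}"
    unfolding grid_interp_def
    by (rule sum.mono_neutral_right[OF finite_grid_index sub]) (simp add: H)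
  also have "\<dots> = ?f m0 + ?f ?m1 + ?f ?m2" using ne by simp
  also have "\<dots> = \<phi> (grid_node h m0) * (1 - \<alpha>) + \<phi> (grid_node h ?m1) * (\<alpha> - \<beta>) + \<phi> (grid_node h ?m2) * \<beta>"
    using ne by (simp add: H)
  finally show ?thesis .
qed

text \<open>The interpolant is a convex combination of the values at nodes within 2h of
  \<open>x\<close>. Two steps along the axes join the three nodes, so the components of its gradient
  are difference quotients of \<phi>.\<close>

lemma grid_interp_error_on_cell:
  fixes m0 :: "int^2" and x :: "real^2"
  assumes kl: "k \<noteq> l" and h: "h > 0" "2 * h \<le> 1"
    and cell: "0 < (x$l - grid_node h m0 $ l) / h" "(x$l - grid_node h m0 $ l) / h < (x$k - grid_node h m0 $ k) / h"
      "(x$k - grid_node h m0 $ k) / h < 1"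
    and m0: "\<And>r. \<bar>m0$r\<bar> + 1 \<le> N"
    and \<phi>: "\<And>x. GDERIV \<phi> x :> D x" "\<And>x. norm (D x) \<le> L"
    and D: "\<And>x y. norm (x - y) \<le> 1 \<Longrightarrow> norm (D x - D y) \<le> c * norm (x - y)"
  shows "\<bar>grid_interp h N \<phi> x - \<phi> x\<bar> \<le> L * (2 * h)"
    "\<exists>w. GDERIV (grid_interp h N \<phi>) x :> w \<and> norm (w - D x) \<le> c * (4 * h)"
proof -
  let ?p0 = "grid_node h m0" and ?p1 = "grid_node h (m0 + axis k 1)" and ?p2 = "grid_node h (m0 + axis k 1 + axis l 1)"
  define \<alpha> where "\<alpha> y = (y$k - ?p0$k) / h" for y :: "real^2"
  define \<beta> where "\<beta> y = (y$l - ?p0$l) / h" for y :: "real^2"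
  have p1: "?p1 = ?p0 + h *\<^sub>R axis k 1" by (auto simp: vec_eq_iff grid_node_def axis_def algebra_simps)
  have p2: "?p2 = ?p1 + h *\<^sub>R axis l 1" by (auto simp: vec_eq_iff grid_node_def axis_def algebra_simps)
  have cx: "0 < \<beta> x" "\<beta> x < \<alpha> x" "\<alpha> x < 1" using cell by (auto simp: \<alpha>_def \<beta>_def)
  have eq: "grid_interp h N \<phi> y = \<phi> ?p0 * (1 - \<alpha> y) + \<phi> ?p1 * (\<alpha> y - \<beta> y) + \<phi> ?p2 * \<beta> y"
    if "0 < \<beta> y" "\<beta> y < \<alpha> y" "\<alpha> y < 1" for y
    by (rule grid_interp_on_cell[OF kl h(1) \<alpha>_def \<beta>_def that m0])
  have x1: "?p0$k < x$k" "x$k < ?p0$k + h" "?p0$l < x$l" "x$l < ?p0$l + h"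
  proof -
    have "0 < \<alpha> x" "\<beta> x < 1" using cx by linarith+
    then show "?p0$k < x$k" "x$k < ?p0$k + h" "?p0$l < x$l" "x$l < ?p0$l + h"
      using cx(1,3) h(1) by (auto simp: \<alpha>_def \<beta>_def zero_less_divide_iff)
  qed
  have nr: "norm v \<le> 2 * h" if "\<bar>v$k\<bar> \<le> h" "\<bar>v$l\<bar> \<le> h" for v :: "real^2"
    using norm_le_l1_cart[of v] two_indices[OF kl] that by (auto simp: sum_2)
  have axn: "axis k 1 $ k = (1::real)" "axis k 1 $ l = (0::real)" "axis l 1 $ k = (0::real)" "axis l 1 $ l = (1::real)"
    using kl by (auto simp: axis_def)
  have n0: "norm (?p0 - x) \<le> 2 * h" using x1 by (intro nr) auto
  have n1: "norm (?p1 - x) \<le> 2 * h" unfolding p1 using x1 by (intro nr) (auto simp: axn)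
  have n2: "norm (?p2 - x) \<le> 2 * h" unfolding p2 p1 using x1 by (intro nr) (auto simp: axn)
  have L0: "L \<ge> 0" using \<phi>(2)[of 0] norm_ge_zero[of "D 0"] by linarith
  have c0: "c \<ge> 0"
    using order_trans[OF norm_ge_zero D[of "axis 1 1" 0]] by (simp add: norm_axis_1)
  have lipphi: "\<bar>\<phi> p - \<phi> x\<bar> \<le> L * (2 * h)" if "norm (p - x) \<le> 2 * h" for p
  proof -
    have "\<bar>\<phi> p - \<phi> x\<bar> \<le> L * norm (p - x)" by (rule GDERIV_bound[of UNIV]) (use \<phi> in auto)
    also have "\<dots> \<le> L * (2 * h)" using that L0 by (rule mult_left_mono)
    finally show ?thesis .
  qed
  have "grid_interp h N \<phi> x - \<phi> x = (\<phi> ?p0 - \<phi> x) * (1 - \<alpha> x) + (\<phi> ?p1 - \<phi> x) * (\<alpha> x - \<beta> x) + (\<phi> ?p2 - \<phi> x) * \<beta> x"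
    unfolding eq[OF cx] by (simp add: algebra_simps)
  also have "\<bar>\<dots>\<bar> \<le> \<bar>(\<phi> ?p0 - \<phi> x) * (1 - \<alpha> x)\<bar> + \<bar>(\<phi> ?p1 - \<phi> x) * (\<alpha> x - \<beta> x)\<bar> + \<bar>(\<phi> ?p2 - \<phi> x) * \<beta> x\<bar>"
    by linarith
  also have "\<dots> = \<bar>\<phi> ?p0 - \<phi> x\<bar> * (1 - \<alpha> x) + \<bar>\<phi> ?p1 - \<phi> x\<bar> * (\<alpha> x - \<beta> x) + \<bar>\<phi> ?p2 - \<phi> x\<bar> * \<beta> x"
    using cx by (simp add: abs_mult)
  also have "\<dots> \<le> (L * (2 * h)) * (1 - \<alpha> x) + (L * (2 * h)) * (\<alpha> x - \<beta> x) + (L * (2 * h)) * \<beta> x"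
    using cx by (intro add_mono mult_right_mono lipphi n0 n1 n2) auto
  also have "\<dots> = L * (2 * h)" by (simp add: algebra_simps)
  finally show "\<bar>grid_interp h N \<phi> x - \<phi> x\<bar> \<le> L * (2 * h)" .
  define w where "w = ((\<phi> ?p1 - \<phi> ?p0) / h) *\<^sub>R axis k 1 + ((\<phi> ?p2 - \<phi> ?p1) / h) *\<^sub>R (axis l 1 :: real^2)"
  have "GDERIV (grid_interp h N \<phi>) x :> w"
    unfolding gderiv_def
  proof (rule has_derivative_transform_within_open[where s = "{y. 0 < \<beta> y} \<inter> {y. \<beta> y < \<alpha> y} \<inter> {y. \<alpha> y < 1}"])
    let ?f = "\<lambda>y. (\<phi> ?p0 - ((\<phi> ?p1 - \<phi> ?p0) / h) * ?p0$k - ((\<phi> ?p2 - \<phi> ?p1) / h) * ?p0$l) + w \<bullet> y"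
    show "(?f has_derivative (\<lambda>h. h \<bullet> w)) (at x)" by (auto intro!: derivative_eq_intros simp: inner_commute)
    show "open ({y. 0 < \<beta> y} \<inter> {y. \<beta> y < \<alpha> y} \<inter> {y. \<alpha> y < 1})"
      unfolding \<alpha>_def \<beta>_def using h(1) by (intro open_Int open_Collect_less continuous_intros) auto
    show "x \<in> {y. 0 < \<beta> y} \<inter> {y. \<beta> y < \<alpha> y} \<inter> {y. \<alpha> y < 1}" using cx by simp
    fix y assume "y \<in> {y. 0 < \<beta> y} \<inter> {y. \<beta> y < \<alpha> y} \<inter> {y. \<alpha> y < 1}"
    then have "grid_interp h N \<phi> y = \<phi> ?p0 * (1 - \<alpha> y) + \<phi> ?p1 * (\<alpha> y - \<beta> y) + \<phi> ?p2 * \<beta> y" by (intro eq) auto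
    also have "\<dots> = \<phi> ?p0 + (\<phi> ?p1 - \<phi> ?p0) * \<alpha> y + (\<phi> ?p2 - \<phi> ?p1) * \<beta> y" by (simp add: algebra_simps)
    also have "\<dots> = ?f y"
      using h(1) by (simp add: w_def inner_add_left inner_axis' \<alpha>_def \<beta>_def field_simps)
    finally show "?f y = grid_interp h N \<phi> y" by simp
  qed
  moreover have "norm (w - D x) \<le> c * (4 * h)"
  proof -
    \<comment> \<open>Subtracting the linear function with gradient \<open>D x\<close> leaves a
      function whose gradient is at most \<open>c * (2 * h)\<close> on the ball of radius 2h;
      \<open>2 * h \<le> 1\<close> makes the bound for \<open>D\<close> applicable there.\<close>
    have slope: "\<bar>(\<phi> q - \<phi> p) / h - D x $ r\<bar> \<le> c * (2 * h)"
      if q: "q = p + h *\<^sub>R axis r 1" and n: "norm (p - x) \<le> 2 * h" "norm (q - x) \<le> 2 * h" for p q r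
    proof -
      have "\<bar>(\<phi> q - q \<bullet> D x) - (\<phi> p - p \<bullet> D x)\<bar> \<le> (c * (2 * h)) * norm (q - p)"
      proof (rule GDERIV_bound[of "cball x (2 * h)" _ "\<lambda>y. D y - D x"])
        fix z assume z: "z \<in> cball x (2 * h)"
        have "GDERIV (\<lambda>y. y \<bullet> D x) z :> D x" unfolding gderiv_def by (auto intro!: derivative_eq_intros)
        then show "GDERIV (\<lambda>y. \<phi> y - y \<bullet> D x) z :> D z - D x" using GDERIV_diff[OF \<phi>(1)] by blast
        have "norm (z - x) \<le> 2 * h" using z by (simp add: dist_norm norm_minus_commute)
        then have "norm (D z - D x) \<le> c * norm (z - x)" using h(2) by (intro D) simp
        also have "\<dots> \<le> c * (2 * h)" using \<open>norm (z - x) \<le> 2 * h\<close> c0 by (rule mult_left_mono)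
        finally show "norm (D z - D x) \<le> c * (2 * h)" .
      qed (use n in \<open>auto simp: dist_norm norm_minus_commute\<close>)
      moreover have "norm (q - p) = h" using h(1) by (simp add: q norm_axis_1)
      moreover have "(\<phi> q - q \<bullet> D x) - (\<phi> p - p \<bullet> D x) = h * ((\<phi> q - \<phi> p) / h - D x $ r)"
      proof -
        have "q \<bullet> D x = p \<bullet> D x + h * D x $ r" by (simp add: q inner_add_left inner_axis')
        moreover have "h * ((\<phi> q - \<phi> p) / h - D x $ r) = h * ((\<phi> q - \<phi> p) / h) - h * D x $ r"
          by (rule right_diff_distrib)
        moreover have "h * ((\<phi> q - \<phi> p) / h) = \<phi> q - \<phi> p" using h(1) by simp
        ultimately show ?thesis by linarith
      qed
      ultimately have "h * \<bar>(\<phi> q - \<phi> p) / h - D x $ r\<bar> \<le> h * (c * (2 * h))"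
        using h(1) by (simp add: abs_mult mult_ac)
      then show ?thesis using h(1) by simp
    qed
    have "norm (w - D x) \<le> \<bar>(w - D x)$k\<bar> + \<bar>(w - D x)$l\<bar>"
      using norm_le_l1_cart[of "w - D x"] two_indices[OF kl] by (auto simp: sum_2)
    also have "\<dots> \<le> c * (2 * h) + c * (2 * h)"
      using slope[OF p1 n0 n1] slope[OF p2 n1 n2] by (simp add: w_def axn)
    finally show ?thesis by simp
  qed
  ultimately show "\<exists>w. GDERIV (grid_interp h N \<phi>) x :> w \<and> norm (w - D x) \<le> c * (4 * h)" by blast
qed

lemma negligible_grid_lines:
  assumes "h > 0"
  shows "negligible {x::real^2. x$1 / h \<in> \<int> \<or> x$2 / h \<in> \<int> \<or> (x$1 - x$2) / h \<in> \<int>}"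
proof -
  have 1: "negligible {x::real^2. (a \<bullet> x) / h \<in> \<int>}" if "a \<noteq> 0" for a
  proof -
    have "{x::real^2. (a \<bullet> x) / h \<in> \<int>} = (\<Union>k::int. {x. a \<bullet> x = of_int k * h})"
      using assms by (auto simp: Ints_def field_simps)
    moreover have "negligible (\<Union>k::int. {x. a \<bullet> x = of_int k * h})"
      using that by (intro negligible_countable_Union) (auto intro!: negligible_hyperplane)
    ultimately show ?thesis by simp
  qed
  have "axis 1 1 - axis 2 1 \<noteq> (0::real^2)" by (simp add: vec_eq_iff forall_2 axis_def)
  then have "negligible ({x::real^2. (axis 1 1 \<bullet> x) / h \<in> \<int>} \<union> {x. (axis 2 1 \<bullet> x) / h \<in> \<int>} \<union> {x. ((axis 1 1 - axis 2 1) \<bullet> x) / h \<in> \<int>})"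
    by (intro negligible_Un 1) auto
  moreover have "{x::real^2. x$1 / h \<in> \<int> \<or> x$2 / h \<in> \<int> \<or> (x$1 - x$2) / h \<in> \<int>} =
    {x::real^2. (axis 1 1 \<bullet> x) / h \<in> \<int>} \<union> {x. (axis 2 1 \<bullet> x) / h \<in> \<int>} \<union> {x. ((axis 1 1 - axis 2 1) \<bullet> x) / h \<in> \<int>}"
    by (auto simp: inner_axis' inner_diff_left)
  ultimately show ?thesis by simp
qed

text \<open>Off the grid lines and diagonals the fractional parts of the two scaled coordinates are
  nonzero and distinct, so \<open>x\<close> lies in an open cell. The 2 in the bound for
  \<open>N\<close> leaves 1 for rounding and 1 for the neighbouring nodes.\<close>

lemma grid_interp_error:
  fixes x :: "real^2"
  assumes h: "h > 0" "2 * h \<le> 1" and N: "\<lceil>R / h\<rceil> + 2 \<le> N" and x: "norm x \<le> R"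
    and gen: "x \<notin> {x. x$1 / h \<in> \<int> \<or> x$2 / h \<in> \<int> \<or> (x$1 - x$2) / h \<in> \<int>}"
    and \<phi>: "\<And>x. GDERIV \<phi> x :> D x" "\<And>x. norm (D x) \<le> L"
    and D: "\<And>x y. norm (x - y) \<le> 1 \<Longrightarrow> norm (D x - D y) \<le> c * norm (x - y)"
  shows "\<bar>grid_interp h N \<phi> x - \<phi> x\<bar> \<le> L * (2 * h)"
    "\<exists>w. GDERIV (grid_interp h N \<phi>) x :> w \<and> norm (w - D x) \<le> c * (4 * h)"
proof -
  define m0 :: "int^2" where "m0 = (\<chi> r. \<lfloor>x$r / h\<rfloor>)"
  have fr: "(x$r - grid_node h m0 $ r) / h = frac (x$r / h)" for r
    using h(1) by (simp add: grid_node_def m0_def frac_def field_simps)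
  have m0N: "\<bar>m0$r\<bar> + 1 \<le> N" for r
  proof -
    have "\<bar>x$r\<bar> \<le> R" using component_le_norm_cart[of x r] x by linarith
    then have "\<bar>x$r / h\<bar> \<le> R / h" using h(1) by (simp add: abs_divide divide_right_mono)
    then have "\<bar>m0$r\<bar> \<le> \<lceil>R / h\<rceil> + 1" unfolding m0_def by (simp, linarith)
    then show ?thesis using N by linarith
  qed
  have pos: "0 < frac (x$r / h)" "frac (x$r / h) < 1" for r
  proof -
    have "x$r / h \<notin> \<int>" using gen exhaust_2[of r] by auto
    then show "0 < frac (x$r / h)" by (simp add: frac_gt_0_iff)
    show "frac (x$r / h) < 1" by (rule frac_lt_1)
  qed
  have "frac (x$1 / h) \<noteq> frac (x$2 / h)"
  proof
    assume "frac (x$1 / h) = frac (x$2 / h)"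
    then have "(x$1 - x$2) / h = of_int (\<lfloor>x$1 / h\<rfloor> - \<lfloor>x$2 / h\<rfloor>)"
      by (simp add: frac_def diff_divide_distrib)
    then show False using gen by (metis (mono_tags, lifting) Ints_of_int mem_Collect_eq)
  qed
  then consider "frac (x$2 / h) < frac (x$1 / h)" | "frac (x$1 / h) < frac (x$2 / h)" by linarith
  then have "\<exists>k l :: 2. k \<noteq> l \<and> frac (x$l / h) < frac (x$k / h)"
    by cases (metis two_indices zero_neq_one)+
  then obtain k l :: 2 where kl: "k \<noteq> l" "frac (x$l / h) < frac (x$k / h)" by blast
  note E = grid_interp_error_on_cell[OF kl(1) h, of x m0 N \<phi> D L c, unfolded fr, OF pos(1) kl(2) pos(2) m0N \<phi> D]
  show "\<bar>grid_interp h N \<phi> x - \<phi> x\<bar> \<le> L * (2 * h)" by (rule E(1))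
  show "\<exists>w. GDERIV (grid_interp h N \<phi>) x :> w \<and> norm (w - D x) \<le> c * (4 * h)" by (rule E(2))
qed

text \<open>The bound for the values extends from the dense open cells to the closure by continuity,
  while the bound for the gradients holds almost everywhere, which is enough for areas.\<close>

lemma pw_affine_approximation:
  assumes bnd: "bounded \<Omega>" and op: "open \<Omega>" and e: "e > 0"
    and \<phi>: "\<And>x. GDERIV \<phi> x :> D x" "\<And>x. norm (D x) \<le> L" "continuous_on UNIV \<phi>"
    and D: "\<And>x y. norm (x - y) \<le> 1 \<Longrightarrow> norm (D x - D y) \<le> c * norm (x - y)"
  obtains u N where "pw_affine (u :: real^2 \<Rightarrow> real)" "negligible N" "\<And>x. x \<in> closure \<Omega> \<Longrightarrow> \<bar>u x - \<phi> x\<bar> \<le> e"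
    "\<And>x. x \<in> \<Omega> - N \<Longrightarrow> norm (grad u x - D x) \<le> e"
proof -
  have L0: "L \<ge> 0" using \<phi>(2)[of 0] norm_ge_zero[of "D 0"] by linarith
  have c0: "c \<ge> 0"
    using order_trans[OF norm_ge_zero D[of "axis 1 1" 0]] by (simp add: norm_axis_1)
  \<comment> \<open>Makes both errors \<open>L * (2 * h)\<close> and \<open>c * (4 * h)\<close> at
    most \<open>e\<close>.\<close>
  define h where "h = min (1/2) (e / (4 * (L + c + 1)))"
  have h: "h > 0" "2 * h \<le> 1" using e L0 c0 by (auto simp: h_def)
  have "h * (4 * (L + c + 1)) \<le> e / (4 * (L + c + 1)) * (4 * (L + c + 1))"
    using L0 c0 by (intro mult_right_mono) (auto simp: h_def)
  also have "\<dots> = e" using L0 c0 by simp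
  finally have he: "h * (4 * (L + c + 1)) \<le> e" .
  have "L * (2 * h) \<le> h * (4 * (L + c + 1))" "c * (4 * h) \<le> h * (4 * (L + c + 1))"
    using L0 c0 h(1) by (auto simp: algebra_simps)
  then have he': "L * (2 * h) \<le> e" "c * (4 * h) \<le> e" using he by auto
  obtain R where R: "\<And>x. x \<in> \<Omega> \<Longrightarrow> norm x \<le> R" using bnd by (auto simp: bounded_iff)
  define N where "N = \<lceil>R / h\<rceil> + 2"
  define u where "u = grid_interp h N \<phi>"
  define Z where "Z = {x::real^2. x$1 / h \<in> \<int> \<or> x$2 / h \<in> \<int> \<or> (x$1 - x$2) / h \<in> \<int>}"
  have Z: "negligible Z" unfolding Z_def by (rule negligible_grid_lines[OF h(1)])
  have E: "\<bar>u x - \<phi> x\<bar> \<le> L * (2 * h)" "\<exists>w. GDERIV u x :> w \<and> norm (w - D x) \<le> c * (4 * h)" if "x \<in> \<Omega> - Z" for x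
    unfolding u_def using that R[of x]
    by (intro grid_interp_error[OF h _ _ _ \<phi>(1,2) D, of R N x] ; simp add: N_def Z_def)+
  have pu: "pw_affine u" unfolding u_def by (rule pw_affine_grid_interp)
  show thesis
  proof (rule that[OF pu Z])
    fix x assume x: "x \<in> closure \<Omega>"
    have "closed {x. \<bar>u x - \<phi> x\<bar> \<le> e}"
      by (intro closed_Collect_le continuous_intros pw_affine_continuous[OF pu] \<phi>(3))
    moreover have "\<Omega> - Z \<subseteq> {x. \<bar>u x - \<phi> x\<bar> \<le> e}" using E(1) he'(1) by force
    ultimately have "closure (\<Omega> - Z) \<subseteq> {x. \<bar>u x - \<phi> x\<bar> \<le> e}" by (simp add: closure_minimal)
    then show "\<bar>u x - \<phi> x\<bar> \<le> e" using x closure_open_Diff_negligible[OF op Z] by auto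
  next
    fix x assume "x \<in> \<Omega> - Z"
    then obtain w where w: "GDERIV u x :> w" "norm (w - D x) \<le> c * (4 * h)" using E(2) by blast
    then show "norm (grad u x - D x) \<le> e" using grad_eq[OF w(1)] he'(2) by simp
  qed
qed

section \<open>Convergence of areas\<close>

lemma area_difference_le:
  fixes D G :: "real^2 \<Rightarrow> real^2"
  assumes "integrable (lebesgue_on S) (\<lambda>x. sqrt (1 + (norm (D x))\<^sup>2))" "integrable (lebesgue_on S) (\<lambda>x. sqrt (1 + (norm (G x))\<^sup>2))"
    and "integrable (lebesgue_on S) k" "AE x in lebesgue_on S. norm (D x - G x) \<le> k x"
  shows "\<bar>(LINT x|lebesgue_on S. sqrt (1 + (norm (D x))\<^sup>2)) - (LINT x|lebesgue_on S. sqrt (1 + (norm (G x))\<^sup>2))\<bar> \<le> (LINT x|lebesgue_on S. k x)"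
proof -
  let ?d = "\<lambda>x. sqrt (1 + (norm (D x))\<^sup>2) - sqrt (1 + (norm (G x))\<^sup>2)"
  have "norm (LINT x|lebesgue_on S. ?d x) \<le> (LINT x|lebesgue_on S. norm (?d x))" by (rule integral_norm_bound)
  also have "\<dots> \<le> (LINT x|lebesgue_on S. k x)"
  proof (rule integral_mono_AE[OF _ assms(3)])
    show "integrable (lebesgue_on S) (\<lambda>x. norm (?d x))" using assms(1,2) by simp
    show "AE x in lebesgue_on S. norm (?d x) \<le> k x"
      using assms(4)
    proof eventually_elim
      case (elim x)
      then show ?case using sqrt_one_plus_lipschitz[of "D x" "G x"] unfolding real_norm_def by linarith
    qed
  qed
  finally show ?thesis using assms(1,2) by simp
qed

context
  fixes \<Omega> :: "(real^2) set" and g :: "real^2 \<Rightarrow> real" and G :: "real^2 \<Rightarrow> real^2" and L B M :: real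
  assumes dom: "polygonal_domain \<Omega>" and bnd: "bounded \<Omega>"
    and lip: "L-lipschitz_on UNIV g" and gB: "\<And>x. \<bar>g x\<bar> \<le> B"
    and Gm: "G \<in> borel_measurable lebesgue" and GM: "\<And>x. norm (G x) \<le> M"
    and wg: "weak_gradient \<Omega> g G"
begin

lemma domain_facts: "open \<Omega>" "\<Omega> \<in> lmeasurable" "\<Omega> \<in> sets lebesgue"
  using dom bnd by (auto simp: polygonal_domain_def lmeasurable_open)

lemma area_integrable:
  assumes "S \<subseteq> \<Omega>" "S \<in> sets lebesgue"
  shows "integrable (lebesgue_on S) (\<lambda>x. sqrt (1 + (norm (G x))\<^sup>2))"
proof (rule integrable_lebesgue_on_subset[OF _ assms domain_facts(3)])
  show "integrable (lebesgue_on \<Omega>) (\<lambda>x. sqrt (1 + (norm (G x))\<^sup>2))"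
    by (rule integrable_area_integrand[OF domain_facts(2) measurable_lebesgue_on_lebesgue[OF Gm], of M]) (use GM in simp)
qed

lemma gradient_error_integrable: "integrable (lebesgue_on \<Omega>) (\<lambda>x. norm (mollify_grad (eps n) g x - G x))"
proof (rule integrable_norm, rule integrable_lebesgue_on_bounded[OF domain_facts(2), where B = "L + M"])
  show "(\<lambda>x. mollify_grad (eps n) g x - G x) \<in> borel_measurable (lebesgue_on \<Omega>)"
    using mollify_grad_measurable[OF lip gB, of n] Gm by (intro measurable_lebesgue_on_lebesgue borel_measurable_diff)
  have "norm (mollify_grad (eps n) g x - G x) \<le> L + M" for x
    using norm_triangle_ineq4[of "mollify_grad (eps n) g x" "G x"] GM[of x]
      norm_mollify_grad_le[OF _ lip gB, of "eps n" x] by simp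
  then show "AE x in lebesgue_on \<Omega>. norm (mollify_grad (eps n) g x - G x) \<le> L + M" by simp
qed

text \<open>In the distance to \<open>g\<close> the 1 comes from interpolation and
  \<open>2 * L\<close> from mollification. The area integrand is 1-Lipschitz in the gradient, so the
  area error is at most the L1 error of the gradients: \<open>eps n\<close> times the area from
  interpolation, plus that of the mollification. The triangulation \<tau> is the one that gets
  refined.\<close>

lemma recovery_step:
  assumes tri: "triangulation_of \<Omega> \<tau>"
  shows "\<exists>F \<sigma>. triangulation_of \<Omega> \<sigma> \<and> fineness \<sigma> < eps n \<and> continuous_on (closure \<Omega>) F \<and> piecewise_affine \<sigma> F \<and>
     (\<forall>x\<in>closure \<Omega>. \<bar>F x - g x\<bar> \<le> (1 + 2 * L) * eps n) \<and>
     \<bar>elementary_area \<Omega> F - (LINT x|lebesgue_on \<Omega>. sqrt (1 + (norm (G x))\<^sup>2))\<bar>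
       \<le> eps n * measure lebesgue \<Omega> + (LINT x|lebesgue_on \<Omega>. norm (mollify_grad (eps n) g x - G x))"
proof -
  have en: "eps n > 0" by simp
  note gm = lipschitz_measurable[OF lip]
  define c where "c = B * kern_const (eps n) * measure lebesgue (cball 0 (2 * eps n + 1) :: (real^2) set)"
  have d: "GDERIV (mollify (eps n) g) x :> mollify_grad (eps n) g x" for x by (rule GDERIV_mollify[OF en gm gB])
  have dL: "norm (mollify_grad (eps n) g x) \<le> L" for x by (rule norm_mollify_grad_le[OF en lip gB])
  have cc: "continuous_on UNIV (mollify (eps n) g)" by (rule C1_continuous[OF C1_mollify[OF en gm gB]])
  have dl: "norm (mollify_grad (eps n) g x - mollify_grad (eps n) g y) \<le> c * norm (x - y)" if "norm (x - y) \<le> 1" for x y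
    unfolding c_def by (rule mollify_grad_lipschitz[OF en gm gB that])
  obtain u N where u: "pw_affine u" "negligible N" "\<And>x. x \<in> closure \<Omega> \<Longrightarrow> \<bar>u x - mollify (eps n) g x\<bar> \<le> eps n"
    "\<And>x. x \<in> \<Omega> - N \<Longrightarrow> norm (grad u x - mollify_grad (eps n) g x) \<le> eps n"
    by (rule pw_affine_approximation[OF bnd domain_facts(1) en d dL cc dl]) (assumption, rule that)
  obtain \<sigma> where \<sigma>: "triangulation_of \<Omega> \<sigma>" "fineness \<sigma> < eps n" "piecewise_affine \<sigma> u"
    by (rule pw_affine_triangulation[OF dom tri u(1) en]) (rule that)
  have uc: "continuous_on (closure \<Omega>) u" using pw_affine_continuous[OF u(1)] continuous_on_subset by blast
  obtain L' N' where N': "negligible N'" "\<And>x. x \<in> \<Omega> - N' \<Longrightarrow> norm (grad u x) \<le> L'" "grad u \<in> borel_measurable (lebesgue_on \<Omega>)"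
    by (rule piecewise_affine_gradient[OF dom bnd \<sigma>(1) uc \<sigma>(3)]) (rule that)
  have close: "\<bar>u x - g x\<bar> \<le> (1 + 2 * L) * eps n" if "x \<in> closure \<Omega>" for x
  proof -
    have "(1 + 2 * L) * s = s + L * (2 * s)" for s by (simp add: algebra_simps)
    from this[of "eps n"] show ?thesis using u(3)[OF that] mollify_lipschitz_dist[OF en lip gB, of x] by linarith
  qed
  have ie: "integrable (lebesgue_on \<Omega>) (\<lambda>_. eps n)"
    by (rule integrable_lebesgue_on_bounded[OF domain_facts(2), where B = "eps n"]) auto
  have "\<bar>(LINT x|lebesgue_on \<Omega>. sqrt (1 + (norm (grad u x))\<^sup>2)) - (LINT x|lebesgue_on \<Omega>. sqrt (1 + (norm (G x))\<^sup>2))\<bar>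
     \<le> (LINT x|lebesgue_on \<Omega>. eps n + norm (mollify_grad (eps n) g x - G x))"
  proof (rule area_difference_le)
    show "integrable (lebesgue_on \<Omega>) (\<lambda>x. sqrt (1 + (norm (grad u x))\<^sup>2))"
      by (rule integrable_area_integrand[OF domain_facts(2) N'(3)])
         (rule AE_lebesgue_onI[OF N'(1) domain_facts(3)], rule N'(2))
    show "integrable (lebesgue_on \<Omega>) (\<lambda>x. sqrt (1 + (norm (G x))\<^sup>2))" by (rule area_integrable[OF order_refl domain_facts(3)])
    show "integrable (lebesgue_on \<Omega>) (\<lambda>x. eps n + norm (mollify_grad (eps n) g x - G x))"
      by (intro Bochner_Integration.integrable_add ie gradient_error_integrable)
    show "AE x in lebesgue_on \<Omega>. norm (grad u x - G x) \<le> eps n + norm (mollify_grad (eps n) g x - G x)"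
    proof (rule AE_lebesgue_onI[OF u(2) domain_facts(3)])
      fix x assume "x \<in> \<Omega> - N"
      then show "norm (grad u x - G x) \<le> eps n + norm (mollify_grad (eps n) g x - G x)"
        using u(4)[of x] norm_triangle_ineq[of "grad u x - mollify_grad (eps n) g x" "mollify_grad (eps n) g x - G x"] by simp
    qed
  qed
  also have "\<dots> = (LINT x|lebesgue_on \<Omega>. eps n) + (LINT x|lebesgue_on \<Omega>. norm (mollify_grad (eps n) g x - G x))"
    by (rule Bochner_Integration.integral_add[OF ie gradient_error_integrable])
  also have "(LINT x|lebesgue_on \<Omega>. eps n) = eps n * measure lebesgue \<Omega>"
    using domain_facts by (simp add: measure_restrict_space)
  finally show ?thesis
    using \<sigma> uc close unfolding elementary_area_def by blast
qed

lemma gradient_error_tendsto: "(\<lambda>n. LINT x|lebesgue_on \<Omega>. norm (mollify_grad (eps n) g x - G x)) \<longlonglongrightarrow> 0"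
  by (rule mollify_grad_tendsto_L1[OF domain_facts(1) bnd lip gB Gm GM wg order_refl domain_facts(3)])

lemma Lebesgue_area_le:
  assumes tri: "triangulation_of \<Omega> \<tau>" and r: "\<And>x. x \<in> closure \<Omega> \<Longrightarrow> r x = g x"
  shows "Lebesgue_area \<Omega> r \<le> ereal (LINT x|lebesgue_on \<Omega>. sqrt (1 + (norm (G x))\<^sup>2))"
proof -
  let ?A = "LINT x|lebesgue_on \<Omega>. sqrt (1 + (norm (G x))\<^sup>2)"
  define P where "P n F \<sigma> \<longleftrightarrow> triangulation_of \<Omega> \<sigma> \<and> fineness \<sigma> < eps n \<and> continuous_on (closure \<Omega>) F \<and> piecewise_affine \<sigma> F \<and>
     (\<forall>x\<in>closure \<Omega>. \<bar>F x - g x\<bar> \<le> (1 + 2 * L) * eps n) \<and>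
     \<bar>elementary_area \<Omega> F - ?A\<bar> \<le> eps n * measure lebesgue \<Omega> + (LINT x|lebesgue_on \<Omega>. norm (mollify_grad (eps n) g x - G x))" for n F \<sigma>
  have "\<exists>F \<sigma>. P n F \<sigma>" for n unfolding P_def by (rule recovery_step[OF tri])
  then obtain F \<sigma> where P: "\<And>n. P n (F n) (\<sigma> n)" by metis
  have F: "\<And>n. triangulation_of \<Omega> (\<sigma> n)" "\<And>n. fineness (\<sigma> n) < eps n" "\<And>n. continuous_on (closure \<Omega>) (F n)"
     "\<And>n. piecewise_affine (\<sigma> n) (F n)" "\<And>n x. x \<in> closure \<Omega> \<Longrightarrow> \<bar>F n x - g x\<bar> \<le> (1 + 2 * L) * eps n"
     "\<And>n. \<bar>elementary_area \<Omega> (F n) - ?A\<bar> \<le> eps n * measure lebesgue \<Omega> + (LINT x|lebesgue_on \<Omega>. norm (mollify_grad (eps n) g x - G x))"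
    using P unfolding P_def by blast+
  have nonneg: "0 \<le> fineness \<sigma>" if "triangulation_of \<Omega> \<sigma>" for \<sigma>
  proof -
    note t = triangulation_ofD[OF that]
    have "\<Omega> \<noteq> {}" using dom by (simp add: polygonal_domain_def)
    then have "\<Union>\<sigma> \<noteq> {}" unfolding t(3) by simp
    then have "\<sigma> \<noteq> {}" by auto
    then obtain K where K: "K \<in> \<sigma>" by blast
    have "0 \<le> diameter K" by (rule diameter_ge_0[OF triangleD(6)[OF t(2)[OF K]]])
    also have "\<dots> \<le> fineness \<sigma>" unfolding fineness_def using t(1) K by (intro Max_ge) auto
    finally show ?thesis .
  qed
  have fine: "(\<lambda>n. fineness (\<sigma> n)) \<longlonglongrightarrow> 0"
  proof (rule Lim_null_comparison[OF _ eps_tendsto], intro always_eventually allI)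
    show "norm (fineness (\<sigma> n)) \<le> eps n" for n using F(2)[of n] nonneg[OF F(1)[of n]] by simp
  qed
  have ul: "uniform_limit (closure \<Omega>) F r sequentially"
  proof (rule uniform_limitI)
    fix e :: real assume e: "e > 0"
    have L0: "L \<ge> 0" using lip by (rule lipschitz_on_nonneg)
    have "\<forall>\<^sub>F n in sequentially. eps n < e / (1 + 2 * L)" using e L0 by (intro eventually_eps_less) simp
    then show "\<forall>\<^sub>F n in sequentially. \<forall>x\<in>closure \<Omega>. dist (F n x) (r x) < e"
    proof eventually_elim
      case (elim n)
      have "(1 + 2 * L) * eps n < e" using elim L0 by (simp add: pos_less_divide_eq mult.commute del: of_nat_Suc)
      then show ?case using F(5)[of _ n] r by (force simp: dist_real_def)
    qed
  qed
  have "(\<lambda>n. elementary_area \<Omega> (F n) - ?A) \<longlonglongrightarrow> 0"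
  proof (rule Lim_null_comparison)
    show "\<forall>\<^sub>F n in sequentially. norm (elementary_area \<Omega> (F n) - ?A) \<le> eps n * measure lebesgue \<Omega> + (LINT x|lebesgue_on \<Omega>. norm (mollify_grad (eps n) g x - G x))"
      using F(6) by simp
    show "(\<lambda>n. eps n * measure lebesgue \<Omega> + (LINT x|lebesgue_on \<Omega>. norm (mollify_grad (eps n) g x - G x))) \<longlonglongrightarrow> 0"
      using tendsto_add[OF tendsto_mult_right[OF eps_tendsto, of "measure lebesgue \<Omega>"] gradient_error_tendsto] by simp
  qed
  then have "(\<lambda>n. ereal (elementary_area \<Omega> (F n))) \<longlonglongrightarrow> ereal ?A"
    by (simp add: LIM_zero_iff)
  then have "liminf (\<lambda>n. ereal (elementary_area \<Omega> (F n))) = ereal ?A"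
    by (intro lim_imp_Liminf) auto
  moreover have "Lebesgue_area \<Omega> r \<le> liminf (\<lambda>n. ereal (elementary_area \<Omega> (F n)))"
    unfolding Lebesgue_area_def by (rule Inf_lower) (use F fine ul in blast)
  ultimately show ?thesis by simp
qed

text \<open>One mollified gradient \<open>H\<close> is fixed with L1 distance below r/4 from
  \<open>G\<close>. It is uniformly continuous on the compact closure, so for fine triangulations
  its oscillation on every triangle is at most \<open>e\<close>, and the errors on the triangles add
  up to less than 2 r/4 + e m.\<close>

lemma mean_gradient_areas_tendsto:
  assumes tri: "\<And>k. triangulation_of \<Omega> (\<tau> k)" and fine: "(\<lambda>k. fineness (\<tau> k)) \<longlonglongrightarrow> 0"
  shows "(\<lambda>k. \<Sum>K\<in>\<tau> k. measure lebesgue K * sqrt (1 + (norm ((LINT x|lebesgue_on (interior K). G x) /\<^sub>R measure lebesgue K))\<^sup>2))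
    \<longlonglongrightarrow> (LINT x|lebesgue_on \<Omega>. sqrt (1 + (norm (G x))\<^sup>2))"
proof (rule tendstoI)
  fix r :: real assume r: "r > 0"
  define m where "m = measure lebesgue \<Omega>"
  have m0: "m \<ge> 0" by (simp add: m_def)
  have "\<forall>\<^sub>F n in sequentially. (LINT x|lebesgue_on \<Omega>. norm (mollify_grad (eps n) g x - G x)) < r / 4"
    using order_tendstoD(2)[OF gradient_error_tendsto, of "r/4"] r by simp
  then obtain n where n: "(LINT x|lebesgue_on \<Omega>. norm (mollify_grad (eps n) g x - G x)) < r / 4"
    using eventually_happens'[OF sequentially_bot] by blast
  define H where "H = mollify_grad (eps n) g"
  \<comment> \<open>Chosen with e (m + 1) = r/4, so that e m stays below r/2.\<close>
  define e where "e = r / (4 * (m + 1))"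
  have e0: "e > 0" using r m0 by (simp add: e_def)
  have "r / (4 * s) * s = r / 4" if "s > 0" for s using that by simp
  from this[of "m + 1"] have "e * (m + 1) = r / 4" using m0 unfolding e_def by simp
  then have "e * m + e = r / 4" by (simp add: distrib_left)
  then have e: "e > 0" "e * m < r / 2" using r e0 by linarith+
  have Hc: "continuous_on (closure \<Omega>) H"
    unfolding H_def using continuous_mollify_grad[OF _ lipschitz_measurable[OF lip] gB, of "eps n"] continuous_on_subset by auto
  have "uniformly_continuous_on (closure \<Omega>) H"
    using bnd by (intro compact_uniformly_continuous[OF Hc]) simp
  then obtain \<delta> where \<delta>: "\<delta> > 0" "\<And>x y. x \<in> closure \<Omega> \<Longrightarrow> y \<in> closure \<Omega> \<Longrightarrow> dist y x < \<delta> \<Longrightarrow> dist (H y) (H x) < e"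
    by (rule uniformly_continuous_onE[OF _ e(1)]) (rule that)
  have Hm: "H \<in> borel_measurable lebesgue" unfolding H_def by (rule mollify_grad_measurable[OF lip gB])
  have HL: "norm (H x) \<le> L" for x unfolding H_def by (rule norm_mollify_grad_le[OF _ lip gB]) simp
  have "\<forall>\<^sub>F k in sequentially. fineness (\<tau> k) < \<delta>" using order_tendstoD(2)[OF fine \<delta>(1)] .
  then show "\<forall>\<^sub>F k in sequentially. dist (\<Sum>K\<in>\<tau> k. measure lebesgue K * sqrt (1 + (norm ((LINT x|lebesgue_on (interior K). G x) /\<^sub>R measure lebesgue K))\<^sup>2))
    (LINT x|lebesgue_on \<Omega>. sqrt (1 + (norm (G x))\<^sup>2)) < r"
  proof eventually_elim
    case (elim k)
    note t = triangulation_ofD[OF tri[of k]]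
    have iU: "interior K \<subseteq> \<Omega>" if "K \<in> \<tau> k" for K by (rule triangle_interior_subset[OF dom tri that])
    have part: "(LINT x|lebesgue_on \<Omega>. w x) = (\<Sum>K\<in>\<tau> k. LINT x|lebesgue_on (interior K). w x)"
      if "integrable (lebesgue_on \<Omega>) w" for w :: "real^2 \<Rightarrow> real"
    proof (rule integral_lebesgue_on_partition[OF that domain_facts(3) t(1)])
      show "negligible (\<Omega> - (\<Union>K\<in>\<tau> k. interior K))"
        by (rule negligible_subset[OF triangulation_negligible_rest[OF tri]]) (use closure_subset[of \<Omega>] in blast)
      show "interior K \<inter> interior K' = {}" if "K \<in> \<tau> k" "K' \<in> \<tau> k" "K \<noteq> K'" for K K'
        using triangulation_interior_disjoint[OF tri that] interior_subset[of K] by blast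
    qed (use iU in auto)
    let ?S = "\<lambda>K. measure lebesgue K * sqrt (1 + (norm ((LINT x|lebesgue_on (interior K). G x) /\<^sub>R measure lebesgue K))\<^sup>2)"
    let ?d = "\<lambda>x. norm (G x - H x)"
    have dcomm: "?d = (\<lambda>x. norm (mollify_grad (eps n) g x - G x))" by (simp add: H_def norm_minus_commute)
    have id: "integrable (lebesgue_on \<Omega>) ?d" unfolding dcomm by (rule gradient_error_integrable)
    have i1: "integrable (lebesgue_on \<Omega>) (\<lambda>_. e)"
      by (rule integrable_lebesgue_on_bounded[OF domain_facts(2), where B = "\<bar>e\<bar>"]) auto
    have "(\<Sum>K\<in>\<tau> k. ?S K) - (LINT x|lebesgue_on \<Omega>. sqrt (1 + (norm (G x))\<^sup>2))
      = (\<Sum>K\<in>\<tau> k. ?S K - (LINT x|lebesgue_on (interior K). sqrt (1 + (norm (G x))\<^sup>2)))"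
      unfolding part[OF area_integrable[OF order_refl domain_facts(3)]] by (simp add: sum_subtractf)
    also have "\<bar>\<dots>\<bar> \<le> (\<Sum>K\<in>\<tau> k. 2 * (LINT x|lebesgue_on (interior K). ?d x) + e * measure lebesgue K)"
    proof (rule order_trans[OF sum_abs], rule sum_mono)
      fix K assume K: "K \<in> \<tau> k"
      note mK = measure_triangle[OF t(2)[OF K]]
      show "\<bar>?S K - (LINT x|lebesgue_on (interior K). sqrt (1 + (norm (G x))\<^sup>2))\<bar> \<le> 2 * (LINT x|lebesgue_on (interior K). ?d x) + e * measure lebesgue K"
      proof (rule mean_gradient_error[OF t(2)[OF K]])
        show "integrable (lebesgue_on (interior K)) G"
          using GM by (intro integrable_lebesgue_on_bounded[OF mK(2) measurable_lebesgue_on_lebesgue[OF Gm], where B = M]) simp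
        show "integrable (lebesgue_on (interior K)) H"
          using HL by (intro integrable_lebesgue_on_bounded[OF mK(2) measurable_lebesgue_on_lebesgue[OF Hm], where B = L]) simp
        fix x y assume xy: "x \<in> K" "y \<in> K"
        have "dist x y \<le> diameter K" by (rule diameter_bounded_bound[OF triangleD(6)[OF t(2)[OF K]] xy])
        also have "\<dots> \<le> fineness (\<tau> k)" unfolding fineness_def using t(1) K by (intro Max_ge) auto
        finally have "dist x y < \<delta>" using elim by simp
        then have "dist (H x) (H y) < e" using \<delta>(2)[of y x] xy t(5)[OF K] by auto
        then show "norm (H x - H y) \<le> e" by (simp add: dist_norm)
      qed
    qed
    also have "\<dots> = 2 * (LINT x|lebesgue_on \<Omega>. ?d x) + e * m"
    proof -
      have "(\<Sum>K\<in>\<tau> k. e * measure lebesgue K) = (\<Sum>K\<in>\<tau> k. LINT x|lebesgue_on (interior K). e)"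
        using measure_triangle(2,3)[OF t(2)] by (intro sum.cong) (auto simp: measure_restrict_space)
      also have "\<dots> = e * m" unfolding part[OF i1, symmetric] m_def
        using domain_facts by (simp add: measure_restrict_space)
      finally show ?thesis unfolding part[OF id] by (simp add: sum.distrib sum_distrib_left)
    qed
    also have "\<dots> < r" using n e(2) unfolding dcomm by simp
    finally show ?case by (simp add: dist_real_def)
  qed
qed

end

section \<open>Conclusion\<close>

text \<open>Mollification integrates over the whole plane and asks for a bounded measurable function
  there, whereas the data are given on a set and bounded up to a null set.\<close>

lemma measurable_truncation:
  fixes h :: "'a::euclidean_space \<Rightarrow> 'b::euclidean_space"
  assumes "h \<in> borel_measurable (lebesgue_on S)" "S \<in> sets lebesgue" "AE x in lebesgue_on S. norm (h x) \<le> M"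
  obtains h' N where "h' \<in> borel_measurable lebesgue" "\<And>x. norm (h' x) \<le> \<bar>M\<bar>" "negligible N" "\<And>x. x \<in> S - N \<Longrightarrow> h' x = h x"
proof -
  obtain N where N: "negligible N" "\<And>x. x \<in> S - N \<Longrightarrow> norm (h x) \<le> M"
    by (rule AE_lebesgue_onE[OF assms(3,2)]) (rule that)
  define h' where "h' x = (if x \<in> S then (if norm (h x) \<le> M then h x else 0) else 0)" for x
  have "(\<lambda>x. if norm (h x) \<le> M then h x else 0) \<in> borel_measurable (lebesgue_on S)"
    by (rule borel_measurable_lebesgue_on_spike[OF assms(1,2) N(1)]) (use N(2) in auto)
  then have "h' \<in> borel_measurable lebesgue"
    unfolding h'_def using assms(2) by (subst borel_measurable_if)
  moreover have "norm (h' x) \<le> \<bar>M\<bar>" for x by (auto simp: h'_def)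
  moreover have "h' x = h x" if "x \<in> S - N" for x using that N(2) by (auto simp: h'_def)
  ultimately show thesis using that N(1) by blast
qed

text \<open>The bound for the weak gradient yields a Lipschitz estimate only along segments in
  \<Omega>. It is carried over to the closed triangles of \<tau>, glued over common faces to a
  Lipschitz function on the closure with a possibly larger constant, and extended to the
  plane.\<close>

lemma W_1_infinity_lipschitz_representative:
  assumes bnd: "bounded \<Omega>" and dom: "polygonal_domain \<Omega>" and tri: "triangulation_of \<Omega> \<tau>" and W: "W_1_infinity \<Omega> f"
  obtains g G L B M N where "L-lipschitz_on UNIV g" "\<And>x. \<bar>g x\<bar> \<le> B" "G \<in> borel_measurable lebesgue" "\<And>x. norm (G x) \<le> M"
    "weak_gradient \<Omega> g G" "f \<in> borel_measurable (lebesgue_on \<Omega>)" "negligible N" "\<And>x. x \<in> \<Omega> - N \<Longrightarrow> f x = g x"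
proof -
  have op: "open \<Omega>" "\<Omega> \<noteq> {}" and m\<Omega>: "\<Omega> \<in> sets lebesgue" using dom by (auto simp: polygonal_domain_def)
  obtain G1 M0 M1 where f: "f \<in> borel_measurable (lebesgue_on \<Omega>)" "AE x in lebesgue_on \<Omega>. norm (f x) \<le> M0"
    and G1: "G1 \<in> borel_measurable (lebesgue_on \<Omega>)" "AE x in lebesgue_on \<Omega>. norm (G1 x) \<le> M1" "weak_gradient \<Omega> f G1"
    using W unfolding W_1_infinity_def L_infinity_def by blast
  obtain u N0 where u: "u \<in> borel_measurable lebesgue" "\<And>x. norm (u x) \<le> \<bar>M0\<bar>" "negligible N0" "\<And>x. x \<in> \<Omega> - N0 \<Longrightarrow> u x = f x"
    by (rule measurable_truncation[OF f(1) m\<Omega> f(2)]) (rule that)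
  obtain G N1 where G: "G \<in> borel_measurable lebesgue" "\<And>x. norm (G x) \<le> \<bar>M1\<bar>" "negligible N1" "\<And>x. x \<in> \<Omega> - N1 \<Longrightarrow> G x = G1 x"
    by (rule measurable_truncation[OF G1(1) m\<Omega> G1(2)]) (rule that)
  have mu: "u \<in> borel_measurable (lebesgue_on \<Omega>)" and mG: "G \<in> borel_measurable (lebesgue_on \<Omega>)"
    using u(1) G(1) by (auto intro: measurable_lebesgue_on_lebesgue)
  have wu: "weak_gradient \<Omega> u G"
    by (rule weak_gradient_cong_AE[OF G1(3) m\<Omega>, of "N0 \<union> N1"]) (use u(3,4) G(3,4) f G1 mu mG in auto)
  obtain N2 where N2: "negligible N2"
    "\<And>x y. x \<notin> N2 \<Longrightarrow> y \<notin> N2 \<Longrightarrow> closed_segment x y \<subseteq> \<Omega> \<Longrightarrow> \<bar>u x - u y\<bar> \<le> \<bar>M1\<bar> * norm (x - y)"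
    by (rule weak_gradient_AE_lipschitz[OF op(1) u(1) u(2)[unfolded real_norm_def] G(1,2) wu]) (rule that)
  obtain g1 where g1: "\<And>K. K \<in> \<tau> \<Longrightarrow> \<bar>M1\<bar>-lipschitz_on K g1" "\<And>K x. K \<in> \<tau> \<Longrightarrow> x \<in> interior K - N2 \<Longrightarrow> g1 x = u x"
    by (rule continuous_representative_exists[OF dom tri N2 abs_ge_zero]) (assumption, assumption, assumption, rule that)
  obtain C where C: "C-lipschitz_on (closure \<Omega>) g1" using lipschitz_on_triangulation[OF tri g1(1)] by blast
  have "compact (closure \<Omega>)" using bnd by simp
  then have "bounded (g1 ` closure \<Omega>)"
    using C by (intro compact_imp_bounded compact_continuous_image lipschitz_on_continuous_on)
  then obtain B where B: "\<And>x. x \<in> closure \<Omega> \<Longrightarrow> \<bar>g1 x\<bar> \<le> B" by (auto simp: bounded_iff)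
  have cne: "closure \<Omega> \<noteq> {}" using op(2) by simp
  obtain g where g: "C-lipschitz_on UNIV g" "\<And>x. x \<in> closure \<Omega> \<Longrightarrow> g x = g1 x" "\<And>x. \<bar>g x\<bar> \<le> B"
    by (rule lipschitz_extension_real[OF C cne B]) (assumption, rule that)
  define N where "N = N0 \<union> N2 \<union> (closure \<Omega> - (\<Union>K\<in>\<tau>. interior K))"
  have N: "negligible N" unfolding N_def using u(3) N2(1) triangulation_negligible_rest[OF tri] by simp
  have fg: "f x = g x \<and> u x = g x" if x: "x \<in> \<Omega> - N" for x
  proof -
    have xc: "x \<in> closure \<Omega>" using x closure_subset by blast
    then obtain K where K: "K \<in> \<tau>" "x \<in> interior K" using x by (auto simp: N_def)
    have "g x = u x" using g(2)[OF xc] g1(2)[OF K(1), of x] K(2) x by (auto simp: N_def)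
    moreover have "u x = f x" using u(4) x by (auto simp: N_def)
    ultimately show ?thesis by simp
  qed
  have "weak_gradient \<Omega> g G"
    by (rule weak_gradient_cong_AE[OF wu m\<Omega> N])
       (use fg mu mG measurable_lebesgue_on_lebesgue[OF lipschitz_measurable[OF g(1)]] in auto)
  then show thesis using that[of C g B G "\<bar>M1\<bar>" N] g(1,3) G(1,2) f(1) N fg by blast
qed

text \<open>\<open>g\<close> shows that the choice is possible, and two continuous functions that
  agree almost everywhere on an open set agree on a dense subset of its closure.\<close>

lemma continuous_rep_eq:
  assumes op: "open \<Omega>" and g: "continuous_on (closure \<Omega>) g" and N: "negligible N" "\<And>x. x \<in> \<Omega> - N \<Longrightarrow> f x = g x"
    and x: "x \<in> closure \<Omega>"
  shows "continuous_rep \<Omega> f x = g x"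
proof -
  have m\<Omega>: "\<Omega> \<in> sets lebesgue" using op by simp
  define r where "r = continuous_rep \<Omega> f"
  have "AE x in lebesgue_on \<Omega>. g x = f x" by (rule AE_lebesgue_onI[OF N(1) m\<Omega>]) (use N(2) in simp)
  then have "continuous_on (closure \<Omega>) r \<and> (AE x in lebesgue_on \<Omega>. r x = f x)"
    unfolding r_def continuous_rep_def using g by (intro someI[of "\<lambda>g. continuous_on (closure \<Omega>) g \<and> (AE x in lebesgue_on \<Omega>. g x = f x)"]) simp
  then have rc: "continuous_on (closure \<Omega>) r" and ae: "AE x in lebesgue_on \<Omega>. r x = f x" by auto
  obtain N' where N': "negligible N'" "\<And>x. x \<in> \<Omega> - N' \<Longrightarrow> r x = f x"
    by (rule AE_lebesgue_onE[OF ae m\<Omega>]) (rule that)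
  let ?S = "\<Omega> - (N \<union> N')"
  have cl: "closure ?S = closure \<Omega>" using N(1) N'(1) by (intro closure_open_Diff_negligible[OF op]) simp
  have "r x - g x = 0"
  proof (rule continuous_constant_on_closure[of ?S "\<lambda>x. r x - g x"])
    show "continuous_on (closure ?S) (\<lambda>x. r x - g x)" unfolding cl by (intro continuous_intros rc g)
    show "r y - g y = 0" if "y \<in> ?S" for y using that N(2) N'(2) by auto
    show "x \<in> closure ?S" unfolding cl by (rule x)
  qed
  then show ?thesis by (simp add: r_def)
qed

theorem theorem5p1:
  fixes \<Omega> :: "(real^2) set" and \<tau> :: "nat \<Rightarrow> (real^2) set set" and f :: "real^2 \<Rightarrow> real"
  assumes "bounded \<Omega>" and "polygonal_domain \<Omega>"
    and "\<And>k. triangulation_of \<Omega> (\<tau> k)"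
    and "(\<lambda>k. fineness (\<tau> k)) \<longlonglongrightarrow> 0"
    and "W_1_infinity \<Omega> f"
  shows "(\<lambda>k. ereal (CR_area (\<tau> k) f)) \<longlonglongrightarrow> Lebesgue_area \<Omega> (continuous_rep \<Omega> f)"
proof -
  note bnd = assms(1) and dom = assms(2) and tri = assms(3)
  have op: "open \<Omega>" using dom by (simp add: polygonal_domain_def)
  obtain g G L B M N where g: "L-lipschitz_on UNIV g" "\<And>x. \<bar>g x\<bar> \<le> B" and G: "G \<in> borel_measurable lebesgue" "\<And>x. norm (G x) \<le> M"
    and wg: "weak_gradient \<Omega> g G" and f: "f \<in> borel_measurable (lebesgue_on \<Omega>)" "negligible N" "\<And>x. x \<in> \<Omega> - N \<Longrightarrow> f x = g x"
    by (rule W_1_infinity_lipschitz_representative[OF bnd dom tri[of 0] assms(5)]) (rule that)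
  have gc: "continuous_on (closure \<Omega>) g" using g(1) lipschitz_on_continuous_on continuous_on_subset by blast
  define r where "r = continuous_rep \<Omega> f"
  have r: "r x = g x" if "x \<in> closure \<Omega>" for x
    unfolding r_def by (rule continuous_rep_eq[OF op gc f(2,3) that])
  define S where "S k = (\<Sum>K\<in>\<tau> k. measure lebesgue K * sqrt (1 + (norm ((LINT x|lebesgue_on (interior K). G x) /\<^sub>R measure lebesgue K))\<^sup>2))" for k
  let ?A = "LINT x|lebesgue_on \<Omega>. sqrt (1 + (norm (G x))\<^sup>2)"
  have CR: "CR_area (\<tau> k) f = S k" for k
    unfolding CR_area_def S_def
  proof (rule sum.cong[OF refl])
    fix K assume K: "K \<in> \<tau> k"
    have K2: "2 simplex K" by (rule triangulation_ofD(2)[OF tri K])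
    note tr = has_trace_lipschitz[OF op bnd g G wg K2 triangle_interior_subset[OF dom tri K] f]
    show "elementary_area K (CR_interpolant K f) =
      measure lebesgue K * sqrt (1 + (norm ((LINT x|lebesgue_on (interior K). G x) /\<^sub>R measure lebesgue K))\<^sup>2)"
      by (rule elementary_area_CR_interpolant[OF K2 tr(1,3,2)])
  qed
  have lim: "S \<longlonglongrightarrow> ?A"
    unfolding S_def by (rule mean_gradient_areas_tendsto[OF dom bnd g G wg tri assms(4)])
  have lower: "ereal (S k) \<le> Lebesgue_area \<Omega> r" for k
    unfolding Lebesgue_area_def
  proof (rule Inf_greatest)
    fix a assume "a \<in> {liminf (\<lambda>n. ereal (elementary_area \<Omega> (F n))) | F \<sigma>.
       (\<forall>n. triangulation_of \<Omega> (\<sigma> n)) \<and> (\<lambda>n. fineness (\<sigma> n)) \<longlonglongrightarrow> 0 \<and>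
       (\<forall>n. continuous_on (closure \<Omega>) (F n) \<and> piecewise_affine (\<sigma> n) (F n)) \<and>
       uniform_limit (closure \<Omega>) F r sequentially}"
    then obtain F \<sigma> where F: "a = liminf (\<lambda>n. ereal (elementary_area \<Omega> (F n)))" "\<And>n. triangulation_of \<Omega> (\<sigma> n)"
      "\<And>n. continuous_on (closure \<Omega>) (F n)" "\<And>n. piecewise_affine (\<sigma> n) (F n)" "uniform_limit (closure \<Omega>) F r sequentially"
      by blast
    have ul: "uniform_limit (closure \<Omega>) F g sequentially"
      using F(5) by (rule uniform_limit_cong'[THEN iffD1, rotated -1]) (use r in auto)
    show "ereal (S k) \<le> a"
      unfolding S_def F(1)
      by (rule liminf_area_ge_mean_gradients[OF dom bnd F(2) F(3) F(4) ul wg G tri])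
  qed
  have upper: "Lebesgue_area \<Omega> r \<le> ereal ?A"
    by (rule Lebesgue_area_le[OF dom bnd g G wg tri[of 0] r])
  have lim': "(\<lambda>k. ereal (S k)) \<longlonglongrightarrow> ereal ?A" using lim by simp
  have "ereal ?A \<le> Lebesgue_area \<Omega> r" by (rule LIMSEQ_le_const2[OF lim']) (use lower in blast)
  then have "Lebesgue_area \<Omega> r = ereal ?A" using upper by (rule antisym[rotated])
  then show ?thesis using lim' by (simp add: CR r_def)
qed

end
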